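(* Let $R$ be a commutative noetherian ring and let $A$ be an $R$-algebra with property $\mathbf{P_\ell}$. Then: (1) $A^\circ$ is an $R$-coalgebra. If in addition $A$ is a bialgebra (resp. Hopf algebra), then $A^\circ$ is a bialgebra (resp. Hopf algebra). (2) $(A^\circ,A,\langle-,-\rangle)$, with $\langle f,a\rangle=f(a)$, is a rational pairing.
   Context: Algebras are associative with unit; $\otimes=\otimes_R$. $A^*=\mathrm{Hom}_R(A,R)$ is a left $A$-module via $(af)(b)=f(ba)$, and $A^\circ=\{f\in A^*: Af\text{ is a finitely generated }R\text{-module}\}$. Property $\mathbf{P_\ell}$: for every left ideal $I$ of $A$ with $A/I$ finitely generated as an $R$-module, there is a left ideal $I_0\subseteq I$ of $A$ with $A/I_0$ finitely generated and projective as an $R$-module. The coalgebra structure on $A^\circ$ is the canonical one: $\Delta(f)=\sum f_1\otimes f_2\in A^\circ\otimes A^\circ$ determined by $f(ab)=\sum f_1(a)f_2(b)$ for all $a,b\in A$, and $\epsilon(f)=f(1)$. When $A$ is a bialgebra, the multiplication on $A^\circ$ is convolution $(fg)(a)=\sum f(a_1)g(a_2)$ with unit the counit of $A$; when $A$ is a Hopf algebra with antipode $S$, the antipode of $A^\circ$ is $f\mapsto f\circ S$. Rational pairing: a triple $(C,A,\langle-,-\rangle)$ with $C$ an $R$-coalgebra, $A$ an $R$-algebra and $\langle-,-\rangle:C\times A\to R$ an $R$-bilinear form such that for every $R$-module $M$ the map $\alpha_M:M\otimes C\to\mathrm{Hom}_R(A,M)$, $m\otimes c\mapsto[a\mapsto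 m\langle c,a\rangle]$, is injective, and the map $A\to C^*$, $a\mapsto\langle-,a\rangle$, is a homomorphism of $R$-algebras into the convolution algebra $C^*=\mathrm{Hom}_R(C,R)$. *)

theory Defs
  imports "HOL-Algebra.Module" "HOL-Algebra.QuotRing" "HOL-Algebra.Ring_Divisibility"
begin

section \<open>Modules over a commutative ring\<close>

text \<open>
  Modules are records of the library type \<open>module\<close>. Records built below for structures that are
  only modules leave the ring operations \<open>mult\<close> and \<open>one\<close> unspecified.
\<close>

definition mod_hom ::
  "('r, 'x) ring_scheme \<Rightarrow> ('r, 'm, 'y) module_scheme \<Rightarrow> ('r, 'n, 'z) module_scheme \<Rightarrow> ('m \<Rightarrow> 'n) set"
  where "mod_hom R M N = {h. h \<in> carrier M \<rightarrow> carrier N \<and>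
    (\<forall>x\<in>carrier M. \<forall>y\<in>carrier M. h (x \<oplus>\<^bsub>M\<^esub> y) = h x \<oplus>\<^bsub>N\<^esub> h y) \<and>
    (\<forall>r\<in>carrier R. \<forall>x\<in>carrier M. h (r \<odot>\<^bsub>M\<^esub> x) = r \<odot>\<^bsub>N\<^esub> h x)}"

definition ring_module :: "('r, 'x) ring_scheme \<Rightarrow> ('r, 'r) module"
  where "ring_module R = \<lparr>carrier = carrier R, mult = mult R, one = \<one>\<^bsub>R\<^esub>, zero = \<zero>\<^bsub>R\<^esub>, add = add R,
    smult = mult R\<rparr>"

text \<open>Linear maps are made extensional, so that they are determined by their values on the carrier.\<close>

definition hom_module ::
  "('r, 'x) ring_scheme \<Rightarrow> ('r, 'm, 'y) module_scheme \<Rightarrow> ('r, 'n, 'z) module_scheme \<Rightarrow> ('r, 'm \<Rightarrow> 'n) module"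
  where "hom_module R M N = \<lparr>carrier = mod_hom R M N \<inter> extensional (carrier M),
    mult = undefined, one = undefined,
    zero = (\<lambda>x\<in>carrier M. \<zero>\<^bsub>N\<^esub>),
    add = (\<lambda>f g. \<lambda>x\<in>carrier M. f x \<oplus>\<^bsub>N\<^esub> g x),
    smult = (\<lambda>r f. \<lambda>x\<in>carrier M. r \<odot>\<^bsub>N\<^esub> f x)\<rparr>"

definition dual_module :: "('r, 'x) ring_scheme \<Rightarrow> ('r, 'm, 'y) module_scheme \<Rightarrow> ('r, 'm \<Rightarrow> 'r) module"
  where "dual_module R M = hom_module R M (ring_module R)"

definition module_span :: "('r, 'x) ring_scheme \<Rightarrow> ('r, 'm, 'y) module_scheme \<Rightarrow> 'm set \<Rightarrow> 'm set"
  where "module_span R M S = \<Inter>{N. submodule N R M \<and> S \<subseteq> N}"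

definition finitely_generated :: "('r, 'x) ring_scheme \<Rightarrow> ('r, 'm, 'y) module_scheme \<Rightarrow> bool"
  where "finitely_generated R M \<longleftrightarrow>
    (\<exists>S. finite S \<and> S \<subseteq> carrier M \<and> module_span R M S = carrier M)"

definition quotient_module :: "('r, 'm, 'y) module_scheme \<Rightarrow> 'm set \<Rightarrow> ('r, 'm set) module"
  where "quotient_module M N = \<lparr>carrier = a_rcosets\<^bsub>M\<^esub> N, mult = undefined, one = undefined,
    zero = N, add = set_add M,
    smult = (\<lambda>r X. \<Union>x\<in>X. N +>\<^bsub>M\<^esub> (r \<odot>\<^bsub>M\<^esub> x))\<rparr>"

text \<open>
  Projectivity as the lifting property against surjections \<open>g : M \<rightarrow> N\<close>. A definition cannot quantify
  over types, so the carriers of the test modules are drawn from two fixed types. They are large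
  enough: they contain the free module on \<open>carrier P\<close> and \<open>P\<close> itself, and the lifting property for
  the canonical surjection between these two makes \<open>P\<close> a direct summand of a free module, which
  gives the lifting property for modules over arbitrary types.
\<close>

definition projective_module :: "('r, 'x) ring_scheme \<Rightarrow> ('r, 'p) module \<Rightarrow> bool"
  where "projective_module R P \<longleftrightarrow> module R P \<and>
    (\<forall>(M :: ('r, 'p \<Rightarrow> 'r) module) (N :: ('r, 'p) module) g f.
      module R M \<and> module R N \<and> g \<in> mod_hom R M N \<and> g ` carrier M = carrier N \<and> f \<in> mod_hom R P N \<longrightarrow>
      (\<exists>h\<in>mod_hom R P M. \<forall>x\<in>carrier P. g (h x) = f x))"


section \<open>Tensor products\<close>

definition free_module :: "('r, 'x) ring_scheme \<Rightarrow> 'b set \<Rightarrow> ('r, 'b \<Rightarrow> 'r) module"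
  where "free_module R X = \<lparr>
    carrier = {w. (\<forall>x\<in>X. w x \<in> carrier R) \<and> (\<forall>x. x \<notin> X \<longrightarrow> w x = \<zero>\<^bsub>R\<^esub>) \<and> finite {x. w x \<noteq> \<zero>\<^bsub>R\<^esub>}},
    mult = undefined, one = undefined,
    zero = (\<lambda>x. \<zero>\<^bsub>R\<^esub>),
    add = (\<lambda>v w x. v x \<oplus>\<^bsub>R\<^esub> w x),
    smult = (\<lambda>r w x. r \<otimes>\<^bsub>R\<^esub> w x)\<rparr>"

definition free_gen :: "('r, 'x) ring_scheme \<Rightarrow> 'b \<Rightarrow> 'b \<Rightarrow> 'r"
  where "free_gen R x = (\<lambda>y. if y = x then \<one>\<^bsub>R\<^esub> else \<zero>\<^bsub>R\<^esub>)"

abbreviation free_prod ::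
  "('r, 'x) ring_scheme \<Rightarrow> ('r, 'm, 'y) module_scheme \<Rightarrow> ('r, 'n, 'z) module_scheme \<Rightarrow> ('r, 'm \<times> 'n \<Rightarrow> 'r) module"
  where "free_prod R M N \<equiv> free_module R (carrier M \<times> carrier N)"

definition tensor_relations ::
  "('r, 'x) ring_scheme \<Rightarrow> ('r, 'm, 'y) module_scheme \<Rightarrow> ('r, 'n, 'z) module_scheme \<Rightarrow> ('m \<times> 'n \<Rightarrow> 'r) set"
  where "tensor_relations R M N = (let F = free_prod R M N; e = (\<lambda>m n. free_gen R (m, n)) in
      {e (m \<oplus>\<^bsub>M\<^esub> m') n \<ominus>\<^bsub>F\<^esub> (e m n \<oplus>\<^bsub>F\<^esub> e m' n) | m m' n. m \<in> carrier M \<and> m' \<in> carrier M \<and> n \<in> carrier N}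
    \<union> {e m (n \<oplus>\<^bsub>N\<^esub> n') \<ominus>\<^bsub>F\<^esub> (e m n \<oplus>\<^bsub>F\<^esub> e m n') | m n n'. m \<in> carrier M \<and> n \<in> carrier N \<and> n' \<in> carrier N}
    \<union> {e (r \<odot>\<^bsub>M\<^esub> m) n \<ominus>\<^bsub>F\<^esub> r \<odot>\<^bsub>F\<^esub> e m n | r m n. r \<in> carrier R \<and> m \<in> carrier M \<and> n \<in> carrier N}
    \<union> {e m (r \<odot>\<^bsub>N\<^esub> n) \<ominus>\<^bsub>F\<^esub> r \<odot>\<^bsub>F\<^esub> e m n | r m n. r \<in> carrier R \<and> m \<in> carrier M \<and> n \<in> carrier N})"

definition tensor_kernel ::
  "('r, 'x) ring_scheme \<Rightarrow> ('r, 'm, 'y) module_scheme \<Rightarrow> ('r, 'n, 'z) module_scheme \<Rightarrow> ('m \<times> 'n \<Rightarrow> 'r) set"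
  where "tensor_kernel R M N = module_span R (free_prod R M N) (tensor_relations R M N)"

definition tensor ::
  "('r, 'x) ring_scheme \<Rightarrow> ('r, 'm, 'y) module_scheme \<Rightarrow> ('r, 'n, 'z) module_scheme \<Rightarrow> ('r, ('m \<times> 'n \<Rightarrow> 'r) set) module"
  where "tensor R M N = quotient_module (free_prod R M N) (tensor_kernel R M N)"

definition pure_tensor ::
  "('r, 'x) ring_scheme \<Rightarrow> ('r, 'm, 'y) module_scheme \<Rightarrow> ('r, 'n, 'z) module_scheme \<Rightarrow> 'm \<Rightarrow> 'n \<Rightarrow> ('m \<times> 'n \<Rightarrow> 'r) set"
  where "pure_tensor R M N m n = tensor_kernel R M N +>\<^bsub>free_prod R M N\<^esub> free_gen R (m, n)"

text \<open>
  The linear map \<open>\<Sum> m\<^sub>i \<otimes> n\<^sub>i \<mapsto> \<Sum> \<beta> m\<^sub>i n\<^sub>i\<close> into \<open>P\<close> induced by a bilinear map \<open>\<beta>\<close>. The formal sums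
  \<open>w\<close> in a coset \<open>t\<close> all have the same value when \<open>\<beta>\<close> is bilinear.
\<close>

definition tensor_lift ::
  "('r, 'x) ring_scheme \<Rightarrow> ('r, 'p, 'y) module_scheme \<Rightarrow> ('m \<Rightarrow> 'n \<Rightarrow> 'p) \<Rightarrow> ('m \<times> 'n \<Rightarrow> 'r) set \<Rightarrow> 'p"
  where "tensor_lift R P \<beta> t =
    the_elem ((\<lambda>w. \<Oplus>\<^bsub>P\<^esub>z\<in>{z. w z \<noteq> \<zero>\<^bsub>R\<^esub>}. w z \<odot>\<^bsub>P\<^esub> \<beta> (fst z) (snd z)) ` t)"

text \<open>\<open>f \<otimes> g\<close>, with values in \<open>M \<otimes> N\<close>\<close>

definition tensor_map ::
  "('r, 'x) ring_scheme \<Rightarrow> ('r, 'm, 'y) module_scheme \<Rightarrow> ('r, 'n, 'z) module_scheme \<Rightarrow>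
    ('k \<Rightarrow> 'm) \<Rightarrow> ('l \<Rightarrow> 'n) \<Rightarrow> ('k \<times> 'l \<Rightarrow> 'r) set \<Rightarrow> ('m \<times> 'n \<Rightarrow> 'r) set"
  where "tensor_map R M N f g = tensor_lift R (tensor R M N) (\<lambda>x y. pure_tensor R M N (f x) (g y))"

definition tensor_assoc ::
  "('r, 'x) ring_scheme \<Rightarrow> ('r, 'l, 'w) module_scheme \<Rightarrow> ('r, 'm, 'y) module_scheme \<Rightarrow> ('r, 'n, 'z) module_scheme \<Rightarrow>
    (('l \<times> 'm \<Rightarrow> 'r) set \<times> 'n \<Rightarrow> 'r) set \<Rightarrow> ('l \<times> ('m \<times> 'n \<Rightarrow> 'r) set \<Rightarrow> 'r) set"
  where "tensor_assoc R L M N =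
    (let T = tensor R L (tensor R M N) in
      tensor_lift R T (\<lambda>t z. tensor_lift R T
        (\<lambda>x y. pure_tensor R L (tensor R M N) x (pure_tensor R M N y z)) t))"


section \<open>Algebras, coalgebras, bialgebras, Hopf algebras\<close>

text \<open>The library locale \<open>algebra\<close> is restricted to commutative algebras.\<close>

locale assoc_algebra = module R A + A?: ring A for R (structure) and A (structure) +
  assumes smult_mult_left:
      "\<lbrakk>r \<in> carrier R; a \<in> carrier A; b \<in> carrier A\<rbrakk> \<Longrightarrow> (r \<odot>\<^bsub>A\<^esub> a) \<otimes>\<^bsub>A\<^esub> b = r \<odot>\<^bsub>A\<^esub> (a \<otimes>\<^bsub>A\<^esub> b)"
    and smult_mult_right:
      "\<lbrakk>r \<in> carrier R; a \<in> carrier A; b \<in> carrier A\<rbrakk> \<Longrightarrow> a \<otimes>\<^bsub>A\<^esub> (r \<odot>\<^bsub>A\<^esub> b) = r \<odot>\<^bsub>A\<^esub> (a \<otimes>\<^bsub>A\<^esub> b)"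

definition alg_hom ::
  "('r, 'x) ring_scheme \<Rightarrow> ('r, 'a, 'y) module_scheme \<Rightarrow> ('r, 'b, 'z) module_scheme \<Rightarrow> ('a \<Rightarrow> 'b) set"
  where "alg_hom R A B = mod_hom R A B \<inter> ring_hom A B"

definition tensor_algebra ::
  "('r, 'x) ring_scheme \<Rightarrow> ('r, 'a, 'y) module_scheme \<Rightarrow> ('r, 'b, 'z) module_scheme \<Rightarrow> ('r, ('a \<times> 'b \<Rightarrow> 'r) set) module"
  where "tensor_algebra R A B = (tensor R A B)\<lparr>
    mult := (\<lambda>s t. tensor_lift R (tensor R A B) (\<lambda>a b. tensor_lift R (tensor R A B)
      (\<lambda>a' b'. pure_tensor R A B (a \<otimes>\<^bsub>A\<^esub> a') (b \<otimes>\<^bsub>B\<^esub> b')) t) s),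
    one := pure_tensor R A B \<one>\<^bsub>A\<^esub> \<one>\<^bsub>B\<^esub>\<rparr>"

locale coalgebra = module R C for R (structure) and C (structure) +
  fixes \<Delta> :: "'c \<Rightarrow> ('c \<times> 'c \<Rightarrow> 'a) set" and \<epsilon> :: "'c \<Rightarrow> 'a"
  assumes comult_hom: "\<Delta> \<in> mod_hom R C (tensor R C C)"
    and counit_hom: "\<epsilon> \<in> mod_hom R C (ring_module R)"
    and coassoc: "c \<in> carrier C \<Longrightarrow>
      tensor_assoc R C C C (tensor_map R (tensor R C C) C \<Delta> id (\<Delta> c))
        = tensor_map R C (tensor R C C) id \<Delta> (\<Delta> c)"
    and counit_left: "c \<in> carrier C \<Longrightarrow> tensor_lift R C (\<lambda>x y. \<epsilon> x \<odot>\<^bsub>C\<^esub> y) (\<Delta> c) = c"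
    and counit_right: "c \<in> carrier C \<Longrightarrow> tensor_lift R C (\<lambda>x y. \<epsilon> y \<odot>\<^bsub>C\<^esub> x) (\<Delta> c) = c"

locale bialgebra = assoc_algebra R B + coalgebra R B \<Delta> \<epsilon>
  for R (structure) and B (structure) and \<Delta> and \<epsilon> +
  assumes comult_alg_hom: "\<Delta> \<in> alg_hom R B (tensor_algebra R B B)"
    and counit_alg_hom: "\<epsilon> \<in> alg_hom R B (ring_module R)"

locale hopf_algebra = bialgebra R H \<Delta> \<epsilon>
  for R (structure) and H (structure) and \<Delta> and \<epsilon> +
  fixes S
  assumes antipode_hom: "S \<in> mod_hom R H H"
    and antipode_left: "h \<in> carrier H \<Longrightarrow>
      tensor_lift R H (\<lambda>x y. S x \<otimes>\<^bsub>H\<^esub> y) (\<Delta> h) = \<epsilon> h \<odot>\<^bsub>H\<^esub> \<one>\<^bsub>H\<^esub>"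
    and antipode_right: "h \<in> carrier H \<Longrightarrow>
      tensor_lift R H (\<lambda>x y. x \<otimes>\<^bsub>H\<^esub> S y) (\<Delta> h) = \<epsilon> h \<odot>\<^bsub>H\<^esub> \<one>\<^bsub>H\<^esub>"

definition convolution_algebra ::
  "('r, 'x) ring_scheme \<Rightarrow> ('r, 'c, 'y) module_scheme \<Rightarrow> ('c \<Rightarrow> ('c \<times> 'c \<Rightarrow> 'r) set) \<Rightarrow> ('c \<Rightarrow> 'r) \<Rightarrow>
    ('r, 'c \<Rightarrow> 'r) module"
  where "convolution_algebra R C \<Delta> \<epsilon> = (dual_module R C)\<lparr>
    mult := (\<lambda>f g. \<lambda>c\<in>carrier C. tensor_lift R (ring_module R) (\<lambda>x y. f x \<otimes>\<^bsub>R\<^esub> g y) (\<Delta> c)),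
    one := restrict \<epsilon> (carrier C)\<rparr>"


section \<open>The finite dual\<close>

locale left_ideal = additive_subgroup I A for I and A (structure) +
  assumes l_closed: "\<lbrakk>a \<in> carrier A; x \<in> I\<rbrakk> \<Longrightarrow> a \<otimes> x \<in> I"

definition property_P_left :: "('r, 'x) ring_scheme \<Rightarrow> ('r, 'a, 'y) module_scheme \<Rightarrow> bool"
  where "property_P_left R A \<longleftrightarrow>
    (\<forall>I. left_ideal I A \<and> finitely_generated R (quotient_module A I) \<longrightarrow>
      (\<exists>I\<^sub>0. left_ideal I\<^sub>0 A \<and> I\<^sub>0 \<subseteq> I \<and> finitely_generated R (quotient_module A I\<^sub>0) \<and>
        projective_module R (quotient_module A I\<^sub>0)))"

text \<open>The left \<open>A\<close>-module structure \<open>(a f)(b) = f(b a)\<close> on \<open>A\<^sup>*\<close>\<close>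

definition dual_act :: "('r, 'a, 'y) module_scheme \<Rightarrow> 'a \<Rightarrow> ('a \<Rightarrow> 'r) \<Rightarrow> 'a \<Rightarrow> 'r"
  where "dual_act A a f = (\<lambda>b\<in>carrier A. f (b \<otimes>\<^bsub>A\<^esub> a))"

definition finite_dual :: "('r, 'x) ring_scheme \<Rightarrow> ('r, 'a, 'y) module_scheme \<Rightarrow> ('a \<Rightarrow> 'r) set"
  where "finite_dual R A = {f \<in> carrier (dual_module R A).
    finitely_generated R ((dual_module R A)\<lparr>carrier := (\<lambda>a. dual_act A a f) ` carrier A\<rparr>)}"

definition finite_dual_module :: "('r, 'x) ring_scheme \<Rightarrow> ('r, 'a, 'y) module_scheme \<Rightarrow> ('r, 'a \<Rightarrow> 'r) module"
  where "finite_dual_module R A = (dual_module R A)\<lparr>carrier := finite_dual R A\<rparr>"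

text \<open>\<open>t = \<Sum> f\<^sub>1 \<otimes> f\<^sub>2\<close> in \<open>A\<^sup>\<circ> \<otimes> A\<^sup>\<circ>\<close> satisfies \<open>f(a b) = \<Sum> f\<^sub>1(a) f\<^sub>2(b)\<close> for all \<open>a\<close>, \<open>b\<close>.\<close>

definition is_finite_dual_comult ::
  "('r, 'x) ring_scheme \<Rightarrow> ('r, 'a, 'y) module_scheme \<Rightarrow> ('a \<Rightarrow> 'r) \<Rightarrow> (('a \<Rightarrow> 'r) \<times> ('a \<Rightarrow> 'r) \<Rightarrow> 'r) set \<Rightarrow> bool"
  where "is_finite_dual_comult R A f t \<longleftrightarrow>
    t \<in> carrier (tensor R (finite_dual_module R A) (finite_dual_module R A)) \<and>
    (\<forall>a\<in>carrier A. \<forall>b\<in>carrier A.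
      f (a \<otimes>\<^bsub>A\<^esub> b) = tensor_lift R (ring_module R) (\<lambda>g h. g a \<otimes>\<^bsub>R\<^esub> h b) t)"

definition finite_dual_comult ::
  "('r, 'x) ring_scheme \<Rightarrow> ('r, 'a, 'y) module_scheme \<Rightarrow> ('a \<Rightarrow> 'r) \<Rightarrow> (('a \<Rightarrow> 'r) \<times> ('a \<Rightarrow> 'r) \<Rightarrow> 'r) set"
  where "finite_dual_comult R A f = (THE t. is_finite_dual_comult R A f t)"

definition finite_dual_counit :: "('r, 'a, 'y) module_scheme \<Rightarrow> ('a \<Rightarrow> 'r) \<Rightarrow> 'r"
  where "finite_dual_counit A f = f \<one>\<^bsub>A\<^esub>"

text \<open>For a bialgebra \<open>A\<close>, the product on \<open>A\<^sup>\<circ>\<close> is the one of the convolution algebra \<open>A\<^sup>*\<close>.\<close>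

definition finite_dual_algebra ::
  "('r, 'x) ring_scheme \<Rightarrow> ('r, 'a, 'y) module_scheme \<Rightarrow> ('a \<Rightarrow> ('a \<times> 'a \<Rightarrow> 'r) set) \<Rightarrow> ('a \<Rightarrow> 'r) \<Rightarrow>
    ('r, 'a \<Rightarrow> 'r) module"
  where "finite_dual_algebra R A \<Delta> \<epsilon> = (convolution_algebra R A \<Delta> \<epsilon>)\<lparr>carrier := finite_dual R A\<rparr>"

definition finite_dual_antipode :: "('r, 'a, 'y) module_scheme \<Rightarrow> ('a \<Rightarrow> 'a) \<Rightarrow> ('a \<Rightarrow> 'r) \<Rightarrow> 'a \<Rightarrow> 'r"
  where "finite_dual_antipode A S f = (\<lambda>a\<in>carrier A. f (S a))"


section \<open>Rational pairings\<close>

definition alpha_map ::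
  "('r, 'x) ring_scheme \<Rightarrow> ('r, 'a, 'y) module_scheme \<Rightarrow> ('c \<Rightarrow> 'a \<Rightarrow> 'r) \<Rightarrow> ('r, 'm, 'z) module_scheme \<Rightarrow>
    ('m \<times> 'c \<Rightarrow> 'r) set \<Rightarrow> 'a \<Rightarrow> 'm"
  where "alpha_map R A p M =
    tensor_lift R (hom_module R A M) (\<lambda>m c. \<lambda>a\<in>carrier A. p c a \<odot>\<^bsub>M\<^esub> m)"

text \<open>
  The type argument is the carrier type of the test modules \<open>M\<close>; a theorem in which it is a free type
  variable speaks about all modules \<open>M\<close>.
\<close>

definition rational_pairing ::
  "'m itself \<Rightarrow> ('r, 'x) ring_scheme \<Rightarrow> ('r, 'c, 'y) module_scheme \<Rightarrow> ('c \<Rightarrow> ('c \<times> 'c \<Rightarrow> 'r) set) \<Rightarrow> ('c \<Rightarrow> 'r) \<Rightarrow>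
    ('r, 'a, 'z) module_scheme \<Rightarrow> ('c \<Rightarrow> 'a \<Rightarrow> 'r) \<Rightarrow> bool"
  where "rational_pairing (_ :: 'm itself) R C \<Delta> \<epsilon> A p \<longleftrightarrow>
    coalgebra R C \<Delta> \<epsilon> \<and> assoc_algebra R A \<and>
    (\<forall>c\<in>carrier C. p c \<in> mod_hom R A (ring_module R)) \<and>
    (\<forall>a\<in>carrier A. (\<lambda>c. p c a) \<in> mod_hom R C (ring_module R)) \<and>
    (\<forall>M :: ('r, 'm) module. module R M \<longrightarrow> inj_on (alpha_map R A p M) (carrier (tensor R M C))) \<and>
    (\<lambda>a. \<lambda>c\<in>carrier C. p c a) \<in> alg_hom R A (convolution_algebra R C \<Delta> \<epsilon>)"

end

theory Submission
  imports Defs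
begin

text \<open>
  A functional \<open>f\<close> is in \<open>A\<^sup>\<circ>\<close> iff \<open>f(a b) = \<Sum> g\<^sub>i(a) h\<^sub>i(b)\<close> for finitely many \<open>g\<^sub>i, h\<^sub>i \<in> A\<^sup>*\<close>: such an expansion
  puts \<open>A f\<close> into the span of the \<open>g\<^sub>i\<close>, and \<open>R\<close> is noetherian. Conversely, for finitely many \<open>f \<in> A\<^sup>\<circ>\<close> the
  left ideal \<open>{x. x f = 0 for all f}\<close> has a finitely generated quotient, so by \<open>P\<^sub>\<ell>\<close> it contains a left ideal
  \<open>I\<close> with \<open>A/I\<close> finitely generated projective. A dual basis of \<open>A/I\<close> lifts to \<open>a\<^sub>j \<in> A\<close>, \<open>\<phi>\<^sub>j \<in> A\<^sup>*\<close> with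
  \<open>g = \<Sum> g(a\<^sub>j) \<phi>\<^sub>j\<close> for every \<open>g\<close> vanishing on \<open>I\<close>. Since \<open>I\<close> is a left ideal this may be applied to
  \<open>b \<mapsto> g(a b)\<close>, which gives \<open>g(a b) = \<Sum> (a\<^sub>j g)(a) \<phi>\<^sub>j(b)\<close> and shows \<open>\<phi>\<^sub>j \<in> A\<^sup>\<circ>\<close>. Consequently every
  \<open>t \<in> M \<otimes> A\<^sup>\<circ>\<close> equals \<open>\<Sum> \<alpha>\<^sub>M(t)(a\<^sub>j) \<otimes> \<phi>\<^sub>j\<close> for a suitable dual basis, so \<open>\<alpha>\<^sub>M\<close> is injective. Elements of
  \<open>A\<^sup>\<circ> \<otimes> A\<^sup>\<circ>\<close> and \<open>A\<^sup>\<circ> \<otimes> (A\<^sup>\<circ> \<otimes> A\<^sup>\<circ>)\<close> are therefore determined by their values on \<open>A \<times> A\<close> and \<open>A \<times> A \<times> A\<close>,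
  and each axiom of the coalgebra, bialgebra and Hopf algebra \<open>A\<^sup>\<circ>\<close> dualises an axiom of \<open>A\<close>.
\<close>

section \<open>Linear maps, spans and quotients\<close>

text \<open>Tensor products over a general \<open>R\<close> are not exact, so nothing makes
  \<open>A\<^sup>\<circ> \<otimes> A\<^sup>\<circ>\<close> embed a priori into
  \<open>A\<^sup>* \<otimes> A\<^sup>*\<close> or into the functions on \<open>A \<times> A\<close>.
  Membership in \<open>A\<^sup>\<circ>\<close> is therefore tested by a tensor in
  \<open>A\<^sup>* \<otimes> A\<^sup>*\<close>, where nothing about \<open>A\<^sup>\<circ>\<close>
  has to be known, and equations between tensors are tested by evaluation only after injectivity is
  available. A dual basis depends on a finite set of functionals, and comparing two tensors requires
  a common one; for this reason the expansion of a tensor is proved for every dual basis of a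
  suitable finite set. Besides keeping \<open>A f\<close> finitely generated inside a span,
  noetherianity ensures that a finite intersection of annihilators still has a finitely generated
  quotient. The Hopf algebra axioms do not list that the antipode reverses products. This is
  derived, because the closure of \<open>A\<^sup>\<circ>\<close> under composition with
  \<open>S\<close> rests on it.\<close>

lemma mod_homI:
  assumes "\<And>x. x \<in> carrier M \<Longrightarrow> h x \<in> carrier N"
    and "\<And>x y. x \<in> carrier M \<Longrightarrow> y \<in> carrier M \<Longrightarrow> h (x \<oplus>\<^bsub>M\<^esub> y) = h x \<oplus>\<^bsub>N\<^esub> h y"
    and "\<And>r x. r \<in> carrier R \<Longrightarrow> x \<in> carrier M \<Longrightarrow> h (r \<odot>\<^bsub>M\<^esub> x) = r \<odot>\<^bsub>N\<^esub> h x"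
  shows "h \<in> mod_hom R M N"
  using assms by (auto simp: mod_hom_def)

lemma mod_hom_closed: "h \<in> mod_hom R M N \<Longrightarrow> x \<in> carrier M \<Longrightarrow> h x \<in> carrier N"
  and mod_hom_add: "h \<in> mod_hom R M N \<Longrightarrow> x \<in> carrier M \<Longrightarrow> y \<in> carrier M \<Longrightarrow>
    h (x \<oplus>\<^bsub>M\<^esub> y) = h x \<oplus>\<^bsub>N\<^esub> h y"
  and mod_hom_smult: "h \<in> mod_hom R M N \<Longrightarrow> r \<in> carrier R \<Longrightarrow> x \<in> carrier M \<Longrightarrow>
    h (r \<odot>\<^bsub>M\<^esub> x) = r \<odot>\<^bsub>N\<^esub> h x"
  by (auto simp: mod_hom_def)

text \<open>Functions matter only on carriers. This lets a map be exchanged for its restriction, or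
  for any expression with the same values there.\<close>

lemma mod_hom_cong:
  assumes "h \<in> mod_hom R M N" "module R M" "\<And>x. x \<in> carrier M \<Longrightarrow> g x = h x"
  shows "g \<in> mod_hom R M N"
proof -
  interpret M: module R M by fact
  show ?thesis
    using assms(1) by (auto intro!: mod_homI simp: assms(3) mod_hom_closed mod_hom_add mod_hom_smult)
qed

lemma mod_hom_id: "(\<lambda>x. x) \<in> mod_hom R M M"
  by (rule mod_homI) auto

lemma mod_hom_comp:
  assumes "g \<in> mod_hom R N P" "h \<in> mod_hom R M N"
  shows "(\<lambda>x. g (h x)) \<in> mod_hom R M P"
  using assms by (auto intro!: mod_homI simp: mod_hom_closed mod_hom_add mod_hom_smult)

text \<open>The zero element is a multiple by the scalar zero, so compatibility with scalars carries
  it over. Negation is treated likewise with the scalar \<open>-1\<close>.\<close>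

lemma mod_hom_zero:
  assumes "h \<in> mod_hom R M N" "module R M" "module R N"
  shows "h \<zero>\<^bsub>M\<^esub> = \<zero>\<^bsub>N\<^esub>"
proof -
  interpret M: module R M by fact
  interpret N: module R N by fact
  have "h (\<zero>\<^bsub>R\<^esub> \<odot>\<^bsub>M\<^esub> \<zero>\<^bsub>M\<^esub>) = \<zero>\<^bsub>R\<^esub> \<odot>\<^bsub>N\<^esub> h \<zero>\<^bsub>M\<^esub>"
    using assms(1) by (intro mod_hom_smult) auto
  then show ?thesis
    using mod_hom_closed[OF assms(1), of "\<zero>\<^bsub>M\<^esub>"] by simp
qed

lemma mod_hom_uminus:
  assumes "h \<in> mod_hom R M N" "module R M" "module R N" "x \<in> carrier M"
  shows "h (\<ominus>\<^bsub>M\<^esub> x) = \<ominus>\<^bsub>N\<^esub> h x"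
proof -
  interpret M: module R M by fact
  interpret N: module R N by fact
  have "h (\<ominus>\<^bsub>R\<^esub> \<one>\<^bsub>R\<^esub> \<odot>\<^bsub>M\<^esub> x) = \<ominus>\<^bsub>R\<^esub> \<one>\<^bsub>R\<^esub> \<odot>\<^bsub>N\<^esub> h x"
    using assms by (intro mod_hom_smult) auto
  then show ?thesis
    using mod_hom_closed[OF assms(1) assms(4)] assms(4)
    by (simp add: M.smult_l_minus N.smult_l_minus)
qed

lemma mod_hom_minus:
  assumes "h \<in> mod_hom R M N" "module R M" "module R N" "x \<in> carrier M" "y \<in> carrier M"
  shows "h (x \<ominus>\<^bsub>M\<^esub> y) = h x \<ominus>\<^bsub>N\<^esub> h y"
proof -
  interpret M: module R M by fact
  show ?thesis
    using assms by (simp add: a_minus_def mod_hom_uminus mod_hom_add[where N = N])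
qed

lemma mod_hom_finsum:
  assumes "h \<in> mod_hom R M N" "module R M" "module R N" "f \<in> I \<rightarrow> carrier M"
  shows "h (finsum M f I) = finsum N (\<lambda>i. h (f i)) I"
proof -
  interpret M: module R M by fact
  interpret N: module R N by fact
  show ?thesis
  proof (cases "finite I")
    case True
    then show ?thesis
      using assms(4)
    proof (induction I)
      case (insert i I)
      then show ?case
        using assms(1) by (simp add: Pi_def mod_hom_add[where N = N] mod_hom_closed[where N = N])
    qed (simp add: mod_hom_zero[OF assms(1-3)])
  qed (simp add: mod_hom_zero[OF assms(1-3)])
qed

lemma mod_hom_zero_fun:
  assumes "module R N"
  shows "(\<lambda>x. \<zero>\<^bsub>N\<^esub>) \<in> mod_hom R M N"
proof -
  interpret N: module R N by fact
  show ?thesis by (rule mod_homI) auto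
qed

lemma mod_hom_add_fun:
  assumes "f \<in> mod_hom R M N" "g \<in> mod_hom R M N" "module R N"
  shows "(\<lambda>x. f x \<oplus>\<^bsub>N\<^esub> g x) \<in> mod_hom R M N"
proof -
  interpret N: module R N by fact
  show ?thesis
    using assms(1,2)
    by (auto intro!: mod_homI simp: mod_hom_closed mod_hom_add[where N = N]
        mod_hom_smult[where N = N] N.smult_r_distr N.a_ac)
qed

lemma mod_hom_smult_fun:
  assumes "f \<in> mod_hom R M N" "r \<in> carrier R" "module R N"
  shows "(\<lambda>x. r \<odot>\<^bsub>N\<^esub> f x) \<in> mod_hom R M N"
proof -
  interpret N: module R N by fact
  have "r \<odot>\<^bsub>N\<^esub> (s \<odot>\<^bsub>N\<^esub> f x) = s \<odot>\<^bsub>N\<^esub> (r \<odot>\<^bsub>N\<^esub> f x)" if "s \<in> carrier R" "x \<in> carrier M" for s x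
    using that assms by (metis N.smult_assoc1 N.m_comm mod_hom_closed)
  then show ?thesis
    using assms(1,2)
    by (auto intro!: mod_homI simp: mod_hom_closed mod_hom_add[where N = N]
        mod_hom_smult[where N = N] N.smult_r_distr)
qed

lemma mod_hom_smult_elem:
  assumes "f \<in> mod_hom R M (ring_module R)" "n \<in> carrier N" "module R N"
  shows "(\<lambda>x. f x \<odot>\<^bsub>N\<^esub> n) \<in> mod_hom R M N"
proof -
  interpret N: module R N by fact
  have f: "f x \<in> carrier R" if "x \<in> carrier M" for x
    using mod_hom_closed[OF assms(1) that] by (simp add: ring_module_def)
  show ?thesis
    using assms(2) f mod_hom_add[OF assms(1)] mod_hom_smult[OF assms(1)]
    by (auto intro!: mod_homI simp: ring_module_def N.smult_l_distr N.smult_assoc1)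
qed

section \<open>Submodules, spans and finite generation\<close>

lemma submodule_kernel:
  assumes "h \<in> mod_hom R M N" "module R M" "module R N"
  shows "submodule {x \<in> carrier M. h x = \<zero>\<^bsub>N\<^esub>} R M"
proof -
  interpret M: module R M by fact
  interpret N: module R N by fact
  show ?thesis
    using assms
    by (intro M.submoduleI)
      (auto simp: mod_hom_zero mod_hom_uminus mod_hom_add[where N = N] mod_hom_smult[where N = N])
qed

lemma submodule_vimage:
  assumes "h \<in> mod_hom R M N" "module R M" "module R N" "submodule H R N"
  shows "submodule {x \<in> carrier M. h x \<in> H} R M"
proof -
  interpret M: module R M by fact
  interpret N: module R N by fact
  note E = N.submoduleE[OF assms(4)]
  have "\<zero>\<^bsub>N\<^esub> \<in> H"
    using subgroup.one_closed[OF submodule.axioms(1)[OF assms(4)]] by simp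
  then show ?thesis
    using assms E
    by (intro M.submoduleI)
      (auto simp: mod_hom_zero mod_hom_uminus mod_hom_add[where N = N] mod_hom_smult[where N = N])
qed

lemma submodule_image:
  assumes "h \<in> mod_hom R M N" "module R M" "module R N"
  shows "submodule (h ` carrier M) R N"
proof -
  interpret M: module R M by fact
  interpret N: module R N by fact
  show ?thesis
  proof (intro N.submoduleI)
    show "\<zero>\<^bsub>N\<^esub> \<in> h ` carrier M"
      using mod_hom_zero[OF assms] by (metis M.zero_closed imageI)
  qed (use assms in \<open>auto simp: mod_hom_closed mod_hom_uminus[symmetric] mod_hom_add[symmetric]
        mod_hom_smult[symmetric]\<close>)
qed

lemma submodule_zero: "submodule H R M \<Longrightarrow> \<zero>\<^bsub>M\<^esub> \<in> H"
  using subgroup.one_closed[OF submodule.axioms(1)] by fastforce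

lemma submodule_subset: "submodule H R M \<Longrightarrow> H \<subseteq> carrier M"
  using subgroup.subset[OF submodule.axioms(1)] by fastforce

lemma span_superset: "S \<subseteq> module_span R M S"
  by (auto simp: module_span_def)

lemma span_minimal: "submodule H R M \<Longrightarrow> S \<subseteq> H \<Longrightarrow> module_span R M S \<subseteq> H"
  by (auto simp: module_span_def)

lemma submodule_span:
  assumes "module R M" "S \<subseteq> carrier M"
  shows "submodule (module_span R M S) R M"
proof -
  interpret M: module R M by fact
  have "module_span R M S \<subseteq> carrier M"
    by (rule span_minimal[OF M.carrier_is_submodule assms(2)])
  then show ?thesis
    by (intro M.submoduleI)
      (auto simp: module_span_def M.submoduleE submodule_zero)
qed

lemma span_subset_carrier:
  assumes "module R M" "S \<subseteq> carrier M"
  shows "module_span R M S \<subseteq> carrier M"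
  using submodule_subset[OF submodule_span[OF assms]] .

lemma span_mono: "S \<subseteq> T \<Longrightarrow> module_span R M S \<subseteq> module_span R M T"
  by (auto simp: module_span_def)

text \<open>The preimage of \<open>H\<close> is a submodule that contains \<open>S\<close>, hence it
  contains the span.\<close>

lemma mod_hom_span_subset:
  assumes "h \<in> mod_hom R M N" "module R M" "module R N" "S \<subseteq> carrier M" "submodule H R N"
    and "\<And>x. x \<in> S \<Longrightarrow> h x \<in> H" "x \<in> module_span R M S"
  shows "h x \<in> H"
  using span_minimal[OF submodule_vimage[OF assms(1-3,5)], of S] assms(4,6,7) by blast

lemma submodule_Int:
  assumes "module R M" "submodule H R M" "submodule K R M"
  shows "submodule (H \<inter> K) R M"
proof -
  interpret M: module R M by fact
  show ?thesis
    using M.submoduleE[OF assms(2)] M.submoduleE[OF assms(3)]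
    by (intro M.submoduleI) (auto simp: submodule_zero[OF assms(2)] submodule_zero[OF assms(3)])
qed

lemma submodule_add:
  assumes "module R M" "submodule H R M" "submodule K R M"
  shows "submodule {x \<oplus>\<^bsub>M\<^esub> y | x y. x \<in> H \<and> y \<in> K} R M"
proof -
  interpret M: module R M by fact
  note H = M.submoduleE[OF assms(2)] and K = M.submoduleE[OF assms(3)]
  show ?thesis
  proof (intro M.submoduleI)
    show "{x \<oplus>\<^bsub>M\<^esub> y | x y. x \<in> H \<and> y \<in> K} \<subseteq> carrier M"
      using H(1) K(1) by auto
    show "\<zero>\<^bsub>M\<^esub> \<in> {x \<oplus>\<^bsub>M\<^esub> y | x y. x \<in> H \<and> y \<in> K}"
    proof -
      have "\<zero>\<^bsub>M\<^esub> = \<zero>\<^bsub>M\<^esub> \<oplus>\<^bsub>M\<^esub> \<zero>\<^bsub>M\<^esub>" by simp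
      then show ?thesis
        using submodule_zero[OF assms(2)] submodule_zero[OF assms(3)] by blast
    qed
  next
    fix a assume "a \<in> {x \<oplus>\<^bsub>M\<^esub> y | x y. x \<in> H \<and> y \<in> K}"
    then obtain x y where a: "a = x \<oplus>\<^bsub>M\<^esub> y" "x \<in> H" "y \<in> K" by blast
    then have "\<ominus>\<^bsub>M\<^esub> a = \<ominus>\<^bsub>M\<^esub> x \<oplus>\<^bsub>M\<^esub> \<ominus>\<^bsub>M\<^esub> y"
      using H(1) K(1) by (auto intro: M.minus_add)
    then show "\<ominus>\<^bsub>M\<^esub> a \<in> {x \<oplus>\<^bsub>M\<^esub> y | x y. x \<in> H \<and> y \<in> K}"
      using a(2,3) H(3) K(3) by blast
    fix b assume "b \<in> {x \<oplus>\<^bsub>M\<^esub> y | x y. x \<in> H \<and> y \<in> K}"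
    then obtain x' y' where b: "b = x' \<oplus>\<^bsub>M\<^esub> y'" "x' \<in> H" "y' \<in> K" by blast
    have "a \<oplus>\<^bsub>M\<^esub> b = (x \<oplus>\<^bsub>M\<^esub> x') \<oplus>\<^bsub>M\<^esub> (y \<oplus>\<^bsub>M\<^esub> y')"
      using a b H(1) K(1) by (simp add: subset_iff M.a_ac)
    then show "a \<oplus>\<^bsub>M\<^esub> b \<in> {x \<oplus>\<^bsub>M\<^esub> y | x y. x \<in> H \<and> y \<in> K}"
      using a(2,3) b(2,3) H(5) K(5) by blast
  next
    fix r a assume r: "r \<in> carrier R" and "a \<in> {x \<oplus>\<^bsub>M\<^esub> y | x y. x \<in> H \<and> y \<in> K}"
    then obtain x y where a: "a = x \<oplus>\<^bsub>M\<^esub> y" "x \<in> H" "y \<in> K" by blast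
    then have "r \<odot>\<^bsub>M\<^esub> a = r \<odot>\<^bsub>M\<^esub> x \<oplus>\<^bsub>M\<^esub> r \<odot>\<^bsub>M\<^esub> y"
      using r H(1) K(1) by (simp add: subset_iff M.smult_r_distr)
    then show "r \<odot>\<^bsub>M\<^esub> a \<in> {x \<oplus>\<^bsub>M\<^esub> y | x y. x \<in> H \<and> y \<in> K}"
      using r a(2,3) H(4) K(4) by blast
  qed
qed

text \<open>The definition of \<open>finite_dual\<close> expresses finite generation of
  \<open>A f\<close> in a record with a smaller carrier. This reduces submodules of that record to
  submodules of the ambient module.\<close>

lemma submodule_carrier_update:
  assumes "module R M" "submodule N R M"
  shows "submodule H R (M\<lparr>carrier := N\<rparr>) \<longleftrightarrow> submodule H R M \<and> H \<subseteq> N"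
proof -
  interpret M: module R M by fact
  interpret N: module R "M\<lparr>carrier := N\<rparr>"
    by (rule submodule.submodule_is_module[OF assms(2,1)])
  \<comment> \<open>Negation is a description that ranges over the carrier, so shrinking the carrier
    could change it. On a subgroup it does not.\<close>
  have inv: "\<ominus>\<^bsub>M\<lparr>carrier := N\<rparr>\<^esub> x = \<ominus>\<^bsub>M\<^esub> x" if "x \<in> N" for x
    using group.m_inv_consistent[OF M.a_group submodule.axioms(1)[OF assms(2)], of x] that
    by (simp add: a_inv_def)
  show ?thesis
  proof
    assume H: "submodule H R (M\<lparr>carrier := N\<rparr>)"
    have HN: "H \<subseteq> N"
      using submodule_subset[OF H] by simp
    have "submodule H R M"
    proof (intro M.submoduleI)
      show "\<And>a. a \<in> H \<Longrightarrow> \<ominus>\<^bsub>M\<^esub> a \<in> H"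
        using N.submoduleE(3)[OF H] inv HN by force
    qed (use HN submodule_subset[OF assms(2)] submodule_zero[OF H] N.submoduleE[OF H] in auto)
    with HN show "submodule H R M \<and> H \<subseteq> N" by blast
  next
    assume H: "submodule H R M \<and> H \<subseteq> N"
    show "submodule H R (M\<lparr>carrier := N\<rparr>)"
    proof (intro N.submoduleI)
      show "\<And>a. a \<in> H \<Longrightarrow> \<ominus>\<^bsub>M\<lparr>carrier := N\<rparr>\<^esub> a \<in> H"
        using M.submoduleE(3)[of H] inv H by force
    qed (use H submodule_zero[of H R M] M.submoduleE[of H] in auto)
  qed
qed

lemma span_carrier_update:
  assumes "module R M" "submodule N R M" "S \<subseteq> N"
  shows "module_span R (M\<lparr>carrier := N\<rparr>) S = module_span R M S"
proof -
  have "submodule (module_span R M S) R (M\<lparr>carrier := N\<rparr>)"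
    unfolding submodule_carrier_update[OF assms(1,2)]
    using submodule_span[OF assms(1)] span_minimal[OF assms(2,3)] submodule_subset[OF assms(2)] assms(3)
    by blast
  then have "module_span R (M\<lparr>carrier := N\<rparr>) S \<subseteq> module_span R M S"
    by (rule span_minimal) (rule span_superset)
  moreover have "module_span R M S \<subseteq> module_span R (M\<lparr>carrier := N\<rparr>) S"
    unfolding module_span_def submodule_carrier_update[OF assms(1,2)] by blast
  ultimately show ?thesis by blast
qed

text \<open>Removes the record update: generators of \<open>N\<close> may be sought, and spans
  formed, in the ambient module.\<close>

lemma finitely_generated_submodule:
  assumes "module R M" "submodule N R M"
  shows "finitely_generated R (M\<lparr>carrier := N\<rparr>) \<longleftrightarrow> (\<exists>S. finite S \<and> S \<subseteq> N \<and> module_span R M S = N)"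
  using span_carrier_update[OF assms] unfolding finitely_generated_def by auto

section \<open>Quotient modules and their cosets\<close>

context
  fixes R :: "('r, 'x) ring_scheme" and M :: "('r, 'm, 'y) module_scheme" and N
  assumes M: "module R M" and N: "submodule N R M"
begin

interpretation M: module R M by (rule M)

interpretation N: abelian_subgroup N M
  using submodule.axioms(1)[OF N] M.a_comm_group by (rule abelian_subgroupI2[rotated])

lemma quotient_coset_closed: "x \<in> carrier M \<Longrightarrow> N +>\<^bsub>M\<^esub> x \<in> carrier (quotient_module M N)"
  using M.a_rcosetsI[OF N.a_subset] by (simp add: quotient_module_def)

lemma quotient_cases:
  assumes "X \<in> carrier (quotient_module M N)"
  obtains x where "x \<in> carrier M" "X = N +>\<^bsub>M\<^esub> x"
  using assms by (auto simp: quotient_module_def A_RCOSETS_def')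

lemma quotient_coset_add:
  "x \<in> carrier M \<Longrightarrow> y \<in> carrier M \<Longrightarrow>
    (N +>\<^bsub>M\<^esub> x) \<oplus>\<^bsub>quotient_module M N\<^esub> (N +>\<^bsub>M\<^esub> y) = N +>\<^bsub>M\<^esub> (x \<oplus>\<^bsub>M\<^esub> y)"
  by (simp add: quotient_module_def N.a_rcos_sum)

lemma coset_eqI: "x \<in> N +>\<^bsub>M\<^esub> y \<Longrightarrow> y \<in> carrier M \<Longrightarrow> N +>\<^bsub>M\<^esub> x = N +>\<^bsub>M\<^esub> y"
  using M.a_repr_independence[of x N y] N.a_subgroup by simp

lemma coset_self: "x \<in> carrier M \<Longrightarrow> x \<in> N +>\<^bsub>M\<^esub> x"
  by (rule N.a_rcos_self)

lemma coset_subset: "x \<in> carrier M \<Longrightarrow> N +>\<^bsub>M\<^esub> x \<subseteq> carrier M"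
  by (rule M.a_r_coset_subset_G[OF N.a_subset])

lemma mem_coset_iff:
  assumes "x \<in> carrier M" "y \<in> carrier M"
  shows "x \<in> N +>\<^bsub>M\<^esub> y \<longleftrightarrow> x \<ominus>\<^bsub>M\<^esub> y \<in> N"
proof
  assume "x \<in> N +>\<^bsub>M\<^esub> y"
  then obtain n where n: "n \<in> N" "x = n \<oplus>\<^bsub>M\<^esub> y"
    by (auto simp: a_r_coset_def')
  then have "x \<ominus>\<^bsub>M\<^esub> y = n"
    using assms N.a_subset by (auto simp: a_minus_def M.a_assoc M.r_neg)
  with n show "x \<ominus>\<^bsub>M\<^esub> y \<in> N" by simp
next
  assume "x \<ominus>\<^bsub>M\<^esub> y \<in> N"
  moreover have "x = (x \<ominus>\<^bsub>M\<^esub> y) \<oplus>\<^bsub>M\<^esub> y"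
    using assms by (simp add: a_minus_def M.a_assoc M.l_neg)
  ultimately show "x \<in> N +>\<^bsub>M\<^esub> y"
    by (auto simp: a_r_coset_def')
qed

lemma coset_eq_iff:
  assumes "x \<in> carrier M" "y \<in> carrier M"
  shows "N +>\<^bsub>M\<^esub> x = N +>\<^bsub>M\<^esub> y \<longleftrightarrow> x \<ominus>\<^bsub>M\<^esub> y \<in> N"
  using mem_coset_iff[OF assms] coset_self[OF assms(1)] coset_eqI[OF _ assms(2), of x] by auto

text \<open>The scalar action is defined as a union over all representatives of the coset. The
  united cosets coincide, because representatives differ by elements of \<open>N\<close> and
  \<open>N\<close> is closed under scalars.\<close>

lemma quotient_coset_smult:
  assumes "r \<in> carrier R" "x \<in> carrier M"
  shows "r \<odot>\<^bsub>quotient_module M N\<^esub> (N +>\<^bsub>M\<^esub> x) = N +>\<^bsub>M\<^esub> (r \<odot>\<^bsub>M\<^esub> x)"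
proof -
  have "N +>\<^bsub>M\<^esub> (r \<odot>\<^bsub>M\<^esub> y) = N +>\<^bsub>M\<^esub> (r \<odot>\<^bsub>M\<^esub> x)" if "y \<in> N +>\<^bsub>M\<^esub> x" for y
  proof -
    have y: "y \<in> carrier M"
      using that coset_subset[OF assms(2)] by blast
    have "r \<odot>\<^bsub>M\<^esub> y \<ominus>\<^bsub>M\<^esub> r \<odot>\<^bsub>M\<^esub> x = r \<odot>\<^bsub>M\<^esub> (y \<ominus>\<^bsub>M\<^esub> x)"
      using y assms by (simp add: a_minus_def M.smult_r_distr M.smult_r_minus)
    also have "\<dots> \<in> N"
      using that y assms M.submoduleE(4)[OF N] by (simp add: mem_coset_iff)
    finally show ?thesis
      using y assms by (simp add: coset_eq_iff)
  qed
  moreover have "x \<in> N +>\<^bsub>M\<^esub> x"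
    by (rule coset_self[OF assms(2)])
  ultimately have "(\<Union>y\<in>N +>\<^bsub>M\<^esub> x. N +>\<^bsub>M\<^esub> (r \<odot>\<^bsub>M\<^esub> y)) = N +>\<^bsub>M\<^esub> (r \<odot>\<^bsub>M\<^esub> x)"
    by blast
  then show ?thesis
    by (simp add: quotient_module_def)
qed

lemma module_quotient: "module R (quotient_module M N)"
proof (rule moduleI)
  let ?Q = "quotient_module M N"
  show "cring R" by (rule M.is_cring)
  show "abelian_group ?Q"
  proof (rule abelian_groupI)
    show "\<zero>\<^bsub>?Q\<^esub> \<in> carrier ?Q"
      using quotient_coset_closed[of "\<zero>\<^bsub>M\<^esub>"] N.a_subset by (simp add: quotient_module_def)
  next
    fix x assume "x \<in> carrier ?Q"
    then obtain a where a: "a \<in> carrier M" "x = N +>\<^bsub>M\<^esub> a" by (rule quotient_cases)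
    have z: "\<zero>\<^bsub>?Q\<^esub> = N +>\<^bsub>M\<^esub> \<zero>\<^bsub>M\<^esub>"
      using N.a_subset by (simp add: quotient_module_def)
    show "\<zero>\<^bsub>?Q\<^esub> \<oplus>\<^bsub>?Q\<^esub> x = x"
      using a by (simp add: z quotient_coset_add)
    show "\<exists>y\<in>carrier ?Q. y \<oplus>\<^bsub>?Q\<^esub> x = \<zero>\<^bsub>?Q\<^esub>"
      using a by (intro bexI[of _ "N +>\<^bsub>M\<^esub> (\<ominus>\<^bsub>M\<^esub> a)"])
        (auto simp: z quotient_coset_add quotient_coset_closed M.l_neg)
  next
    fix x y assume "x \<in> carrier ?Q" "y \<in> carrier ?Q"
    then obtain a b where *: "a \<in> carrier M" "x = N +>\<^bsub>M\<^esub> a" "b \<in> carrier M" "y = N +>\<^bsub>M\<^esub> b"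
      by (metis quotient_cases)
    then show "x \<oplus>\<^bsub>?Q\<^esub> y \<in> carrier ?Q" "x \<oplus>\<^bsub>?Q\<^esub> y = y \<oplus>\<^bsub>?Q\<^esub> x"
      by (auto simp: quotient_coset_add quotient_coset_closed M.a_comm)
    fix z assume "z \<in> carrier ?Q"
    then obtain c where "c \<in> carrier M" "z = N +>\<^bsub>M\<^esub> c" by (rule quotient_cases)
    with * show "x \<oplus>\<^bsub>?Q\<^esub> y \<oplus>\<^bsub>?Q\<^esub> z = x \<oplus>\<^bsub>?Q\<^esub> (y \<oplus>\<^bsub>?Q\<^esub> z)"
      by (simp add: quotient_coset_add M.a_assoc)
  qed
next
  let ?Q = "quotient_module M N"
  fix a x assume a: "a \<in> carrier R" and x: "x \<in> carrier ?Q"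
  from x obtain u where u: "u \<in> carrier M" "x = N +>\<^bsub>M\<^esub> u"
    by (rule quotient_cases)
  with a show "a \<odot>\<^bsub>?Q\<^esub> x \<in> carrier ?Q"
    by (simp add: quotient_coset_smult quotient_coset_closed)
  {
    fix b assume "b \<in> carrier R"
    with a u show "(a \<oplus>\<^bsub>R\<^esub> b) \<odot>\<^bsub>?Q\<^esub> x = a \<odot>\<^bsub>?Q\<^esub> x \<oplus>\<^bsub>?Q\<^esub> b \<odot>\<^bsub>?Q\<^esub> x"
      and "(a \<otimes>\<^bsub>R\<^esub> b) \<odot>\<^bsub>?Q\<^esub> x = a \<odot>\<^bsub>?Q\<^esub> (b \<odot>\<^bsub>?Q\<^esub> x)"
      by (simp_all add: quotient_coset_add quotient_coset_smult M.smult_l_distr M.smult_assoc1)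
  next
    fix y assume "y \<in> carrier ?Q"
    then obtain v where "v \<in> carrier M" "y = N +>\<^bsub>M\<^esub> v" by (rule quotient_cases)
    with a u show "a \<odot>\<^bsub>?Q\<^esub> (x \<oplus>\<^bsub>?Q\<^esub> y) = a \<odot>\<^bsub>?Q\<^esub> x \<oplus>\<^bsub>?Q\<^esub> a \<odot>\<^bsub>?Q\<^esub> y"
      by (simp add: quotient_coset_add quotient_coset_smult M.smult_r_distr)
  }
next
  fix x assume "x \<in> carrier (quotient_module M N)"
  then obtain u where "u \<in> carrier M" "x = N +>\<^bsub>M\<^esub> u" by (rule quotient_cases)
  then show "\<one>\<^bsub>R\<^esub> \<odot>\<^bsub>quotient_module M N\<^esub> x = x"
    by (simp add: quotient_coset_smult)
qed

lemma mod_hom_coset: "(\<lambda>x. N +>\<^bsub>M\<^esub> x) \<in> mod_hom R M (quotient_module M N)"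
  by (rule mod_homI)
    (auto simp: quotient_coset_closed quotient_coset_add quotient_coset_smult)

end

section \<open>Free modules and tensor products\<close>

lemma (in abelian_group) minus_eq_zeroD:
  "x \<ominus> y = \<zero> \<Longrightarrow> x \<in> carrier G \<Longrightarrow> y \<in> carrier G \<Longrightarrow> x = y"
  using minus_equality[of x "\<ominus> y"] by (simp add: a_minus_def)

lemma ring_module_simps [simp]:
  "carrier (ring_module R) = carrier R" "add (ring_module R) = add R"
  "zero (ring_module R) = zero R" "smult (ring_module R) = mult R"
  "mult (ring_module R) = mult R" "one (ring_module R) = one R"
  by (simp_all add: ring_module_def)

lemma (in cring) module_ring_module: "module R (ring_module R)"
proof (rule moduleI)
  show "abelian_group (ring_module R)"
  proof (rule abelian_groupI)
    fix x assume "x \<in> carrier (ring_module R)"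
    then show "\<exists>y\<in>carrier (ring_module R). y \<oplus>\<^bsub>ring_module R\<^esub> x = \<zero>\<^bsub>ring_module R\<^esub>"
      by (intro bexI[of _ "\<ominus> x"]) (auto simp: l_neg)
  qed (auto simp: a_ac)
qed (auto simp: is_cring l_distr r_distr m_assoc)

lemma free_module_simps [simp]:
  "add (free_module R X) = (\<lambda>v w x. v x \<oplus>\<^bsub>R\<^esub> w x)"
  "zero (free_module R X) = (\<lambda>x. \<zero>\<^bsub>R\<^esub>)"
  "smult (free_module R X) = (\<lambda>r w x. r \<otimes>\<^bsub>R\<^esub> w x)"
  by (simp_all add: free_module_def)

lemma free_module_carrier_iff:
  "w \<in> carrier (free_module R X) \<longleftrightarrow>
    (\<forall>x\<in>X. w x \<in> carrier R) \<and> (\<forall>x. x \<notin> X \<longrightarrow> w x = \<zero>\<^bsub>R\<^esub>) \<and> finite {x. w x \<noteq> \<zero>\<^bsub>R\<^esub>}"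
  by (simp add: free_module_def)

text \<open>Isolates the sum that \<open>tensor_lift\<close> evaluates on each representative of a
  coset, so that the universal property of the free module can be proved before relations are
  factored out.\<close>

definition free_lift ::
  "('r, 'x) ring_scheme \<Rightarrow> ('r, 'p, 'y) module_scheme \<Rightarrow> ('b \<Rightarrow> 'p) \<Rightarrow> ('b \<Rightarrow> 'r) \<Rightarrow> 'p"
  where "free_lift R P \<gamma> w = (\<Oplus>\<^bsub>P\<^esub>z\<in>{z. w z \<noteq> \<zero>\<^bsub>R\<^esub>}. w z \<odot>\<^bsub>P\<^esub> \<gamma> z)"

context cring
begin

lemma free_module_closed:
  assumes "w \<in> carrier (free_module R X)"
  shows "w x \<in> carrier R"
  using assms by (cases "x \<in> X") (auto simp: free_module_carrier_iff)

lemma free_module_add_closed: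
  assumes "v \<in> carrier (free_module R X)" "w \<in> carrier (free_module R X)"
  shows "(\<lambda>x. v x \<oplus> w x) \<in> carrier (free_module R X)"
proof -
  have "{x. v x \<oplus> w x \<noteq> \<zero>} \<subseteq> {x. v x \<noteq> \<zero>} \<union> {x. w x \<noteq> \<zero>}"
    by auto
  then show ?thesis
    using assms by (auto simp: free_module_carrier_iff elim: finite_subset)
qed

lemma free_module_smult_closed:
  assumes "r \<in> carrier R" "w \<in> carrier (free_module R X)"
  shows "(\<lambda>x. r \<otimes> w x) \<in> carrier (free_module R X)"
proof -
  have "{x. r \<otimes> w x \<noteq> \<zero>} \<subseteq> {x. w x \<noteq> \<zero>}"
    using assms by auto
  then show ?thesis
    using assms by (auto simp: free_module_carrier_iff elim: finite_subset)
qed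

lemma module_free_module: "module R (free_module R X)"
proof (rule moduleI)
  show "abelian_group (free_module R X)"
  proof (rule abelian_groupI)
    fix w assume w: "w \<in> carrier (free_module R X)"
    have "(\<lambda>x. \<ominus> \<one> \<otimes> w x) \<in> carrier (free_module R X)"
      using w by (intro free_module_smult_closed) auto
    moreover have "(\<ominus> \<one> \<otimes> w x) \<oplus> w x = \<zero>" for x
      using free_module_closed[OF w, of x] by (simp add: l_minus l_neg)
    ultimately show "\<exists>v\<in>carrier (free_module R X). v \<oplus>\<^bsub>free_module R X\<^esub> w = \<zero>\<^bsub>free_module R X\<^esub>"
      by (intro bexI[of _ "\<lambda>x. \<ominus> \<one> \<otimes> w x"]) auto
  next
    show "\<zero>\<^bsub>free_module R X\<^esub> \<in> carrier (free_module R X)"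
      by (simp add: free_module_carrier_iff)
  qed (auto simp: free_module_add_closed free_module_closed a_ac intro!: ext)
qed (auto simp: is_cring free_module_smult_closed free_module_closed l_distr r_distr m_assoc intro!: ext)

lemma free_gen_closed: "x \<in> X \<Longrightarrow> free_gen R x \<in> carrier (free_module R X)"
  by (auto simp: free_module_carrier_iff free_gen_def intro: finite_subset[of _ "{x}"])

text \<open>Terms outside the support vanish. Enlarging the index set gives several functions a
  common one, over which their sums can be added.\<close>

lemma free_lift_eq:
  assumes "module R P" "w \<in> carrier (free_module R X)" "\<gamma> \<in> X \<rightarrow> carrier P"
    and "finite T" "{z. w z \<noteq> \<zero>} \<subseteq> T" "T \<subseteq> X"
  shows "free_lift R P \<gamma> w = (\<Oplus>\<^bsub>P\<^esub>z\<in>T. w z \<odot>\<^bsub>P\<^esub> \<gamma> z)"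
proof -
  interpret P: module R P by fact
  show ?thesis
    unfolding free_lift_def
    by (rule P.add.finprod_mono_neutral_cong_left)
      (use assms free_module_closed[OF assms(2)] in \<open>auto simp: Pi_def subset_iff\<close>)
qed

lemma free_lift_hom:
  assumes "module R P" "\<gamma> \<in> X \<rightarrow> carrier P"
  shows "free_lift R P \<gamma> \<in> mod_hom R (free_module R X) P"
proof -
  interpret P: module R P by fact
  let ?F = "free_module R X"
  have supp: "finite {z. w z \<noteq> \<zero>} \<and> {z. w z \<noteq> \<zero>} \<subseteq> X" if "w \<in> carrier ?F" for w
    using that by (auto simp: free_module_carrier_iff)
  have smult_in: "(\<lambda>z. w z \<odot>\<^bsub>P\<^esub> \<gamma> z) \<in> T \<rightarrow> carrier P" if "w \<in> carrier ?F" "T \<subseteq> X" for w T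
    using that assms(2) free_module_closed[OF that(1)] by auto
  show ?thesis
  proof (rule mod_homI)
    fix w assume w: "w \<in> carrier ?F"
    show "free_lift R P \<gamma> w \<in> carrier P"
      unfolding free_lift_def using smult_in[OF w] supp[OF w] by (intro P.finsum_closed) auto
    fix v assume v: "v \<in> carrier ?F"
    let ?T = "{z. w z \<noteq> \<zero>} \<union> {z. v z \<noteq> \<zero>}"
    have T: "finite ?T" "?T \<subseteq> X" using supp[OF w] supp[OF v] by auto
    have "free_lift R P \<gamma> (\<lambda>x. w x \<oplus> v x) = (\<Oplus>\<^bsub>P\<^esub>z\<in>?T. (w z \<oplus> v z) \<odot>\<^bsub>P\<^esub> \<gamma> z)"
      by (rule free_lift_eq[OF assms(1) free_module_add_closed[OF w v] assms(2) T(1) _ T(2)]) auto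
    also have "\<dots> = (\<Oplus>\<^bsub>P\<^esub>z\<in>?T. w z \<odot>\<^bsub>P\<^esub> \<gamma> z \<oplus>\<^bsub>P\<^esub> v z \<odot>\<^bsub>P\<^esub> \<gamma> z)"
    proof (rule P.finsum_cong')
      show "(\<lambda>z. w z \<odot>\<^bsub>P\<^esub> \<gamma> z \<oplus>\<^bsub>P\<^esub> v z \<odot>\<^bsub>P\<^esub> \<gamma> z) \<in> ?T \<rightarrow> carrier P"
        using smult_in[OF w T(2)] smult_in[OF v T(2)] by blast
    qed (use T(2) assms(2) free_module_closed[OF w] free_module_closed[OF v] in
        \<open>auto intro!: P.smult_l_distr\<close>)
    also have "\<dots> = (\<Oplus>\<^bsub>P\<^esub>z\<in>?T. w z \<odot>\<^bsub>P\<^esub> \<gamma> z) \<oplus>\<^bsub>P\<^esub> (\<Oplus>\<^bsub>P\<^esub>z\<in>?T. v z \<odot>\<^bsub>P\<^esub> \<gamma> z)"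
      using smult_in[OF w T(2)] smult_in[OF v T(2)] by (rule P.finsum_addf)
    also have "(\<Oplus>\<^bsub>P\<^esub>z\<in>?T. w z \<odot>\<^bsub>P\<^esub> \<gamma> z) = free_lift R P \<gamma> w"
      by (rule free_lift_eq[OF assms(1) w assms(2) T(1) _ T(2), symmetric]) auto
    also have "(\<Oplus>\<^bsub>P\<^esub>z\<in>?T. v z \<odot>\<^bsub>P\<^esub> \<gamma> z) = free_lift R P \<gamma> v"
      by (rule free_lift_eq[OF assms(1) v assms(2) T(1) _ T(2), symmetric]) auto
    finally show "free_lift R P \<gamma> (w \<oplus>\<^bsub>?F\<^esub> v) = free_lift R P \<gamma> w \<oplus>\<^bsub>P\<^esub> free_lift R P \<gamma> v"
      by simp
  next
    fix r w assume r: "r \<in> carrier R" and w: "w \<in> carrier ?F"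
    let ?T = "{z. w z \<noteq> \<zero>}"
    have T: "finite ?T" "?T \<subseteq> X" using supp[OF w] by auto
    have "free_lift R P \<gamma> (\<lambda>x. r \<otimes> w x) = (\<Oplus>\<^bsub>P\<^esub>z\<in>?T. (r \<otimes> w z) \<odot>\<^bsub>P\<^esub> \<gamma> z)"
      using r by (intro free_lift_eq[OF assms(1) free_module_smult_closed[OF r w] assms(2) T(1) _ T(2)]) auto
    also have "\<dots> = (\<Oplus>\<^bsub>P\<^esub>z\<in>?T. r \<odot>\<^bsub>P\<^esub> (w z \<odot>\<^bsub>P\<^esub> \<gamma> z))"
    proof (rule P.finsum_cong')
      show "(\<lambda>z. r \<odot>\<^bsub>P\<^esub> (w z \<odot>\<^bsub>P\<^esub> \<gamma> z)) \<in> ?T \<rightarrow> carrier P"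
        using smult_in[OF w T(2)] r by blast
    qed (use r T(2) assms(2) free_module_closed[OF w] in \<open>auto intro!: P.smult_assoc1\<close>)
    also have "\<dots> = r \<odot>\<^bsub>P\<^esub> free_lift R P \<gamma> w"
      unfolding free_lift_def by (rule P.finsum_smult_ldistr[OF T(1) r smult_in[OF w T(2)], symmetric])
    finally show "free_lift R P \<gamma> (r \<odot>\<^bsub>?F\<^esub> w) = r \<odot>\<^bsub>P\<^esub> free_lift R P \<gamma> w"
      by simp
  qed
qed

lemma free_lift_gen:
  assumes "module R P" "\<gamma> \<in> X \<rightarrow> carrier P" "x \<in> X"
  shows "free_lift R P \<gamma> (free_gen R x) = \<gamma> x"
proof -
  interpret P: module R P by fact
  have "free_lift R P \<gamma> (free_gen R x) = (\<Oplus>\<^bsub>P\<^esub>z\<in>{x}. free_gen R x z \<odot>\<^bsub>P\<^esub> \<gamma> z)"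
    using assms by (intro free_lift_eq[where X = X] free_gen_closed) (auto simp: free_gen_def)
  moreover have "\<gamma> x \<in> carrier P" using assms by auto
  ultimately show ?thesis
    by (simp add: free_gen_def)
qed

text \<open>Evaluation at a point \<open>y\<close> is linear and passes through the finite sum,
  where only the term with index \<open>y\<close> survives.\<close>

lemma free_lift_free_gen:
  assumes w: "w \<in> carrier (free_module R X)"
  shows "free_lift R (free_module R X) (free_gen R) w = w"
proof
  fix y
  let ?F = "free_module R X" and ?T = "{z. w z \<noteq> \<zero>}"
  interpret F: module R ?F by (rule module_free_module)
  have T: "finite ?T" "\<And>z. w z \<noteq> \<zero> \<Longrightarrow> z \<in> X"
    using w by (auto simp: free_module_carrier_iff)
  have ev: "(\<lambda>v. v y) \<in> mod_hom R ?F (ring_module R)"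
    by (rule mod_homI) (auto dest: free_module_closed)
  interpret R': module R "ring_module R" by (rule module_ring_module)
  have "free_lift R ?F (free_gen R) w y = (\<Oplus>\<^bsub>ring_module R\<^esub>z\<in>?T. (w z \<odot>\<^bsub>?F\<^esub> free_gen R z) y)"
    unfolding free_lift_def
    using T(2) free_module_closed[OF w]
    by (intro mod_hom_finsum[OF ev module_free_module module_ring_module] funcsetI F.smult_closed
        free_gen_closed) auto
  also have "\<dots> = (\<Oplus>\<^bsub>ring_module R\<^esub>z\<in>?T. if y = z then w z else \<zero>\<^bsub>ring_module R\<^esub>)"
    using free_module_closed[OF w]
    by (intro R'.M.finsum_cong') (auto simp: free_gen_def)
  also have "\<dots> = w y"
  proof (cases "y \<in> ?T")
    case True
    then show ?thesis
      using T(1) free_module_closed[OF w] by (intro R'.M.finsum_singleton) auto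
  next
    case False
    have "(\<Oplus>\<^bsub>ring_module R\<^esub>z\<in>?T. if y = z then w z else \<zero>\<^bsub>ring_module R\<^esub>) = \<zero>\<^bsub>ring_module R\<^esub>"
      using False by (intro R'.M.add.finprod_one_eqI) auto
    then show ?thesis using False by simp
  qed
  finally show "free_lift R ?F (free_gen R) w y = w y" .
qed

end

section \<open>Bilinear maps and the universal property of the tensor product\<close>

definition bilinear_on ::
  "('r, 'x) ring_scheme \<Rightarrow> ('r, 'm, 'y) module_scheme \<Rightarrow> ('r, 'n, 'z) module_scheme \<Rightarrow>
    ('r, 'p, 'w) module_scheme \<Rightarrow> ('m \<Rightarrow> 'n \<Rightarrow> 'p) \<Rightarrow> bool"
  where "bilinear_on R M N P \<beta> \<longleftrightarrow>
    (\<forall>x\<in>carrier M. (\<lambda>y. \<beta> x y) \<in> mod_hom R N P) \<and> (\<forall>y\<in>carrier N. (\<lambda>x. \<beta> x y) \<in> mod_hom R M P)"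

lemma bilinear_onI:
  assumes "\<And>x. x \<in> carrier M \<Longrightarrow> (\<lambda>y. \<beta> x y) \<in> mod_hom R N P"
    and "\<And>y. y \<in> carrier N \<Longrightarrow> (\<lambda>x. \<beta> x y) \<in> mod_hom R M P"
  shows "bilinear_on R M N P \<beta>"
  using assms by (simp add: bilinear_on_def)

lemma bilinear_on_right: "bilinear_on R M N P \<beta> \<Longrightarrow> x \<in> carrier M \<Longrightarrow> (\<lambda>y. \<beta> x y) \<in> mod_hom R N P"
  and bilinear_on_left: "bilinear_on R M N P \<beta> \<Longrightarrow> y \<in> carrier N \<Longrightarrow> (\<lambda>x. \<beta> x y) \<in> mod_hom R M P"
  by (simp_all add: bilinear_on_def)

lemma bilinear_on_closed:
  "bilinear_on R M N P \<beta> \<Longrightarrow> x \<in> carrier M \<Longrightarrow> y \<in> carrier N \<Longrightarrow> \<beta> x y \<in> carrier P"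
  by (auto dest: bilinear_on_right mod_hom_closed)

lemma bilinear_on_comp:
  "h \<in> mod_hom R P Q \<Longrightarrow> bilinear_on R M N P \<beta> \<Longrightarrow> bilinear_on R M N Q (\<lambda>x y. h (\<beta> x y))"
  by (rule bilinear_onI) (blast intro: mod_hom_comp[where h = "\<lambda>y. \<beta> _ y"] mod_hom_comp[where h = "\<lambda>x. \<beta> x _"]
      bilinear_on_right bilinear_on_left)+

lemma bilinear_on_flip: "bilinear_on R M N P \<beta> \<Longrightarrow> bilinear_on R N M P (\<lambda>y x. \<beta> x y)"
  by (simp add: bilinear_on_def)

lemma tensor_lift_eq_free_lift:
  "tensor_lift R P \<beta> t = the_elem (free_lift R P (\<lambda>z. \<beta> (fst z) (snd z)) ` t)"
  by (simp add: tensor_lift_def free_lift_def)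

lemma tensor_relationsI:
  "m \<in> carrier M \<Longrightarrow> m' \<in> carrier M \<Longrightarrow> n \<in> carrier N \<Longrightarrow>
    free_gen R (m \<oplus>\<^bsub>M\<^esub> m', n) \<ominus>\<^bsub>free_prod R M N\<^esub> (free_gen R (m, n) \<oplus>\<^bsub>free_prod R M N\<^esub> free_gen R (m', n))
      \<in> tensor_relations R M N"
  "m \<in> carrier M \<Longrightarrow> n \<in> carrier N \<Longrightarrow> n' \<in> carrier N \<Longrightarrow>
    free_gen R (m, n \<oplus>\<^bsub>N\<^esub> n') \<ominus>\<^bsub>free_prod R M N\<^esub> (free_gen R (m, n) \<oplus>\<^bsub>free_prod R M N\<^esub> free_gen R (m, n'))
      \<in> tensor_relations R M N"
  "r \<in> carrier R \<Longrightarrow> m \<in> carrier M \<Longrightarrow> n \<in> carrier N \<Longrightarrow>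
    free_gen R (r \<odot>\<^bsub>M\<^esub> m, n) \<ominus>\<^bsub>free_prod R M N\<^esub> r \<odot>\<^bsub>free_prod R M N\<^esub> free_gen R (m, n)
      \<in> tensor_relations R M N"
  "r \<in> carrier R \<Longrightarrow> m \<in> carrier M \<Longrightarrow> n \<in> carrier N \<Longrightarrow>
    free_gen R (m, r \<odot>\<^bsub>N\<^esub> n) \<ominus>\<^bsub>free_prod R M N\<^esub> r \<odot>\<^bsub>free_prod R M N\<^esub> free_gen R (m, n)
      \<in> tensor_relations R M N"
  unfolding tensor_relations_def Let_def by blast+

context
  fixes R :: "('r, 'x) ring_scheme" and M :: "('r, 'm, 'y) module_scheme"
    and N :: "('r, 'n, 'z) module_scheme"
  assumes M: "module R M" and N: "module R N"
begin

interpretation M: module R M by (rule M)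
interpretation N: module R N by (rule N)
interpretation F: module R "free_prod R M N" by (rule M.module_free_module)

private abbreviation "F \<equiv> free_prod R M N"
private abbreviation "K \<equiv> tensor_kernel R M N"
private abbreviation "T \<equiv> tensor R M N"
private abbreviation "e \<equiv> \<lambda>m n. free_gen R (m, n)"

lemma tensor_gen_closed: "m \<in> carrier M \<Longrightarrow> n \<in> carrier N \<Longrightarrow> e m n \<in> carrier F"
  by (rule M.free_gen_closed) simp

lemma tensor_relations_subset: "tensor_relations R M N \<subseteq> carrier F"
  unfolding tensor_relations_def Let_def
  using tensor_gen_closed by (auto simp del: free_module_simps)

lemma submodule_tensor_kernel: "submodule K R F"
  unfolding tensor_kernel_def by (rule submodule_span[OF F.module_axioms tensor_relations_subset])

lemma module_tensor: "module R T"
  unfolding tensor_def by (rule module_quotient[OF F.module_axioms submodule_tensor_kernel])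

lemma mod_hom_tensor_coset: "(\<lambda>w. K +>\<^bsub>F\<^esub> w) \<in> mod_hom R F T"
  unfolding tensor_def by (rule mod_hom_coset[OF F.module_axioms submodule_tensor_kernel])

lemma pure_tensor_closed: "m \<in> carrier M \<Longrightarrow> n \<in> carrier N \<Longrightarrow> pure_tensor R M N m n \<in> carrier T"
  unfolding pure_tensor_def using mod_hom_closed[OF mod_hom_tensor_coset tensor_gen_closed] .

lemma tensor_coset_eq:
  assumes "v \<ominus>\<^bsub>F\<^esub> w \<in> tensor_relations R M N" "v \<in> carrier F" "w \<in> carrier F"
  shows "K +>\<^bsub>F\<^esub> v = K +>\<^bsub>F\<^esub> w"
proof -
  have "v \<ominus>\<^bsub>F\<^esub> w \<in> K"
    unfolding tensor_kernel_def by (rule subsetD[OF span_superset assms(1)])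
  then show ?thesis
    by (simp only: coset_eq_iff[OF F.module_axioms submodule_tensor_kernel assms(2,3)])
qed

text \<open>Each of the four families in \<open>tensor_relations\<close> is the defect of one law:
  additivity or homogeneity in one of the two arguments.\<close>

lemma bilinear_pure_tensor: "bilinear_on R M N T (pure_tensor R M N)"
proof (intro bilinear_onI mod_homI)
  fix m n n' assume *: "m \<in> carrier M" "n \<in> carrier N" "n' \<in> carrier N"
  have "K +>\<^bsub>F\<^esub> e m (n \<oplus>\<^bsub>N\<^esub> n') = K +>\<^bsub>F\<^esub> (e m n \<oplus>\<^bsub>F\<^esub> e m n')"
    by (intro tensor_coset_eq F.a_closed tensor_relationsI tensor_gen_closed M.a_closed N.a_closed
        M.smult_closed N.smult_closed *)
  then show "pure_tensor R M N m (n \<oplus>\<^bsub>N\<^esub> n') = pure_tensor R M N m n \<oplus>\<^bsub>T\<^esub> pure_tensor R M N m n'"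
    using mod_hom_add[OF mod_hom_tensor_coset] * tensor_gen_closed by (simp add: pure_tensor_def)
next
  fix m m' n assume *: "m \<in> carrier M" "m' \<in> carrier M" "n \<in> carrier N"
  have "K +>\<^bsub>F\<^esub> e (m \<oplus>\<^bsub>M\<^esub> m') n = K +>\<^bsub>F\<^esub> (e m n \<oplus>\<^bsub>F\<^esub> e m' n)"
    by (intro tensor_coset_eq F.a_closed tensor_relationsI tensor_gen_closed M.a_closed N.a_closed
        M.smult_closed N.smult_closed *)
  then show "pure_tensor R M N (m \<oplus>\<^bsub>M\<^esub> m') n = pure_tensor R M N m n \<oplus>\<^bsub>T\<^esub> pure_tensor R M N m' n"
    using mod_hom_add[OF mod_hom_tensor_coset] * tensor_gen_closed by (simp add: pure_tensor_def)
next
  fix r m n assume *: "r \<in> carrier R" "m \<in> carrier M" "n \<in> carrier N"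
  have "K +>\<^bsub>F\<^esub> e m (r \<odot>\<^bsub>N\<^esub> n) = K +>\<^bsub>F\<^esub> (r \<odot>\<^bsub>F\<^esub> e m n)"
    by (intro tensor_coset_eq F.smult_closed tensor_relationsI tensor_gen_closed M.a_closed N.a_closed
        M.smult_closed N.smult_closed *)
  then show "pure_tensor R M N m (r \<odot>\<^bsub>N\<^esub> n) = r \<odot>\<^bsub>T\<^esub> pure_tensor R M N m n"
    using mod_hom_smult[OF mod_hom_tensor_coset] * tensor_gen_closed by (simp add: pure_tensor_def)
  have "K +>\<^bsub>F\<^esub> e (r \<odot>\<^bsub>M\<^esub> m) n = K +>\<^bsub>F\<^esub> (r \<odot>\<^bsub>F\<^esub> e m n)"
    by (intro tensor_coset_eq F.smult_closed tensor_relationsI tensor_gen_closed M.a_closed N.a_closed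
        M.smult_closed N.smult_closed *)
  then show "pure_tensor R M N (r \<odot>\<^bsub>M\<^esub> m) n = r \<odot>\<^bsub>T\<^esub> pure_tensor R M N m n"
    using mod_hom_smult[OF mod_hom_tensor_coset] * tensor_gen_closed by (simp add: pure_tensor_def)
qed (auto intro: pure_tensor_closed)

text \<open>A coset is represented by a finite combination of generators, and a scalar can be
  absorbed into the left factor of a pure tensor. Hence neither scalars nor zero require a case of
  their own.\<close>

lemma tensor_induct [consumes 1, case_names pure add]:
  assumes "t \<in> carrier T"
    and "\<And>m n. m \<in> carrier M \<Longrightarrow> n \<in> carrier N \<Longrightarrow> Q (pure_tensor R M N m n)"
    and "\<And>s t. s \<in> carrier T \<Longrightarrow> t \<in> carrier T \<Longrightarrow> Q s \<Longrightarrow> Q t \<Longrightarrow> Q (s \<oplus>\<^bsub>T\<^esub> t)"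
  shows "Q t"
proof -
  interpret T: module R T by (rule module_tensor)
  obtain w where w: "w \<in> carrier F" "t = K +>\<^bsub>F\<^esub> w"
    using assms(1) quotient_cases[OF F.module_axioms submodule_tensor_kernel] unfolding tensor_def by blast
  let ?S = "{z. w z \<noteq> \<zero>\<^bsub>R\<^esub>}"
  have S: "finite ?S" "?S \<subseteq> carrier M \<times> carrier N"
    using w(1) by (auto simp: free_module_carrier_iff)
  have "t = K +>\<^bsub>F\<^esub> (\<Oplus>\<^bsub>F\<^esub>z\<in>?S. w z \<odot>\<^bsub>F\<^esub> free_gen R z)"
    using M.free_lift_free_gen[OF w(1)] w(2) by (simp add: free_lift_def)
  also have "\<dots> = (\<Oplus>\<^bsub>T\<^esub>z\<in>?S. K +>\<^bsub>F\<^esub> (w z \<odot>\<^bsub>F\<^esub> free_gen R z))"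
    using S(2) M.free_module_closed[OF w(1)]
    by (intro mod_hom_finsum[OF mod_hom_tensor_coset F.module_axioms module_tensor] funcsetI
        F.smult_closed M.free_gen_closed) blast+
  also have "Q \<dots>"
  proof -
    \<comment> \<open>The coefficient \<open>w z\<close> moves into the left factor, so each summand
      is a single pure tensor.\<close>
    have pure: "\<exists>m\<in>carrier M. \<exists>n\<in>carrier N. K +>\<^bsub>F\<^esub> (w z \<odot>\<^bsub>F\<^esub> free_gen R z) = pure_tensor R M N m n"
      if zMN: "z \<in> carrier M \<times> carrier N" for z
    proof -
      obtain m n where z: "z = (m, n)" "m \<in> carrier M" "n \<in> carrier N"
        using zMN by blast
      then have "K +>\<^bsub>F\<^esub> (w z \<odot>\<^bsub>F\<^esub> free_gen R z) = w z \<odot>\<^bsub>T\<^esub> pure_tensor R M N m n"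
        unfolding pure_tensor_def z(1)
        using tensor_gen_closed M.free_module_closed[OF w(1)]
        by (intro mod_hom_smult[OF mod_hom_tensor_coset]) auto
      also have "\<dots> = pure_tensor R M N (w z \<odot>\<^bsub>M\<^esub> m) n"
        using z M.free_module_closed[OF w(1)]
        by (simp add: mod_hom_smult[OF bilinear_on_left[OF bilinear_pure_tensor]])
      finally show ?thesis
        using z M.free_module_closed[OF w(1)] by blast
    qed
    have "Q (\<Oplus>\<^bsub>T\<^esub>z\<in>S. K +>\<^bsub>F\<^esub> (w z \<odot>\<^bsub>F\<^esub> free_gen R z))"
      if "finite S" "S \<subseteq> carrier M \<times> carrier N" for S
      using that
    proof (induction S)
      case empty
      \<comment> \<open>The empty sum is covered by the case of pure tensors, being the tensor of
        two zeros.\<close>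
      have "pure_tensor R M N \<zero>\<^bsub>M\<^esub> \<zero>\<^bsub>N\<^esub> = \<zero>\<^bsub>T\<^esub>"
        by (rule mod_hom_zero[OF bilinear_on_right[OF bilinear_pure_tensor] N module_tensor]) simp
      then show ?case
        using assms(2)[of "\<zero>\<^bsub>M\<^esub>" "\<zero>\<^bsub>N\<^esub>"] by simp
    next
      case (insert z S)
      have cl: "K +>\<^bsub>F\<^esub> (w z \<odot>\<^bsub>F\<^esub> free_gen R z) \<in> carrier T" if "z \<in> carrier M \<times> carrier N" for z
        using pure[OF that] pure_tensor_closed by (elim bexE) (simp only:)
      have "(\<Oplus>\<^bsub>T\<^esub>z\<in>insert z S. K +>\<^bsub>F\<^esub> (w z \<odot>\<^bsub>F\<^esub> free_gen R z)) =
          (K +>\<^bsub>F\<^esub> (w z \<odot>\<^bsub>F\<^esub> free_gen R z)) \<oplus>\<^bsub>T\<^esub> (\<Oplus>\<^bsub>T\<^esub>z\<in>S. K +>\<^bsub>F\<^esub> (w z \<odot>\<^bsub>F\<^esub> free_gen R z))"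
        using insert(1,2,4) cl by (intro T.finsum_insert funcsetI) blast+
      moreover have "Q (K +>\<^bsub>F\<^esub> (w z \<odot>\<^bsub>F\<^esub> free_gen R z))"
      proof -
        from insert.prems have "z \<in> carrier M \<times> carrier N" by simp
        from pure[OF this] show ?thesis
          by (elim bexE) (simp only: assms(2))
      qed
      moreover have "(\<Oplus>\<^bsub>T\<^esub>z\<in>S. K +>\<^bsub>F\<^esub> (w z \<odot>\<^bsub>F\<^esub> free_gen R z)) \<in> carrier T"
        using cl insert.prems by (intro T.finsum_closed funcsetI) blast
      moreover have "K +>\<^bsub>F\<^esub> (w z \<odot>\<^bsub>F\<^esub> free_gen R z) \<in> carrier T"
        using cl insert.prems by blast
      moreover have "Q (\<Oplus>\<^bsub>T\<^esub>z\<in>S. K +>\<^bsub>F\<^esub> (w z \<odot>\<^bsub>F\<^esub> free_gen R z))"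
        using insert by blast
      ultimately show ?case
        by (simp only: assms(3))
    qed
    with S show ?thesis by blast
  qed
  finally show ?thesis .
qed

context
  fixes P :: "('r, 'p, 'w) module_scheme" and \<beta> :: "'m \<Rightarrow> 'n \<Rightarrow> 'p"
  assumes P: "module R P" and \<beta>: "bilinear_on R M N P \<beta>"
begin

interpretation P: module R P by (rule P)

private abbreviation "L \<equiv> free_lift R P (\<lambda>z. \<beta> (fst z) (snd z))"

lemma tensor_free_lift_hom: "L \<in> mod_hom R F P"
  using bilinear_on_closed[OF \<beta>] by (intro M.free_lift_hom[OF P]) auto

lemma tensor_free_lift_gen: "m \<in> carrier M \<Longrightarrow> n \<in> carrier N \<Longrightarrow> L (e m n) = \<beta> m n"
  using bilinear_on_closed[OF \<beta>]
  by (subst M.free_lift_gen[OF P, where X = "carrier M \<times> carrier N"]) auto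

text \<open>The zero set of the lift is a submodule, so it suffices to check the generating
  relations, on which bilinearity of \<open>\<beta>\<close> gives the value zero.\<close>

lemma tensor_free_lift_kernel:
  assumes "w \<in> K"
  shows "L w = \<zero>\<^bsub>P\<^esub>"
proof -
  have "L w = \<zero>\<^bsub>P\<^esub>" if w: "w \<in> tensor_relations R M N" for w
  proof -
    have zero: "L (v \<ominus>\<^bsub>F\<^esub> u) = \<zero>\<^bsub>P\<^esub>" if "L v = L u" "v \<in> carrier F" "u \<in> carrier F" for v u
      using that mod_hom_minus[OF tensor_free_lift_hom F.module_axioms P that(2,3)]
        mod_hom_closed[OF tensor_free_lift_hom that(3)]
      by (simp add: a_minus_def P.r_neg)
    show ?thesis
      using w unfolding tensor_relations_def Let_def
    proof (elim UnE CollectE exE conjE)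
      fix m m' n
      assume w: "w = e (m \<oplus>\<^bsub>M\<^esub> m') n \<ominus>\<^bsub>F\<^esub> (e m n \<oplus>\<^bsub>F\<^esub> e m' n)" and *: "m \<in> carrier M" "m' \<in> carrier M" "n \<in> carrier N"
      have "L (e (m \<oplus>\<^bsub>M\<^esub> m') n) = L ((e m n \<oplus>\<^bsub>F\<^esub> e m' n))"
        using * by (simp only: mod_hom_add[OF tensor_free_lift_hom] mod_hom_add[OF bilinear_on_left[OF \<beta>]]
            tensor_free_lift_gen tensor_gen_closed M.a_closed N.a_closed M.smult_closed N.smult_closed)
      then show ?thesis
        unfolding w using * by (intro zero tensor_gen_closed F.a_closed F.smult_closed M.a_closed N.a_closed
            M.smult_closed N.smult_closed)
    next
      fix m n n'
      assume w: "w = e m (n \<oplus>\<^bsub>N\<^esub> n') \<ominus>\<^bsub>F\<^esub> (e m n \<oplus>\<^bsub>F\<^esub> e m n')" and *: "m \<in> carrier M" "n \<in> carrier N" "n' \<in> carrier N"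
      have "L (e m (n \<oplus>\<^bsub>N\<^esub> n')) = L ((e m n \<oplus>\<^bsub>F\<^esub> e m n'))"
        using * by (simp only: mod_hom_add[OF tensor_free_lift_hom] mod_hom_add[OF bilinear_on_right[OF \<beta>]]
            tensor_free_lift_gen tensor_gen_closed M.a_closed N.a_closed M.smult_closed N.smult_closed)
      then show ?thesis
        unfolding w using * by (intro zero tensor_gen_closed F.a_closed F.smult_closed M.a_closed N.a_closed
            M.smult_closed N.smult_closed)
    next
      fix r m n
      assume w: "w = e (r \<odot>\<^bsub>M\<^esub> m) n \<ominus>\<^bsub>F\<^esub> r \<odot>\<^bsub>F\<^esub> e m n" and *: "r \<in> carrier R" "m \<in> carrier M" "n \<in> carrier N"
      have "L (e (r \<odot>\<^bsub>M\<^esub> m) n) = L (r \<odot>\<^bsub>F\<^esub> e m n)"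
        using * by (simp only: mod_hom_smult[OF tensor_free_lift_hom] mod_hom_smult[OF bilinear_on_left[OF \<beta>]]
            tensor_free_lift_gen tensor_gen_closed M.a_closed N.a_closed M.smult_closed N.smult_closed)
      then show ?thesis
        unfolding w using * by (intro zero tensor_gen_closed F.a_closed F.smult_closed M.a_closed N.a_closed
            M.smult_closed N.smult_closed)
    next
      fix r m n
      assume w: "w = e m (r \<odot>\<^bsub>N\<^esub> n) \<ominus>\<^bsub>F\<^esub> r \<odot>\<^bsub>F\<^esub> e m n" and *: "r \<in> carrier R" "m \<in> carrier M" "n \<in> carrier N"
      have "L (e m (r \<odot>\<^bsub>N\<^esub> n)) = L (r \<odot>\<^bsub>F\<^esub> e m n)"
        using * by (simp only: mod_hom_smult[OF tensor_free_lift_hom] mod_hom_smult[OF bilinear_on_right[OF \<beta>]]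
            tensor_free_lift_gen tensor_gen_closed M.a_closed N.a_closed M.smult_closed N.smult_closed)
      then show ?thesis
        unfolding w using * by (intro zero tensor_gen_closed F.a_closed F.smult_closed M.a_closed N.a_closed
            M.smult_closed N.smult_closed)
    qed
  qed
  then have "K \<subseteq> {w \<in> carrier F. L w = \<zero>\<^bsub>P\<^esub>}"
    unfolding tensor_kernel_def using tensor_relations_subset
    by (intro span_minimal submodule_kernel[OF tensor_free_lift_hom F.module_axioms P]) blast
  with assms show ?thesis by blast
qed

text \<open>Representatives of one coset differ by an element of the kernel, so the image in the
  definition of \<open>tensor_lift\<close> is a singleton and \<open>the_elem\<close> returns its
  element.\<close>

lemma tensor_lift_coset:
  assumes w: "w \<in> carrier F"
  shows "tensor_lift R P \<beta> (K +>\<^bsub>F\<^esub> w) = L w"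
proof -
  have "L v = L w" if v: "v \<in> K +>\<^bsub>F\<^esub> w" for v
  proof -
    have vF: "v \<in> carrier F"
      using v coset_subset[OF F.module_axioms submodule_tensor_kernel w] by blast
    have "L v \<ominus>\<^bsub>P\<^esub> L w = \<zero>\<^bsub>P\<^esub>"
      using v tensor_free_lift_kernel[of "v \<ominus>\<^bsub>F\<^esub> w"]
      unfolding mem_coset_iff[OF F.module_axioms submodule_tensor_kernel vF w]
      by (simp only: mod_hom_minus[OF tensor_free_lift_hom F.module_axioms P vF w])
    then show ?thesis
      using mod_hom_closed[OF tensor_free_lift_hom vF] mod_hom_closed[OF tensor_free_lift_hom w]
      by (rule P.minus_eq_zeroD)
  qed
  moreover have "w \<in> K +>\<^bsub>F\<^esub> w"
    by (rule coset_self[OF F.module_axioms submodule_tensor_kernel w])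
  ultimately have "L ` (K +>\<^bsub>F\<^esub> w) = {L w}"
    by blast
  then show ?thesis
    by (simp add: tensor_lift_eq_free_lift)
qed

lemma tensor_lift_pure:
  "m \<in> carrier M \<Longrightarrow> n \<in> carrier N \<Longrightarrow> tensor_lift R P \<beta> (pure_tensor R M N m n) = \<beta> m n"
  by (simp add: pure_tensor_def tensor_lift_coset tensor_gen_closed tensor_free_lift_gen)

lemma tensor_lift_hom: "tensor_lift R P \<beta> \<in> mod_hom R T P"
proof (rule mod_homI)
  note cases = quotient_cases[OF F.module_axioms submodule_tensor_kernel, folded tensor_def]
  note coset_add = mod_hom_add[OF mod_hom_tensor_coset, symmetric]
  fix s assume "s \<in> carrier T"
  then obtain v where v: "v \<in> carrier F" "s = K +>\<^bsub>F\<^esub> v" by (rule cases)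
  then show "tensor_lift R P \<beta> s \<in> carrier P"
    by (simp add: tensor_lift_coset mod_hom_closed[OF tensor_free_lift_hom])
  fix t assume "t \<in> carrier T"
  then obtain w where w: "w \<in> carrier F" "t = K +>\<^bsub>F\<^esub> w" by (rule cases)
  have "s \<oplus>\<^bsub>T\<^esub> t = K +>\<^bsub>F\<^esub> (v \<oplus>\<^bsub>F\<^esub> w)"
    unfolding v(2) w(2) by (rule coset_add[OF v(1) w(1)])
  then have "tensor_lift R P \<beta> (s \<oplus>\<^bsub>T\<^esub> t) = L (v \<oplus>\<^bsub>F\<^esub> w)"
    using v(1) w(1) by (simp only: tensor_lift_coset F.a_closed)
  then show "tensor_lift R P \<beta> (s \<oplus>\<^bsub>T\<^esub> t) = tensor_lift R P \<beta> s \<oplus>\<^bsub>P\<^esub> tensor_lift R P \<beta> t"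
    using v w by (simp only: tensor_lift_coset mod_hom_add[OF tensor_free_lift_hom])
next
  note cases = quotient_cases[OF F.module_axioms submodule_tensor_kernel, folded tensor_def]
  fix r s assume r: "r \<in> carrier R" and s: "s \<in> carrier T"
  from s obtain v where v: "v \<in> carrier F" "s = K +>\<^bsub>F\<^esub> v" by (rule cases)
  have "r \<odot>\<^bsub>T\<^esub> s = K +>\<^bsub>F\<^esub> (r \<odot>\<^bsub>F\<^esub> v)"
    unfolding v(2) by (rule mod_hom_smult[OF mod_hom_tensor_coset r v(1), symmetric])
  then have "tensor_lift R P \<beta> (r \<odot>\<^bsub>T\<^esub> s) = L (r \<odot>\<^bsub>F\<^esub> v)"
    using r v(1) by (simp only: tensor_lift_coset F.smult_closed)
  then show "tensor_lift R P \<beta> (r \<odot>\<^bsub>T\<^esub> s) = r \<odot>\<^bsub>P\<^esub> tensor_lift R P \<beta> s"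
    using r v by (simp only: tensor_lift_coset mod_hom_smult[OF tensor_free_lift_hom])
qed

end

text \<open>Uniqueness in the universal property. Most identities between Sweedler sums below are
  reduced to pure tensors through it.\<close>

lemma tensor_hom_eq:
  assumes "f \<in> mod_hom R T P" "g \<in> mod_hom R T P" "t \<in> carrier T"
    and "\<And>m n. m \<in> carrier M \<Longrightarrow> n \<in> carrier N \<Longrightarrow> f (pure_tensor R M N m n) = g (pure_tensor R M N m n)"
  shows "f t = g t"
  using assms(3)
  by (induction rule: tensor_induct) (simp_all add: assms(4) mod_hom_add[OF assms(1)] mod_hom_add[OF assms(2)])

lemma bilinear_on_cong:
  assumes "bilinear_on R M N P \<beta>"
    and "\<And>x y. x \<in> carrier M \<Longrightarrow> y \<in> carrier N \<Longrightarrow> \<beta>' x y = \<beta> x y"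
  shows "bilinear_on R M N P \<beta>'"
proof (rule bilinear_onI)
  show "\<beta>' x \<in> mod_hom R N P" if "x \<in> carrier M" for x
    by (rule mod_hom_cong[OF bilinear_on_right[OF assms(1) that] N]) (simp add: assms(2) that)
  show "(\<lambda>x. \<beta>' x y) \<in> mod_hom R M P" if "y \<in> carrier N" for y
    by (rule mod_hom_cong[OF bilinear_on_left[OF assms(1) that] M]) (simp add: assms(2) that)
qed

text \<open>Equality on the carriers transfers bilinearity from \<open>\<beta>\<close> to
  \<open>\<beta>'\<close>, after which pure tensors decide. This serves to rewrite under a Sweedler
  sum, where the summation variables are known to lie in the carriers.\<close>

lemma tensor_lift_cong:
  assumes "module R P" "bilinear_on R M N P \<beta>" "t \<in> carrier T"
    and "\<And>x y. x \<in> carrier M \<Longrightarrow> y \<in> carrier N \<Longrightarrow> \<beta>' x y = \<beta> x y"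
  shows "tensor_lift R P \<beta>' t = tensor_lift R P \<beta> t"
proof -
  have \<beta>': "bilinear_on R M N P \<beta>'"
    using bilinear_on_cong assms(2,4) .
  show ?thesis
    by (rule tensor_hom_eq[OF tensor_lift_hom[OF assms(1) \<beta>'] tensor_lift_hom[OF assms(1,2)] assms(3)])
      (simp add: tensor_lift_pure[OF assms(1)] \<beta>' assms(2,4))
qed

text \<open>Both sides are linear in \<open>t\<close> and agree on pure tensors. This is how a
  linear map is pushed under a Sweedler sum.\<close>

lemma tensor_lift_comp:
  assumes "module R P" "module R Q" "h \<in> mod_hom R P Q" "bilinear_on R M N P \<beta>" "t \<in> carrier T"
  shows "h (tensor_lift R P \<beta> t) = tensor_lift R Q (\<lambda>x y. h (\<beta> x y)) t"
proof -
  note b = bilinear_on_comp[OF assms(3,4)]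
  show ?thesis
    by (rule tensor_hom_eq[OF mod_hom_comp[OF assms(3) tensor_lift_hom[OF assms(1,4)]]
          tensor_lift_hom[OF assms(2) b] assms(5)])
      (simp add: tensor_lift_pure[OF assms(1,4)] tensor_lift_pure[OF assms(2) b])
qed

text \<open>Here the tensor is fixed and the bilinear map varies. For each pair of parameters the
  two sides are linear in \<open>t\<close>, so pure tensors suffice. Needed whenever the result of
  one lift is the integrand of another.\<close>

lemma tensor_lift_param_hom:
  assumes "module R P" "module R L" "t \<in> carrier T"
    and b: "\<And>u. u \<in> carrier L \<Longrightarrow> bilinear_on R M N P (\<beta> u)"
    and h: "\<And>x y. x \<in> carrier M \<Longrightarrow> y \<in> carrier N \<Longrightarrow> (\<lambda>u. \<beta> u x y) \<in> mod_hom R L P"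
  shows "(\<lambda>u. tensor_lift R P (\<beta> u) t) \<in> mod_hom R L P"
proof -
  interpret L: module R L by fact
  show ?thesis
  proof (rule mod_homI)
    fix u assume u: "u \<in> carrier L"
    show "tensor_lift R P (\<beta> u) t \<in> carrier P"
      by (rule mod_hom_closed[OF tensor_lift_hom[OF assms(1) b[OF u]] assms(3)])
    fix v assume v: "v \<in> carrier L"
    show "tensor_lift R P (\<beta> (u \<oplus>\<^bsub>L\<^esub> v)) t = tensor_lift R P (\<beta> u) t \<oplus>\<^bsub>P\<^esub> tensor_lift R P (\<beta> v) t"
      by (rule tensor_hom_eq[where f = "tensor_lift R P (\<beta> (u \<oplus>\<^bsub>L\<^esub> v))",
            OF tensor_lift_hom[OF assms(1) b] mod_hom_add_fun[OF tensor_lift_hom tensor_lift_hom] assms(3)])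
        (use u v b assms(1) in \<open>simp_all add: tensor_lift_pure[OF assms(1)] mod_hom_add[OF h]\<close>)
  next
    fix r u assume r: "r \<in> carrier R" and u: "u \<in> carrier L"
    show "tensor_lift R P (\<beta> (r \<odot>\<^bsub>L\<^esub> u)) t = r \<odot>\<^bsub>P\<^esub> tensor_lift R P (\<beta> u) t"
      by (rule tensor_hom_eq[where f = "tensor_lift R P (\<beta> (r \<odot>\<^bsub>L\<^esub> u))",
            OF tensor_lift_hom[OF assms(1) b] mod_hom_smult_fun[OF tensor_lift_hom] assms(3)])
        (use r u b assms(1) in \<open>simp_all add: tensor_lift_pure[OF assms(1)] mod_hom_smult[OF h]\<close>)
  qed
qed

end

section \<open>Nested lifts and exchange of summations\<close>

lemma tensor_lift_bilinear:
  assumes M: "module R M" "module R N" and U: "module R U" "module R V" and P: "module R P"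
    and s: "s \<in> carrier (tensor R U V)"
    and b1: "\<And>x y. x \<in> carrier M \<Longrightarrow> y \<in> carrier N \<Longrightarrow> bilinear_on R U V P (\<lambda>u v. T x y u v)"
    and b2: "\<And>u v. u \<in> carrier U \<Longrightarrow> v \<in> carrier V \<Longrightarrow> bilinear_on R M N P (\<lambda>x y. T x y u v)"
  shows "bilinear_on R M N P (\<lambda>x y. tensor_lift R P (\<lambda>u v. T x y u v) s)"
proof (rule bilinear_onI)
  fix x assume "x \<in> carrier M"
  then show "(\<lambda>y. tensor_lift R P (\<lambda>u v. T x y u v) s) \<in> mod_hom R N P"
    by (intro tensor_lift_param_hom[OF U P M(2) s] b1 bilinear_on_right[OF b2])
next
  fix y assume "y \<in> carrier N"
  then show "(\<lambda>x. tensor_lift R P (\<lambda>u v. T x y u v) s) \<in> mod_hom R M P"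
    by (intro tensor_lift_param_hom[OF U P M(1) s] b1 bilinear_on_left[OF b2])
qed

text \<open>A Fubini rule: both sides are linear in \<open>t\<close>, and for a pure
  \<open>t\<close> both reduce to the single lift over \<open>s\<close>. It later exchanges a sum
  over the comultiplication of a functional with a sum over \<open>\<Delta> a\<close>.\<close>

lemma tensor_lift_swap:
  assumes M: "module R M" "module R N" and U: "module R U" "module R V" and P: "module R P"
    and t: "t \<in> carrier (tensor R M N)" and s: "s \<in> carrier (tensor R U V)"
    and b1: "\<And>x y. x \<in> carrier M \<Longrightarrow> y \<in> carrier N \<Longrightarrow> bilinear_on R U V P (\<lambda>u v. T x y u v)"
    and b2: "\<And>u v. u \<in> carrier U \<Longrightarrow> v \<in> carrier V \<Longrightarrow> bilinear_on R M N P (\<lambda>x y. T x y u v)"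
  shows "tensor_lift R P (\<lambda>x y. tensor_lift R P (\<lambda>u v. T x y u v) s) t =
    tensor_lift R P (\<lambda>u v. tensor_lift R P (\<lambda>x y. T x y u v) t) s"
proof -
  have L: "bilinear_on R M N P (\<lambda>x y. tensor_lift R P (\<lambda>u v. T x y u v) s)"
    by (rule tensor_lift_bilinear[OF M U P s b1 b2])
  have Rt: "bilinear_on R U V P (\<lambda>u v. tensor_lift R P (\<lambda>x y. T x y u v) t)"
    if t: "t \<in> carrier (tensor R M N)" for t
    by (rule tensor_lift_bilinear[OF U M P t b2 b1])
  have R: "(\<lambda>t. tensor_lift R P (\<lambda>u v. tensor_lift R P (\<lambda>x y. T x y u v) t) s)
      \<in> mod_hom R (tensor R M N) P"
    by (intro tensor_lift_param_hom[OF U P module_tensor[OF M] s] Rt tensor_lift_hom[OF M P] b2)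
  show ?thesis
  proof (rule tensor_hom_eq[OF M tensor_lift_hom[OF M P L] R t])
    fix x y assume xy: "x \<in> carrier M" "y \<in> carrier N"
    have "tensor_lift R P (\<lambda>u v. tensor_lift R P (\<lambda>x y. T x y u v) (pure_tensor R M N x y)) s =
        tensor_lift R P (\<lambda>u v. T x y u v) s"
      using xy by (intro tensor_lift_cong[OF U P b1 s]) (simp_all add: tensor_lift_pure[OF M P b2])
    then show "tensor_lift R P (\<lambda>x y. tensor_lift R P (\<lambda>u v. T x y u v) s) (pure_tensor R M N x y) =
        tensor_lift R P (\<lambda>u v. tensor_lift R P (\<lambda>x y. T x y u v) (pure_tensor R M N x y)) s"
      using xy by (simp add: tensor_lift_pure[OF M P L])
  qed
qed

section \<open>Modules of linear maps\<close>

lemma hom_module_simps: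
  "carrier (hom_module R M N) = mod_hom R M N \<inter> extensional (carrier M)"
  "add (hom_module R M N) = (\<lambda>f g. \<lambda>x\<in>carrier M. f x \<oplus>\<^bsub>N\<^esub> g x)"
  "zero (hom_module R M N) = (\<lambda>x\<in>carrier M. \<zero>\<^bsub>N\<^esub>)"
  "smult (hom_module R M N) = (\<lambda>r f. \<lambda>x\<in>carrier M. r \<odot>\<^bsub>N\<^esub> f x)"
  by (simp_all add: hom_module_def)

lemma hom_module_eqI:
  assumes "f \<in> carrier (hom_module R M N)" "g \<in> carrier (hom_module R M N)"
    and "\<And>x. x \<in> carrier M \<Longrightarrow> f x = g x"
  shows "f = g"
  using assms by (auto simp: hom_module_simps intro: extensionalityI)

lemma hom_module_restrict:
  assumes "h \<in> mod_hom R M N" "module R M"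
  shows "restrict h (carrier M) \<in> carrier (hom_module R M N)"
  using mod_hom_cong[OF assms, of "restrict h (carrier M)"] by (simp add: hom_module_simps)

lemma module_hom_module:
  assumes M: "module R M" and N: "module R N"
  shows "module R (hom_module R M N)"
proof (rule moduleI)
  interpret M: module R M by fact
  interpret N: module R N by fact
  let ?H = "hom_module R M N"
  have cl: "f x \<in> carrier N" if "f \<in> carrier ?H" "x \<in> carrier M" for f x
    using that by (auto simp: hom_module_simps dest: mod_hom_closed)
  have add: "f \<oplus>\<^bsub>?H\<^esub> g \<in> carrier ?H" if "f \<in> carrier ?H" "g \<in> carrier ?H" for f g
    using hom_module_restrict[OF mod_hom_add_fun[OF _ _ N] M, of f g] that
    by (simp add: hom_module_simps)
  have smult: "r \<odot>\<^bsub>?H\<^esub> f \<in> carrier ?H" if "r \<in> carrier R" "f \<in> carrier ?H" for r f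
    using hom_module_restrict[OF mod_hom_smult_fun[OF _ _ N] M, of f r] that
    by (simp add: hom_module_simps)
  have zero: "\<zero>\<^bsub>?H\<^esub> \<in> carrier ?H"
    using hom_module_restrict[OF mod_hom_zero_fun[OF N] M] by (simp add: hom_module_simps)
  show "cring R" by (rule M.is_cring)
  show "abelian_group ?H"
  proof (rule abelian_groupI)
    fix f assume f: "f \<in> carrier ?H"
    show "\<exists>g\<in>carrier ?H. g \<oplus>\<^bsub>?H\<^esub> f = \<zero>\<^bsub>?H\<^esub>"
    proof (intro bexI)
      show g: "(\<ominus>\<^bsub>R\<^esub> \<one>\<^bsub>R\<^esub>) \<odot>\<^bsub>?H\<^esub> f \<in> carrier ?H"
        by (rule smult[OF _ f]) simp
      show "(\<ominus>\<^bsub>R\<^esub> \<one>\<^bsub>R\<^esub>) \<odot>\<^bsub>?H\<^esub> f \<oplus>\<^bsub>?H\<^esub> f = \<zero>\<^bsub>?H\<^esub>"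
        by (rule hom_module_eqI[OF add[OF g f] zero])
          (simp add: hom_module_simps N.smult_l_minus N.l_neg cl[OF f])
    qed
    show "\<zero>\<^bsub>?H\<^esub> \<oplus>\<^bsub>?H\<^esub> f = f"
      by (rule hom_module_eqI[OF add[OF zero f] f]) (simp add: hom_module_simps cl[OF f])
    fix g assume g: "g \<in> carrier ?H"
    show "f \<oplus>\<^bsub>?H\<^esub> g = g \<oplus>\<^bsub>?H\<^esub> f"
      by (rule hom_module_eqI[OF add[OF f g] add[OF g f]])
        (simp add: hom_module_simps N.a_comm cl[OF f] cl[OF g])
    fix h assume h: "h \<in> carrier ?H"
    show "f \<oplus>\<^bsub>?H\<^esub> g \<oplus>\<^bsub>?H\<^esub> h = f \<oplus>\<^bsub>?H\<^esub> (g \<oplus>\<^bsub>?H\<^esub> h)"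
      by (rule hom_module_eqI[OF add[OF add[OF f g] h] add[OF f add[OF g h]]])
        (simp add: hom_module_simps N.a_assoc cl[OF f] cl[OF g] cl[OF h])
  qed (auto simp: add zero)
  have "\<one>\<^bsub>R\<^esub> \<odot>\<^bsub>?H\<^esub> f = f" if f: "f \<in> carrier ?H" for f
    by (rule hom_module_eqI[OF smult[OF M.one_closed f] f]) (simp add: hom_module_simps cl[OF f])
  then show "\<And>f. f \<in> carrier ?H \<Longrightarrow> \<one>\<^bsub>R\<^esub> \<odot>\<^bsub>?H\<^esub> f = f" .
  fix r f assume r: "r \<in> carrier R" and f: "f \<in> carrier ?H"
  show rf: "r \<odot>\<^bsub>?H\<^esub> f \<in> carrier ?H"
    by (rule smult[OF r f])
  {
    fix s assume s: "s \<in> carrier R"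
    show "(r \<oplus>\<^bsub>R\<^esub> s) \<odot>\<^bsub>?H\<^esub> f = r \<odot>\<^bsub>?H\<^esub> f \<oplus>\<^bsub>?H\<^esub> s \<odot>\<^bsub>?H\<^esub> f"
      by (rule hom_module_eqI[OF smult[OF M.R.a_closed[OF r s] f] add[OF rf smult[OF s f]]])
        (simp add: hom_module_simps N.smult_l_distr r s cl[OF f])
    show "(r \<otimes>\<^bsub>R\<^esub> s) \<odot>\<^bsub>?H\<^esub> f = r \<odot>\<^bsub>?H\<^esub> (s \<odot>\<^bsub>?H\<^esub> f)"
      by (rule hom_module_eqI[OF smult[OF M.m_closed[OF r s] f] smult[OF r smult[OF s f]]])
        (simp add: hom_module_simps N.smult_assoc1 r s cl[OF f])
  next
    fix g assume g: "g \<in> carrier ?H"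
    show "r \<odot>\<^bsub>?H\<^esub> (f \<oplus>\<^bsub>?H\<^esub> g) = r \<odot>\<^bsub>?H\<^esub> f \<oplus>\<^bsub>?H\<^esub> r \<odot>\<^bsub>?H\<^esub> g"
      by (rule hom_module_eqI[OF smult[OF r add[OF f g]] add[OF rf smult[OF r g]]])
        (simp add: hom_module_simps N.smult_r_distr r cl[OF f] cl[OF g])
  }
qed

lemma mod_hom_eval:
  assumes "x \<in> carrier M"
  shows "(\<lambda>f. f x) \<in> mod_hom R (hom_module R M N) N"
  using assms by (auto intro!: mod_homI simp: hom_module_simps dest: mod_hom_closed)

text \<open>Currying of a bilinear map. The restriction is forced because elements of
  \<open>hom_module\<close> are extensional.\<close>

lemma mod_hom_into_hom_module:
  assumes "module R M" "module R N" "module R L"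
    and "\<And>u. u \<in> carrier L \<Longrightarrow> (\<lambda>x. h u x) \<in> mod_hom R M N"
    and "\<And>x. x \<in> carrier M \<Longrightarrow> (\<lambda>u. h u x) \<in> mod_hom R L N"
  shows "(\<lambda>u. \<lambda>x\<in>carrier M. h u x) \<in> mod_hom R L (hom_module R M N)"
proof -
  interpret L: module R L by fact
  interpret H: module R "hom_module R M N" by (rule module_hom_module[OF assms(1,2)])
  have cl: "(\<lambda>x\<in>carrier M. h u x) \<in> carrier (hom_module R M N)" if "u \<in> carrier L" for u
    by (rule hom_module_restrict[OF assms(4)[OF that] assms(1)])
  show ?thesis
  proof (rule mod_homI)
    fix u assume u: "u \<in> carrier L"
    show "(\<lambda>x\<in>carrier M. h u x) \<in> carrier (hom_module R M N)" by (rule cl[OF u])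
    fix v assume v: "v \<in> carrier L"
    show "(\<lambda>x\<in>carrier M. h (u \<oplus>\<^bsub>L\<^esub> v) x) =
        (\<lambda>x\<in>carrier M. h u x) \<oplus>\<^bsub>hom_module R M N\<^esub> (\<lambda>x\<in>carrier M. h v x)"
      by (rule hom_module_eqI[OF cl[OF L.M.a_closed[OF u v]] H.M.a_closed[OF cl[OF u] cl[OF v]]])
        (simp add: hom_module_simps mod_hom_add[OF assms(5)] u v)
  next
    fix r u assume r: "r \<in> carrier R" and u: "u \<in> carrier L"
    show "(\<lambda>x\<in>carrier M. h (r \<odot>\<^bsub>L\<^esub> u) x) = r \<odot>\<^bsub>hom_module R M N\<^esub> (\<lambda>x\<in>carrier M. h u x)"
      by (rule hom_module_eqI[OF cl[OF L.smult_closed[OF r u]] H.smult_closed[OF r cl[OF u]]])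
        (simp add: hom_module_simps mod_hom_smult[OF assms(5)] r u)
  qed
qed

section \<open>Finiteness conditions\<close>

text \<open>Bridge to \<open>noetherian_ring\<close>, whose finiteness condition speaks of
  ideals.\<close>

lemma (in cring) ideal_if_submodule:
  assumes "submodule J R (ring_module R)"
  shows "ideal J R"
proof (rule idealI)
  interpret R': module R "ring_module R" by (rule module_ring_module)
  show "ring R" by (rule ring_axioms)
  show "subgroup J (add_monoid R)"
    using submodule.axioms(1)[OF assms] by (simp add: subgroup_def m_inv_def)
  fix a x assume "a \<in> J" "x \<in> carrier R"
  then show "x \<otimes> a \<in> J"
    using R'.submoduleE(4)[OF assms] by simp
  moreover have "a \<in> carrier R"
    using submodule_subset[OF assms] \<open>a \<in> J\<close> by auto
  ultimately show "a \<otimes> x \<in> J"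
    using \<open>x \<in> carrier R\<close> by (simp add: m_comm)
qed

lemma mod_hom_smult_left:
  assumes "module R M" "x \<in> carrier M"
  shows "(\<lambda>r. r \<odot>\<^bsub>M\<^esub> x) \<in> mod_hom R (ring_module R) M"
proof -
  interpret M: module R M by fact
  show ?thesis
    using assms(2) by (auto intro!: mod_homI simp: M.smult_l_distr M.smult_assoc1)
qed

text \<open>Induction on the generators. The coefficients \<open>r\<close> with \<open>r x\<close>
  in \<open>N\<close> plus the span of \<open>S\<close> form an ideal, which has finitely many
  generators. Elements of \<open>N\<close> realising these, together with generators of the
  intersection of \<open>N\<close> with the span of \<open>S\<close>, generate \<open>N\<close>.
  Everything happens inside \<open>M\<close>, so no subquotients have to be formed.\<close>

lemma noetherian_submodule_of_span:
  assumes R: "noetherian_ring R" and M: "module R M"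
    and "finite S" "S \<subseteq> carrier M" "submodule N R M" "N \<subseteq> module_span R M S"
  shows "\<exists>G. finite G \<and> G \<subseteq> N \<and> module_span R M G = N"
  using assms(3-)
proof (induction S arbitrary: N)
  case empty
  then have "module_span R M {} = N"
    using span_minimal[OF empty.prems(2), of "{}"] by auto
  then show ?case by blast
next
  case (insert x S)
  interpret M: module R M by fact
  note ringR = noetherian_ring.axioms(1)[OF R]
  note NE = M.submoduleE[OF insert.prems(2)]
  have x: "x \<in> carrier M" and S: "S \<subseteq> carrier M"
    using insert.prems by auto
  note subS = submodule_span[OF M S]
  note SE = M.submoduleE[OF subS]
  note hx = mod_hom_smult_left[OF M x]
  note R' = M.module_ring_module
  \<comment> \<open>The submodule is a parameter because the coefficient ideal is formed twice: for
    \<open>N\<close>, and for the span of the chosen elements \<open>n a\<close>. Comparing the two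
    ideals replaces a computation with explicit coefficients.\<close>
  define H where "H N' = {n \<oplus>\<^bsub>M\<^esub> s | n s. n \<in> N' \<and> s \<in> module_span R M S}" for N'
  have subH: "submodule (H N') R M" if "submodule N' R M" for N'
    unfolding H_def by (rule submodule_add[OF M that subS])
  define J where "J N' = {r \<in> carrier R. r \<odot>\<^bsub>M\<^esub> x \<in> H N'}" for N'
  have idJ: "ideal (J N') R" if "submodule N' R M" for N'
    using submodule_vimage[OF hx R' M subH[OF that]]
    unfolding J_def by (intro M.ideal_if_submodule) simp
  obtain A where A: "A \<subseteq> carrier R" "finite A" "J N = Idl\<^bsub>R\<^esub> A"
    using noetherian_ring.finetely_gen[OF R idJ[OF insert.prems(2)]] by blast
  have "A \<subseteq> J N"
    unfolding A(3) by (rule ring.genideal_self[OF ringR A(1)])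
  then have "\<forall>a\<in>A. \<exists>n\<in>N. \<exists>s\<in>module_span R M S. a \<odot>\<^bsub>M\<^esub> x = n \<oplus>\<^bsub>M\<^esub> s"
    unfolding J_def H_def by blast
  then obtain n where n: "\<And>a. a \<in> A \<Longrightarrow> n a \<in> N"
    "\<And>a. a \<in> A \<Longrightarrow> \<exists>s\<in>module_span R M S. a \<odot>\<^bsub>M\<^esub> x = n a \<oplus>\<^bsub>M\<^esub> s"
    by metis
  obtain G where G: "finite G" "G \<subseteq> N \<inter> module_span R M S" "module_span R M G = N \<inter> module_span R M S"
    using insert.IH[OF S submodule_Int[OF M insert.prems(2) subS]] by blast
  have nA: "n ` A \<subseteq> carrier M"
    using n(1) NE(1) by blast
  note sub1 = submodule_span[OF M nA]
  \<comment> \<open>The generators of the ideal of \<open>N\<close> lie in the ideal of the smaller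
    span, hence so does the whole ideal of \<open>N\<close>.\<close>
  have "A \<subseteq> J (module_span R M (n ` A))"
    using n(2) A(1) span_superset[of "n ` A" R M] unfolding J_def H_def by blast
  then have J_sub: "J N \<subseteq> J (module_span R M (n ` A))"
    unfolding A(3) by (rule ring.genideal_minimal[OF ringR idJ[OF sub1]])
  let ?G = "n ` A \<union> G"
  have GN: "?G \<subseteq> N" using n(1) G(2) by blast
  have subG: "submodule (module_span R M ?G) R M"
    using GN NE(1) by (intro submodule_span[OF M]) blast
  have "y \<in> module_span R M ?G" if y: "y \<in> N" for y
  proof -
    have "submodule {s \<oplus>\<^bsub>M\<^esub> k | s k. s \<in> module_span R M S \<and> k \<in> (\<lambda>r. r \<odot>\<^bsub>M\<^esub> x) ` carrier R} R M"
      using submodule_add[OF M subS submodule_image[OF hx R' M]] by simp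
    moreover have "insert x S \<subseteq> {s \<oplus>\<^bsub>M\<^esub> k | s k. s \<in> module_span R M S \<and> k \<in> (\<lambda>r. r \<odot>\<^bsub>M\<^esub> x) ` carrier R}"
    proof (intro insert_subsetI subsetI)
      have "x = \<zero>\<^bsub>M\<^esub> \<oplus>\<^bsub>M\<^esub> \<one>\<^bsub>R\<^esub> \<odot>\<^bsub>M\<^esub> x" using x by simp
      then show "x \<in> {s \<oplus>\<^bsub>M\<^esub> k | s k. s \<in> module_span R M S \<and> k \<in> (\<lambda>r. r \<odot>\<^bsub>M\<^esub> x) ` carrier R}"
        using submodule_zero[OF subS] by blast
      fix s assume s: "s \<in> S"
      then have "s = s \<oplus>\<^bsub>M\<^esub> \<zero>\<^bsub>R\<^esub> \<odot>\<^bsub>M\<^esub> x" using S x by auto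
      then show "s \<in> {s \<oplus>\<^bsub>M\<^esub> k | s k. s \<in> module_span R M S \<and> k \<in> (\<lambda>r. r \<odot>\<^bsub>M\<^esub> x) ` carrier R}"
        using s span_superset[of S R M] by blast
    qed
    ultimately have "module_span R M (insert x S)
        \<subseteq> {s \<oplus>\<^bsub>M\<^esub> k | s k. s \<in> module_span R M S \<and> k \<in> (\<lambda>r. r \<odot>\<^bsub>M\<^esub> x) ` carrier R}"
      by (rule span_minimal)
    then have "y \<in> {s \<oplus>\<^bsub>M\<^esub> k | s k. s \<in> module_span R M S \<and> k \<in> (\<lambda>r. r \<odot>\<^bsub>M\<^esub> x) ` carrier R}"
      using insert.prems(3) y by blast
    then obtain s r where sr: "s \<in> module_span R M S" "r \<in> carrier R" "y = s \<oplus>\<^bsub>M\<^esub> r \<odot>\<^bsub>M\<^esub> x"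
      by blast
    have sM: "s \<in> carrier M"
      using sr(1) SE(1) by blast
    have "r \<odot>\<^bsub>M\<^esub> x = y \<oplus>\<^bsub>M\<^esub> \<ominus>\<^bsub>M\<^esub> s"
      using sM sr(2) x unfolding sr(3) by (simp add: M.a_ac M.r_neg2)
    then have "r \<in> J N"
      unfolding J_def H_def using y SE(3)[OF sr(1)] sr(2) by blast
    then obtain g s' where g: "g \<in> module_span R M (n ` A)" "s' \<in> module_span R M S"
      "r \<odot>\<^bsub>M\<^esub> x = g \<oplus>\<^bsub>M\<^esub> s'"
      using J_sub unfolding J_def H_def by blast
    have gN: "g \<in> N"
      using span_minimal[OF insert.prems(2), of "n ` A"] n(1) g(1) by blast
    have gM: "g \<in> carrier M" "s' \<in> carrier M"
      using gN NE(1) g(2) SE(1) by blast+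
    have yg: "y = g \<oplus>\<^bsub>M\<^esub> (s \<oplus>\<^bsub>M\<^esub> s')"
      unfolding sr(3) g(3) using sM gM by (simp add: M.a_ac)
    \<comment> \<open>The remainder \<open>y - g\<close> lies in \<open>N\<close>, as a difference
      of elements of \<open>N\<close>, and in the span of \<open>S\<close>. There the induction
      hypothesis provides the generators \<open>G\<close>.\<close>
    then have "s \<oplus>\<^bsub>M\<^esub> s' = \<ominus>\<^bsub>M\<^esub> g \<oplus>\<^bsub>M\<^esub> y"
      using sM gM by (simp add: M.r_neg1)
    then have "s \<oplus>\<^bsub>M\<^esub> s' \<in> N"
      using NE(3)[OF gN] NE(5) y by simp
    then have "s \<oplus>\<^bsub>M\<^esub> s' \<in> module_span R M G"
      unfolding G(3) using SE(5)[OF sr(1) g(2)] by blast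
    then have "s \<oplus>\<^bsub>M\<^esub> s' \<in> module_span R M ?G"
      by (rule subsetD[OF span_mono[OF Un_upper2]])
    moreover have "g \<in> module_span R M ?G"
      by (rule subsetD[OF span_mono[OF Un_upper1] g(1)])
    ultimately show ?thesis
      unfolding yg by (rule M.submoduleE(5)[OF subG, rotated])
  qed
  then have "module_span R M ?G = N"
    using span_minimal[OF insert.prems(2) GN] by blast
  moreover have "finite ?G" using A(2) G(1) by simp
  ultimately show ?case
    using GN by (intro exI[of _ ?G] conjI)
qed

text \<open>Says inside \<open>M\<close> that \<open>M/I\<close> is finitely generated:
  \<open>M\<close> is the sum of \<open>I\<close> and the span of a finite set. Arguments about
  intersections then need no coset arithmetic.\<close>

definition cofinite_submodule ::
  "('r, 'x) ring_scheme \<Rightarrow> ('r, 'm, 'y) module_scheme \<Rightarrow> 'm set \<Rightarrow> bool"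
  where "cofinite_submodule R M I \<longleftrightarrow> submodule I R M \<and>
    (\<exists>S. finite S \<and> S \<subseteq> carrier M \<and>
      (\<forall>a\<in>carrier M. \<exists>s\<in>module_span R M S. \<exists>i\<in>I. a = s \<oplus>\<^bsub>M\<^esub> i))"

lemma cofinite_submodule_carrier:
  assumes "module R M"
  shows "cofinite_submodule R M (carrier M)"
proof -
  interpret M: module R M by fact
  have "\<forall>a\<in>carrier M. \<exists>s\<in>module_span R M {}. \<exists>i\<in>carrier M. a = s \<oplus>\<^bsub>M\<^esub> i"
    using submodule_zero[OF submodule_span[OF assms, of "{}"]] by force
  then show ?thesis
    unfolding cofinite_submodule_def using M.carrier_is_submodule by blast
qed

text \<open>\<open>I/(I \<inter> J)\<close> embeds into \<open>M/J\<close>, which is finitely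
  generated, so it is finitely generated over the noetherian ring. Its generators, lifted to
  \<open>I\<close>, are added to generators of \<open>M/I\<close>.\<close>

lemma cofinite_submodule_Int:
  assumes R: "noetherian_ring R" and M: "module R M"
    and "cofinite_submodule R M I" "cofinite_submodule R M J"
  shows "cofinite_submodule R M (I \<inter> J)"
proof -
  interpret M: module R M by fact
  have I: "submodule I R M" and J: "submodule J R M"
    using assms by (auto simp: cofinite_submodule_def)
  note IE = M.submoduleE[OF I] and JE = M.submoduleE[OF J]
  obtain S where S: "finite S" "S \<subseteq> carrier M"
    "\<And>a. a \<in> carrier M \<Longrightarrow> \<exists>s\<in>module_span R M S. \<exists>i\<in>I. a = s \<oplus>\<^bsub>M\<^esub> i"
    using assms(3) by (auto simp: cofinite_submodule_def)
  obtain T where T: "finite T" "T \<subseteq> carrier M"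
    "\<And>a. a \<in> carrier M \<Longrightarrow> \<exists>s\<in>module_span R M T. \<exists>i\<in>J. a = s \<oplus>\<^bsub>M\<^esub> i"
    using assms(4) by (auto simp: cofinite_submodule_def)
  note subT = submodule_span[OF M T(2)]
  \<comment> \<open>The part of the span of \<open>T\<close> inside \<open>I + J\<close> represents
    the image of \<open>I\<close> in \<open>M/J\<close>.\<close>
  let ?N = "module_span R M T \<inter> {x \<oplus>\<^bsub>M\<^esub> y | x y. x \<in> I \<and> y \<in> J}"
  have "submodule ?N R M"
    by (rule submodule_Int[OF M subT submodule_add[OF M I J]])
  from noetherian_submodule_of_span[OF R M T(1,2) this Int_lower1]
  obtain G where G: "finite G" "G \<subseteq> ?N" "module_span R M G = ?N"
    by (elim exE conjE)
  then have "\<forall>g\<in>G. \<exists>x\<in>I. \<exists>y\<in>J. g = x \<oplus>\<^bsub>M\<^esub> y" by blast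
  \<comment> \<open>\<open>p g\<close> replaces the generator \<open>g\<close> by an element of
    \<open>I\<close> congruent to it modulo \<open>J\<close>.\<close>
  then obtain p where p: "\<And>g. g \<in> G \<Longrightarrow> p g \<in> I" "\<And>g. g \<in> G \<Longrightarrow> \<exists>y\<in>J. g = p g \<oplus>\<^bsub>M\<^esub> y"
    by metis
  have pM: "p ` G \<subseteq> carrier M"
    using p(1) IE(1) by blast
  note subp = submodule_span[OF M pM]
  have spI: "module_span R M (p ` G) \<subseteq> I"
    using span_minimal[OF I, of "p ` G"] p(1) by blast
  have "G \<subseteq> {u \<oplus>\<^bsub>M\<^esub> j | u j. u \<in> module_span R M (p ` G) \<and> j \<in> J}"
    using p(2) span_superset[of "p ` G" R M] by blast
  then have N_sub: "?N \<subseteq> {u \<oplus>\<^bsub>M\<^esub> j | u j. u \<in> module_span R M (p ` G) \<and> j \<in> J}"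
    unfolding G(3)[symmetric] by (rule span_minimal[OF submodule_add[OF M subp J]])
  let ?U = "S \<union> p ` G"
  have UM: "?U \<subseteq> carrier M" using S(2) pM by blast
  note subU = submodule_span[OF M UM]
  have "\<exists>s\<in>module_span R M ?U. \<exists>i\<in>I \<inter> J. a = s \<oplus>\<^bsub>M\<^esub> i" if a: "a \<in> carrier M" for a
  proof -
    obtain s x where s: "s \<in> module_span R M S" "x \<in> I" "a = s \<oplus>\<^bsub>M\<^esub> x"
      using S(3)[OF a] by blast
    have sM: "s \<in> carrier M" and xM: "x \<in> carrier M"
      using s(1) span_subset_carrier[OF M S(2)] s(2) IE(1) by blast+
    obtain t j where t: "t \<in> module_span R M T" "j \<in> J" "x = t \<oplus>\<^bsub>M\<^esub> j"
      using T(3)[OF xM] by blast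
    have tM: "t \<in> carrier M" and jM: "j \<in> carrier M"
      using t(1) span_subset_carrier[OF M T(2)] t(2) JE(1) by blast+
    have "t = x \<oplus>\<^bsub>M\<^esub> \<ominus>\<^bsub>M\<^esub> j"
      unfolding t(3) using tM jM by (simp add: M.a_assoc M.r_neg)
    then have "t \<in> ?N"
      using t(1) s(2) JE(3)[OF t(2)] by blast
    then obtain u j' where u: "u \<in> module_span R M (p ` G)" "j' \<in> J" "t = u \<oplus>\<^bsub>M\<^esub> j'"
      using N_sub by blast
    have uI: "u \<in> I" using u(1) spI by blast
    have uM: "u \<in> carrier M" and jM': "j' \<in> carrier M"
      using uI u(2) IE(1) JE(1) by blast+
    \<comment> \<open>The remainder \<open>j' + j\<close> lies in \<open>J\<close>. It lies in
      \<open>I\<close> as well, since it equals \<open>x - u\<close> with \<open>x\<close> and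
      \<open>u\<close> in \<open>I\<close>.\<close>
    have xu: "x = u \<oplus>\<^bsub>M\<^esub> (j' \<oplus>\<^bsub>M\<^esub> j)"
      unfolding t(3) u(3) using uM jM jM' by (simp add: M.a_assoc)
    then have "j' \<oplus>\<^bsub>M\<^esub> j = \<ominus>\<^bsub>M\<^esub> u \<oplus>\<^bsub>M\<^esub> x"
      using uM jM jM' by (simp add: M.r_neg1)
    then have "j' \<oplus>\<^bsub>M\<^esub> j \<in> I \<inter> J"
      using IE(3)[OF uI] IE(5) s(2) JE(5)[OF u(2) t(2)] by simp
    moreover have "s \<oplus>\<^bsub>M\<^esub> u \<in> module_span R M ?U"
      by (rule M.submoduleE(5)[OF subU subsetD[OF span_mono[OF Un_upper1] s(1)]
            subsetD[OF span_mono[OF Un_upper2] u(1)]])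
    moreover have "a = (s \<oplus>\<^bsub>M\<^esub> u) \<oplus>\<^bsub>M\<^esub> (j' \<oplus>\<^bsub>M\<^esub> j)"
      unfolding s(3) xu using sM uM jM jM' by (simp add: M.a_assoc)
    ultimately show ?thesis by blast
  qed
  moreover have "finite ?U" using S(1) G(1) by simp
  ultimately have "finite ?U \<and> ?U \<subseteq> carrier M \<and>
      (\<forall>a\<in>carrier M. \<exists>s\<in>module_span R M ?U. \<exists>i\<in>I \<inter> J. a = s \<oplus>\<^bsub>M\<^esub> i)"
    using UM by (intro conjI ballI)
  then show ?thesis
    unfolding cofinite_submodule_def by (intro conjI[OF submodule_Int[OF M I J]] exI)
qed

text \<open>\<open>M/ker h\<close> is isomorphic to the image of \<open>h\<close>. Preimages of the
  generators \<open>G\<close> therefore generate \<open>M\<close> modulo the kernel.\<close>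

lemma cofinite_submodule_kernel:
  assumes h: "h \<in> mod_hom R M N" and M: "module R M" and N: "module R N"
    and G: "finite G" "G \<subseteq> h ` carrier M" "h ` carrier M \<subseteq> module_span R N G"
  shows "cofinite_submodule R M {x \<in> carrier M. h x = \<zero>\<^bsub>N\<^esub>}"
proof -
  interpret M: module R M by fact
  interpret N: module R N by fact
  obtain S where S: "S \<subseteq> carrier M" "finite S" "G = h ` S"
    using finite_subset_image[OF G(1,2)] by blast
  note subS = submodule_span[OF M S(1)]
  \<comment> \<open>Restricting \<open>h\<close> to the span of \<open>S\<close> exhibits the image
    of that span as a submodule, which contains \<open>G\<close> and hence the span of
    \<open>G\<close>.\<close>
  have "h \<in> mod_hom R (M\<lparr>carrier := module_span R M S\<rparr>) N"
    using subsetD[OF submodule_subset[OF subS]]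
    by (intro mod_homI) (simp_all add: mod_hom_closed[OF h] mod_hom_add[OF h] mod_hom_smult[OF h])
  then have "submodule (h ` module_span R M S) R N"
    using submodule_image[OF _ submodule.submodule_is_module[OF subS M] N, of h] by simp
  then have sub: "module_span R N G \<subseteq> h ` module_span R M S"
    unfolding S(3) using span_superset[of S R M] by (intro span_minimal) blast+
  have "\<exists>s\<in>module_span R M S. \<exists>i\<in>{x \<in> carrier M. h x = \<zero>\<^bsub>N\<^esub>}. a = s \<oplus>\<^bsub>M\<^esub> i"
    if a: "a \<in> carrier M" for a
  proof -
    obtain s where s: "s \<in> module_span R M S" "h a = h s"
      using G(3) a sub by blast
    have sM: "s \<in> carrier M"
      using s(1) submodule_subset[OF subS] by blast
    have "h (a \<ominus>\<^bsub>M\<^esub> s) = \<zero>\<^bsub>N\<^esub>"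
      using mod_hom_minus[OF h M N a sM] mod_hom_closed[OF h sM] by (simp add: s(2) a_minus_def N.r_neg)
    moreover have "a = s \<oplus>\<^bsub>M\<^esub> (a \<ominus>\<^bsub>M\<^esub> s)"
      using a sM by (simp add: a_minus_def M.a_lcomm M.r_neg)
    ultimately show ?thesis
      using s(1) a sM M.minus_closed[OF a sM] by blast
  qed
  then show ?thesis
    unfolding cofinite_submodule_def using submodule_kernel[OF h M N] S(1,2) by blast
qed

lemma finitely_generated_quotient:
  assumes M: "module R M" and "cofinite_submodule R M I"
  shows "finitely_generated R (quotient_module M I)"
proof -
  interpret M: module R M by fact
  have I: "submodule I R M"
    using assms by (simp add: cofinite_submodule_def)
  obtain S where S: "finite S" "S \<subseteq> carrier M"
    "\<And>a. a \<in> carrier M \<Longrightarrow> \<exists>s\<in>module_span R M S. \<exists>i\<in>I. a = s \<oplus>\<^bsub>M\<^esub> i"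
    using assms(2) by (auto simp: cofinite_submodule_def)
  let ?Q = "quotient_module M I" and ?h = "\<lambda>x. I +>\<^bsub>M\<^esub> x"
  note h = mod_hom_coset[OF M I] and Q = module_quotient[OF M I]
  have hS: "?h ` S \<subseteq> carrier ?Q"
    using S(2) mod_hom_closed[OF h] by blast
  have "X \<in> module_span R ?Q (?h ` S)" if X: "X \<in> carrier ?Q" for X
  proof -
    obtain a where a: "a \<in> carrier M" "X = ?h a"
      by (rule quotient_cases[OF M I X])
    obtain s i where s: "s \<in> module_span R M S" "i \<in> I" "a = s \<oplus>\<^bsub>M\<^esub> i"
      using S(3)[OF a(1)] by blast
    have sM: "s \<in> carrier M" and iM: "i \<in> carrier M"
      using s(1) span_subset_carrier[OF M S(2)] s(2) submodule_subset[OF I] by blast+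
    have "a \<ominus>\<^bsub>M\<^esub> s = i"
      unfolding s(3) using sM iM by (simp add: a_minus_def M.a_ac M.r_neg)
    then have "X = ?h s"
      using coset_eq_iff[OF M I a(1) sM] s(2) a(2) by simp
    also have "\<dots> \<in> module_span R ?Q (?h ` S)"
      by (rule mod_hom_span_subset[OF h M Q S(2) submodule_span[OF Q hS] _ s(1)])
        (simp add: subsetD[OF span_superset])
    finally show ?thesis .
  qed
  then have "module_span R ?Q (?h ` S) = carrier ?Q"
    using span_subset_carrier[OF Q hS] by (intro equalityI subsetI) auto
  moreover have "finite (?h ` S)" using S(1) by simp
  ultimately show ?thesis
    unfolding finitely_generated_def using hS by (intro exI[of _ "?h ` S"] conjI)
qed

text \<open>A splitting of the surjection from the free module on finitely many generators
  \<open>S\<close> onto \<open>P\<close> has coordinates \<open>\<phi> s\<close>, and these form the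
  dual basis. The elements of this free module have exactly the type of the first family of test
  modules in \<open>projective_module\<close>.\<close>

lemma projective_dual_basis:
  fixes P :: "('r, 'p) module"
  assumes "projective_module R P" "finitely_generated R P"
  obtains S \<phi> where "finite S" "S \<subseteq> carrier P"
    "\<And>s. s \<in> S \<Longrightarrow> \<phi> s \<in> mod_hom R P (ring_module R)"
    "\<And>x. x \<in> carrier P \<Longrightarrow> x = (\<Oplus>\<^bsub>P\<^esub>s\<in>S. \<phi> s x \<odot>\<^bsub>P\<^esub> s)"
proof -
  have P: "module R P"
    using assms(1) by (simp add: projective_module_def)
  interpret P: module R P by (rule P)
  obtain S where S: "finite S" "S \<subseteq> carrier P" "module_span R P S = carrier P"
    using assms(2) by (auto simp: finitely_generated_def)
  let ?F = "free_module R S" and ?g = "free_lift R P (\<lambda>s. s)"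
  have S': "(\<lambda>s. s) \<in> S \<rightarrow> carrier P" using S(2) by auto
  note g = P.free_lift_hom[OF P S'] and F = P.module_free_module[of S]
  have "S \<subseteq> ?g ` carrier ?F"
  proof
    fix s assume s: "s \<in> S"
    then show "s \<in> ?g ` carrier ?F"
      using P.free_lift_gen[OF P S' s] P.free_gen_closed[OF s] by (metis imageI)
  qed
  then have "carrier P \<subseteq> ?g ` carrier ?F"
    unfolding S(3)[symmetric] by (rule span_minimal[OF submodule_image[OF g F P]])
  then have surj: "?g ` carrier ?F = carrier P"
    using mod_hom_closed[OF g] by blast
  \<comment> \<open>The lifting property is applied to the identity of \<open>P\<close>.\<close>
  obtain h where h: "h \<in> mod_hom R P ?F" "\<And>x. x \<in> carrier P \<Longrightarrow> ?g (h x) = x"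
    using assms(1) F P g surj mod_hom_id[of R P] unfolding projective_module_def by metis
  show ?thesis
  proof (rule that[OF S(1,2), of "\<lambda>s x. h x s"])
    fix s assume "s \<in> S"
    have "(\<lambda>w. w s) \<in> mod_hom R ?F (ring_module R)"
      by (rule mod_homI) (auto dest: P.free_module_closed)
    from mod_hom_comp[OF this h(1)] show "(\<lambda>x. h x s) \<in> mod_hom R P (ring_module R)" .
  next
    fix x assume x: "x \<in> carrier P"
    have "{z. h x z \<noteq> \<zero>\<^bsub>R\<^esub>} \<subseteq> S"
      using mod_hom_closed[OF h(1) x] by (auto simp: free_module_carrier_iff)
    then have "?g (h x) = (\<Oplus>\<^bsub>P\<^esub>s\<in>S. h x s \<odot>\<^bsub>P\<^esub> s)"
      by (intro P.free_lift_eq[OF P mod_hom_closed[OF h(1) x] S' S(1)]) auto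
    then show "x = (\<Oplus>\<^bsub>P\<^esub>s\<in>S. h x s \<odot>\<^bsub>P\<^esub> s)"
      using h(2)[OF x] by simp
  qed
qed

section \<open>Multilinear maps and comultiplications\<close>

lemma bilinear_on_precomp:
  assumes "bilinear_on R M N P \<beta>" "f \<in> mod_hom R X M" "g \<in> mod_hom R Y N"
  shows "bilinear_on R X Y P (\<lambda>x y. \<beta> (f x) (g y))"
proof (rule bilinear_onI)
  fix x assume "x \<in> carrier X"
  then show "(\<lambda>y. \<beta> (f x) (g y)) \<in> mod_hom R Y P"
    by (rule mod_hom_comp[OF bilinear_on_right[OF assms(1) mod_hom_closed[OF assms(2)]] assms(3)])
next
  fix y assume "y \<in> carrier Y"
  then show "(\<lambda>x. \<beta> (f x) (g y)) \<in> mod_hom R X P"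
    by (rule mod_hom_comp[OF bilinear_on_left[OF assms(1) mod_hom_closed[OF assms(3)]] assms(2)])
qed

lemma bilinear_smult:
  assumes "f \<in> mod_hom R X (ring_module R)" "g \<in> mod_hom R Y P" "module R P"
  shows "bilinear_on R X Y P (\<lambda>x y. f x \<odot>\<^bsub>P\<^esub> g y)"
proof (rule bilinear_onI)
  fix x assume "x \<in> carrier X"
  then show "(\<lambda>y. f x \<odot>\<^bsub>P\<^esub> g y) \<in> mod_hom R Y P"
    using mod_hom_closed[OF assms(1)] by (intro mod_hom_smult_fun[OF assms(2) _ assms(3)]) simp
next
  fix y assume "y \<in> carrier Y"
  then show "(\<lambda>x. f x \<odot>\<^bsub>P\<^esub> g y) \<in> mod_hom R X P"
    by (rule mod_hom_smult_elem[OF assms(1) mod_hom_closed[OF assms(2)] assms(3)])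
qed

lemma (in cring) bilinear_mult:
  assumes "f \<in> mod_hom R X (ring_module R)" "g \<in> mod_hom R Y (ring_module R)"
  shows "bilinear_on R X Y (ring_module R) (\<lambda>x y. f x \<otimes> g y)"
  using bilinear_smult[OF assms module_ring_module] by simp

lemma bilinear_pure_precomp:
  assumes "module R M" "module R N" "f \<in> mod_hom R X M" "g \<in> mod_hom R Y N"
  shows "bilinear_on R X Y (tensor R M N) (\<lambda>x y. pure_tensor R M N (f x) (g y))"
  by (rule bilinear_on_precomp[OF bilinear_pure_tensor[OF assms(1,2)] assms(3,4)])

lemma tensor_map_hom:
  assumes "module R M" "module R N" "module R X" "module R Y" "f \<in> mod_hom R X M" "g \<in> mod_hom R Y N"
  shows "tensor_map R M N f g \<in> mod_hom R (tensor R X Y) (tensor R M N)"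
  unfolding tensor_map_def
  by (rule tensor_lift_hom[OF assms(3,4) module_tensor[OF assms(1,2)] bilinear_pure_precomp[OF assms(1,2,5,6)]])

lemma tensor_lift_tensor_map:
  assumes "module R M" "module R N" "module R X" "module R Y" "module R P"
    and "f \<in> mod_hom R X M" "g \<in> mod_hom R Y N" "bilinear_on R M N P \<beta>"
    and "t \<in> carrier (tensor R X Y)"
  shows "tensor_lift R P \<beta> (tensor_map R M N f g t) = tensor_lift R P (\<lambda>x y. \<beta> (f x) (g y)) t"
proof -
  note b = bilinear_on_precomp[OF assms(8,6,7)]
  have "tensor_lift R P \<beta> (tensor_map R M N f g t) =
      tensor_lift R P (\<lambda>x y. tensor_lift R P \<beta> (pure_tensor R M N (f x) (g y))) t"
    unfolding tensor_map_def
    by (rule tensor_lift_comp[OF assms(3,4) module_tensor[OF assms(1,2)] assms(5)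
          tensor_lift_hom[OF assms(1,2,5,8)] bilinear_pure_precomp[OF assms(1,2,6,7)] assms(9)])
  also have "\<dots> = tensor_lift R P (\<lambda>x y. \<beta> (f x) (g y)) t"
    using assms(6,7)
    by (intro tensor_lift_cong[OF assms(3,4,5) b assms(9)] tensor_lift_pure[OF assms(1,2,5,8)])
      (auto dest: mod_hom_closed)
  finally show ?thesis .
qed

text \<open>The grouping follows the bracketing \<open>L \<otimes> (M \<otimes> N)\<close>: for a
  fixed first argument the rest is a bilinear map that can be lifted at once.\<close>

definition trilinear_on ::
  "('r, 'x) ring_scheme \<Rightarrow> ('r, 'l, 'v) module_scheme \<Rightarrow> ('r, 'm, 'y) module_scheme \<Rightarrow>
    ('r, 'n, 'z) module_scheme \<Rightarrow> ('r, 'p, 'w) module_scheme \<Rightarrow> ('l \<Rightarrow> 'm \<Rightarrow> 'n \<Rightarrow> 'p) \<Rightarrow> bool"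
  where "trilinear_on R L M N P \<tau> \<longleftrightarrow>
    (\<forall>x\<in>carrier L. bilinear_on R M N P (\<tau> x)) \<and>
    (\<forall>y\<in>carrier M. \<forall>z\<in>carrier N. (\<lambda>x. \<tau> x y z) \<in> mod_hom R L P)"

lemma trilinear_onI:
  assumes "\<And>x y. x \<in> carrier L \<Longrightarrow> y \<in> carrier M \<Longrightarrow> (\<lambda>z. \<tau> x y z) \<in> mod_hom R N P"
    and "\<And>x z. x \<in> carrier L \<Longrightarrow> z \<in> carrier N \<Longrightarrow> (\<lambda>y. \<tau> x y z) \<in> mod_hom R M P"
    and "\<And>y z. y \<in> carrier M \<Longrightarrow> z \<in> carrier N \<Longrightarrow> (\<lambda>x. \<tau> x y z) \<in> mod_hom R L P"
  shows "trilinear_on R L M N P \<tau>"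
  using assms by (simp add: trilinear_on_def bilinear_on_def)

lemma trilinear_on_1: "trilinear_on R L M N P \<tau> \<Longrightarrow> x \<in> carrier L \<Longrightarrow> bilinear_on R M N P (\<tau> x)"
  and trilinear_on_3: "trilinear_on R L M N P \<tau> \<Longrightarrow> z \<in> carrier N \<Longrightarrow> bilinear_on R L M P (\<lambda>x y. \<tau> x y z)"
  and trilinear_on_12: "trilinear_on R L M N P \<tau> \<Longrightarrow> x \<in> carrier L \<Longrightarrow> y \<in> carrier M \<Longrightarrow>
    (\<lambda>z. \<tau> x y z) \<in> mod_hom R N P"
  and trilinear_on_23: "trilinear_on R L M N P \<tau> \<Longrightarrow> y \<in> carrier M \<Longrightarrow> z \<in> carrier N \<Longrightarrow>
    (\<lambda>x. \<tau> x y z) \<in> mod_hom R L P"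
  by (simp_all add: trilinear_on_def bilinear_on_def)

context
  fixes R :: "('r, 'x) ring_scheme" and L :: "('r, 'l, 'v) module_scheme"
    and M :: "('r, 'm, 'y) module_scheme" and N :: "('r, 'n, 'z) module_scheme"
  assumes L: "module R L" and M: "module R M" and N: "module R N"
begin

private abbreviation "MN \<equiv> tensor R M N"
private abbreviation "LMN \<equiv> tensor R L MN"

lemma trilinear_pure: "trilinear_on R L M N LMN (\<lambda>x y z. pure_tensor R L MN x (pure_tensor R M N y z))"
proof (rule trilinear_onI)
  note bL = bilinear_pure_tensor[OF L module_tensor[OF M N]] and bM = bilinear_pure_tensor[OF M N]
  show "(\<lambda>z. pure_tensor R L MN x (pure_tensor R M N y z)) \<in> mod_hom R N LMN"
    if "x \<in> carrier L" "y \<in> carrier M" for x y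
    by (rule mod_hom_comp[OF bilinear_on_right[OF bL that(1)] bilinear_on_right[OF bM that(2)]])
  show "(\<lambda>y. pure_tensor R L MN x (pure_tensor R M N y z)) \<in> mod_hom R M LMN"
    if "x \<in> carrier L" "z \<in> carrier N" for x z
    by (rule mod_hom_comp[OF bilinear_on_right[OF bL that(1)] bilinear_on_left[OF bM that(2)]])
  show "(\<lambda>x. pure_tensor R L MN x (pure_tensor R M N y z)) \<in> mod_hom R L LMN"
    if "y \<in> carrier M" "z \<in> carrier N" for y z
    by (rule bilinear_on_left[OF bL pure_tensor_closed[OF M N that]])
qed

lemma trilinear_lift_right:
  assumes "module R P" "trilinear_on R L M N P \<tau>"
  shows "bilinear_on R L MN P (\<lambda>x. tensor_lift R P (\<tau> x))"
proof (rule bilinear_onI)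
  fix x assume "x \<in> carrier L"
  then show "(\<lambda>s. tensor_lift R P (\<tau> x) s) \<in> mod_hom R MN P"
    by (intro tensor_lift_hom[OF M N assms(1)] trilinear_on_1[OF assms(2)])
next
  fix s assume "s \<in> carrier MN"
  then show "(\<lambda>x. tensor_lift R P (\<tau> x) s) \<in> mod_hom R L P"
    by (intro tensor_lift_param_hom[OF M N assms(1) L] trilinear_on_1[OF assms(2)]
        trilinear_on_23[OF assms(2)])
qed

lemma trilinear_lift_left:
  assumes "module R P" "trilinear_on R L M N P \<tau>"
  shows "bilinear_on R (tensor R L M) N P (\<lambda>s z. tensor_lift R P (\<lambda>x y. \<tau> x y z) s)"
proof (rule bilinear_onI)
  fix z assume "z \<in> carrier N"
  then show "(\<lambda>s. tensor_lift R P (\<lambda>x y. \<tau> x y z) s) \<in> mod_hom R (tensor R L M) P"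
    by (intro tensor_lift_hom[OF L M assms(1)] trilinear_on_3[OF assms(2)])
next
  fix s assume "s \<in> carrier (tensor R L M)"
  then show "(\<lambda>z. tensor_lift R P (\<lambda>x y. \<tau> x y z) s) \<in> mod_hom R N P"
    by (intro tensor_lift_param_hom[OF L M assms(1) N] trilinear_on_3[OF assms(2)]
        trilinear_on_12[OF assms(2)])
qed

lemma tensor_assoc_hom:
  "tensor_assoc R L M N \<in> mod_hom R (tensor R (tensor R L M) N) LMN"
  unfolding tensor_assoc_def Let_def
  by (rule tensor_lift_hom[OF module_tensor[OF L M] N module_tensor[OF L module_tensor[OF M N]]
        trilinear_lift_left[OF module_tensor[OF L module_tensor[OF M N]] trilinear_pure]])

text \<open>\<open>tensor_assoc\<close> is itself the nested lift of the trilinear map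
  \<open>(x, y, z) \<mapsto> x \<otimes> (y \<otimes> z)\<close>. Pushing the lift of
  \<open>\<tau>\<close> through it leaves \<open>\<tau> x y z\<close>, so evaluation of trilinear
  maps does not see the bracketing.\<close>

lemma tensor_assoc_lift:
  assumes P: "module R P" and \<tau>: "trilinear_on R L M N P \<tau>"
    and t: "t \<in> carrier (tensor R (tensor R L M) N)"
  shows "tensor_lift R P (\<lambda>x. tensor_lift R P (\<tau> x)) (tensor_assoc R L M N t) =
    tensor_lift R P (\<lambda>s z. tensor_lift R P (\<lambda>x y. \<tau> x y z) s) t"
proof -
  note MN = module_tensor[OF M N] and LM = module_tensor[OF L M]
  note LMN = module_tensor[OF L MN]
  note r = trilinear_lift_right[OF P \<tau>] and l = trilinear_lift_left[OF P \<tau>]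
  note p = trilinear_lift_left[OF LMN trilinear_pure]
  note h = tensor_lift_hom[OF L MN P r]
  have "tensor_lift R P (\<lambda>x. tensor_lift R P (\<tau> x)) (tensor_assoc R L M N t) =
      tensor_lift R P (\<lambda>s z. tensor_lift R P (\<lambda>x. tensor_lift R P (\<tau> x))
        (tensor_lift R LMN (\<lambda>x y. pure_tensor R L MN x (pure_tensor R M N y z)) s)) t"
    unfolding tensor_assoc_def Let_def by (rule tensor_lift_comp[OF LM N LMN P h p t])
  also have "\<dots> = tensor_lift R P (\<lambda>s z. tensor_lift R P (\<lambda>x y. \<tau> x y z) s) t"
  proof (rule tensor_lift_cong[OF LM N P l t])
    fix s z assume s: "s \<in> carrier (tensor R L M)" and z: "z \<in> carrier N"
    have "tensor_lift R P (\<lambda>x. tensor_lift R P (\<tau> x))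
        (tensor_lift R LMN (\<lambda>x y. pure_tensor R L MN x (pure_tensor R M N y z)) s) =
      tensor_lift R P (\<lambda>x y. tensor_lift R P (\<lambda>x. tensor_lift R P (\<tau> x))
        (pure_tensor R L MN x (pure_tensor R M N y z))) s"
      by (rule tensor_lift_comp[OF L M LMN P h trilinear_on_3[OF trilinear_pure z] s])
    also have "\<dots> = tensor_lift R P (\<lambda>x y. \<tau> x y z) s"
      by (rule tensor_lift_cong[OF L M P trilinear_on_3[OF \<tau> z] s])
        (simp add: tensor_lift_pure[OF L MN P r] tensor_lift_pure[OF M N P trilinear_on_1[OF \<tau>]]
          pure_tensor_closed[OF M N] z)
    finally show "tensor_lift R P (\<lambda>x. tensor_lift R P (\<tau> x))
        (tensor_lift R LMN (\<lambda>x y. pure_tensor R L MN x (pure_tensor R M N y z)) s) =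
      tensor_lift R P (\<lambda>x y. \<tau> x y z) s" .
  qed
  finally show ?thesis .
qed

end

section \<open>Coalgebra axioms as identities of Sweedler sums\<close>

context
  fixes R :: "('r, 'x) ring_scheme" and C :: "('r, 'c, 'y) module_scheme" and \<Delta>
  assumes C: "module R C" and \<Delta>: "\<Delta> \<in> mod_hom R C (tensor R C C)"
begin

text \<open>In Sweedler notation this is the sum of
  \<open>\<tau>(c\<^sub>1\<^sub>1, c\<^sub>1\<^sub>2, c\<^sub>2)\<close>. Its companion below gives
  the sum of \<open>\<tau>(c\<^sub>1, c\<^sub>2\<^sub>1, c\<^sub>2\<^sub>2)\<close>, and together
  they turn coassociativity into an identity of nested lifts.\<close>

lemma tensor_lift_comult_left:
  assumes P: "module R P" and \<tau>: "trilinear_on R C C C P \<tau>" and c: "c \<in> carrier C"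
  shows "tensor_lift R P (\<lambda>x. tensor_lift R P (\<tau> x))
      (tensor_assoc R C C C (tensor_map R (tensor R C C) C \<Delta> id (\<Delta> c))) =
    tensor_lift R P (\<lambda>x z. tensor_lift R P (\<lambda>u v. \<tau> u v z) (\<Delta> x)) (\<Delta> c)"
proof -
  note CC = module_tensor[OF C C]
  have id: "id \<in> mod_hom R C C" using mod_hom_id[of R C] by (simp add: id_def)
  note dc = mod_hom_closed[OF \<Delta> c]
  show ?thesis
    unfolding tensor_assoc_lift[OF C C C P \<tau> mod_hom_closed[OF tensor_map_hom[OF CC C C C \<Delta> id] dc]]
      tensor_lift_tensor_map[OF CC C C C P \<Delta> id trilinear_lift_left[OF C C C P \<tau>] dc]
    by simp
qed

lemma tensor_lift_comult_right:
  assumes P: "module R P" and \<tau>: "trilinear_on R C C C P \<tau>" and c: "c \<in> carrier C"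
  shows "tensor_lift R P (\<lambda>x. tensor_lift R P (\<tau> x)) (tensor_map R C (tensor R C C) id \<Delta> (\<Delta> c)) =
    tensor_lift R P (\<lambda>x y. tensor_lift R P (\<tau> x) (\<Delta> y)) (\<Delta> c)"
proof -
  note CC = module_tensor[OF C C]
  have id: "id \<in> mod_hom R C C" using mod_hom_id[of R C] by (simp add: id_def)
  note dc = mod_hom_closed[OF \<Delta> c]
  show ?thesis
    unfolding tensor_lift_tensor_map[OF C CC C C P id \<Delta> trilinear_lift_right[OF C C C P \<tau>] dc]
    by simp
qed

lemma comult_lift_bilinear_left:
  assumes P: "module R P" and \<tau>: "trilinear_on R C C C P \<tau>"
  shows "bilinear_on R C C P (\<lambda>x z. tensor_lift R P (\<lambda>u v. \<tau> u v z) (\<Delta> x))"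
  by (rule bilinear_on_precomp[OF trilinear_lift_left[OF C C C P \<tau>] \<Delta> mod_hom_id])

lemma comult_lift_bilinear_right:
  assumes P: "module R P" and \<tau>: "trilinear_on R C C C P \<tau>"
  shows "bilinear_on R C C P (\<lambda>x y. tensor_lift R P (\<tau> x) (\<Delta> y))"
  by (rule bilinear_on_precomp[OF trilinear_lift_right[OF C C C P \<tau>] mod_hom_id \<Delta>])

lemma comult_lift_hom:
  assumes P: "module R P" and \<beta>: "bilinear_on R C C P \<beta>"
  shows "(\<lambda>c. tensor_lift R P \<beta> (\<Delta> c)) \<in> mod_hom R C P"
  by (rule mod_hom_comp[OF tensor_lift_hom[OF C C P \<beta>] \<Delta>])

end

text \<open>Coassociativity tested against a trilinear map. In this form it yields associativity of
  convolution and the cancellation rule for the antipode.\<close>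

lemma (in coalgebra) coassoc_lift:
  assumes P: "module R P" and \<tau>: "trilinear_on R C C C P \<tau>" and c: "c \<in> carrier C"
  shows "tensor_lift R P (\<lambda>x z. tensor_lift R P (\<lambda>u v. \<tau> u v z) (\<Delta> x)) (\<Delta> c) =
    tensor_lift R P (\<lambda>x y. tensor_lift R P (\<tau> x) (\<Delta> y)) (\<Delta> c)"
  using tensor_lift_comult_left[OF module_axioms comult_hom P \<tau> c]
    tensor_lift_comult_right[OF module_axioms comult_hom P \<tau> c] coassoc[OF c] by simp

text \<open>The counit axiom with \<open>h\<close> applied and moved inside the sum:
  \<open>\<Sum> \<epsilon>(c\<^sub>1) h(c\<^sub>2) = h(c)\<close>.\<close>

lemma (in coalgebra) counit_left_lift:
  assumes P: "module R P" and h: "h \<in> mod_hom R C P" and c: "c \<in> carrier C"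
  shows "tensor_lift R P (\<lambda>x y. \<epsilon> x \<odot>\<^bsub>P\<^esub> h y) (\<Delta> c) = h c"
proof -
  note M = module_axioms
  have "h (tensor_lift R C (\<lambda>x y. \<epsilon> x \<odot>\<^bsub>C\<^esub> y) (\<Delta> c)) =
      tensor_lift R P (\<lambda>x y. h (\<epsilon> x \<odot>\<^bsub>C\<^esub> y)) (\<Delta> c)"
    by (rule tensor_lift_comp[OF M M M P h bilinear_smult[OF counit_hom mod_hom_id M]
          mod_hom_closed[OF comult_hom c]])
  also have "\<dots> = tensor_lift R P (\<lambda>x y. \<epsilon> x \<odot>\<^bsub>P\<^esub> h y) (\<Delta> c)"
    using mod_hom_closed[OF counit_hom]
    by (intro tensor_lift_cong[OF M M P bilinear_smult[OF counit_hom h P] mod_hom_closed[OF comult_hom c]]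
        mod_hom_smult[OF h]) simp
  finally show ?thesis
    using counit_left[OF c] by simp
qed

lemma (in coalgebra) counit_right_lift:
  assumes P: "module R P" and h: "h \<in> mod_hom R C P" and c: "c \<in> carrier C"
  shows "tensor_lift R P (\<lambda>x y. \<epsilon> y \<odot>\<^bsub>P\<^esub> h x) (\<Delta> c) = h c"
proof -
  note M = module_axioms
  have "h (tensor_lift R C (\<lambda>x y. \<epsilon> y \<odot>\<^bsub>C\<^esub> x) (\<Delta> c)) =
      tensor_lift R P (\<lambda>x y. h (\<epsilon> y \<odot>\<^bsub>C\<^esub> x)) (\<Delta> c)"
    by (rule tensor_lift_comp[OF M M M P h bilinear_on_flip[OF bilinear_smult[OF counit_hom mod_hom_id M]]
          mod_hom_closed[OF comult_hom c]])
  also have "\<dots> = tensor_lift R P (\<lambda>x y. \<epsilon> y \<odot>\<^bsub>P\<^esub> h x) (\<Delta> c)"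
    using mod_hom_closed[OF counit_hom]
    by (intro tensor_lift_cong[OF M M P bilinear_on_flip[OF bilinear_smult[OF counit_hom h P]]
          mod_hom_closed[OF comult_hom c]] mod_hom_smult[OF h]) simp
  finally show ?thesis
    using counit_right[OF c] by simp
qed

section \<open>The finite dual\<close>

context assoc_algebra
begin

abbreviation "K \<equiv> ring_module R"
abbreviation "D \<equiv> dual_module R A"
abbreviation "C \<equiv> finite_dual_module R A"
text \<open>The pairing of a tensor of functionals with \<open>a \<otimes> b\<close>. Since
  \<open>tensor_lift\<close> does not mention the factors of the tensor product, the same expression
  evaluates tensors over \<open>A\<^sup>*\<close> and over \<open>A\<^sup>\<circ>\<close>.\<close>

abbreviation "ev a b \<equiv> tensor_lift R K (\<lambda>g h. g a \<otimes> h b)"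

lemma module_K: "module R K"
  by (rule module_ring_module)

interpretation K: module R K by (rule module_K)

lemma module_D: "module R D"
  unfolding dual_module_def by (rule module_hom_module[OF module_axioms module_K])

interpretation D: module R D by (rule module_D)

lemma D_hom: "f \<in> carrier D \<Longrightarrow> f \<in> mod_hom R A K"
  by (simp add: dual_module_def hom_module_simps)

lemma D_closed: "f \<in> carrier D \<Longrightarrow> a \<in> carrier A \<Longrightarrow> f a \<in> carrier R"
  using mod_hom_closed[OF D_hom] by fastforce

lemma D_eqI: "f \<in> carrier D \<Longrightarrow> g \<in> carrier D \<Longrightarrow> (\<And>a. a \<in> carrier A \<Longrightarrow> f a = g a) \<Longrightarrow> f = g"
  unfolding dual_module_def by (rule hom_module_eqI)

lemma D_restrict: "h \<in> mod_hom R A K \<Longrightarrow> restrict h (carrier A) \<in> carrier D"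
  unfolding dual_module_def by (rule hom_module_restrict[OF _ module_axioms])

lemma D_apply:
  assumes "a \<in> carrier A"
  shows "(f \<oplus>\<^bsub>D\<^esub> g) a = f a \<oplus> g a" "(r \<odot>\<^bsub>D\<^esub> f) a = r \<otimes> f a" "\<zero>\<^bsub>D\<^esub> a = \<zero>"
  using assms by (simp_all add: dual_module_def hom_module_simps)

lemma D_add: "f \<oplus>\<^bsub>D\<^esub> g = (\<lambda>a\<in>carrier A. f a \<oplus> g a)"
  and D_smult: "r \<odot>\<^bsub>D\<^esub> f = (\<lambda>a\<in>carrier A. r \<otimes> f a)"
  by (simp_all add: dual_module_def hom_module_simps)

lemma D_eval: "a \<in> carrier A \<Longrightarrow> (\<lambda>f. f a) \<in> mod_hom R D K"
  unfolding dual_module_def by (rule mod_hom_eval)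

lemma mult_right_hom: "a \<in> carrier A \<Longrightarrow> (\<lambda>b. b \<otimes>\<^bsub>A\<^esub> a) \<in> mod_hom R A A"
  by (rule mod_homI) (auto simp: A.l_distr smult_mult_left)

lemma mult_left_hom: "a \<in> carrier A \<Longrightarrow> (\<lambda>b. a \<otimes>\<^bsub>A\<^esub> b) \<in> mod_hom R A A"
  by (rule mod_homI) (auto simp: A.r_distr smult_mult_right)

lemma dual_act_closed: "f \<in> carrier D \<Longrightarrow> a \<in> carrier A \<Longrightarrow> dual_act A a f \<in> carrier D"
  unfolding dual_act_def by (rule D_restrict[OF mod_hom_comp[OF D_hom mult_right_hom]])

lemma dual_act_hom:
  assumes "f \<in> carrier D"
  shows "(\<lambda>a. dual_act A a f) \<in> mod_hom R A D"
  unfolding dual_act_def dual_module_def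
  by (rule mod_hom_into_hom_module[OF module_axioms module_K module_axioms])
    (rule mod_hom_comp[OF D_hom[OF assms] mult_right_hom] mod_hom_comp[OF D_hom[OF assms] mult_left_hom],
      assumption)+

lemma ev_bilinear:
  assumes "(\<lambda>g. g a) \<in> mod_hom R X K" "(\<lambda>h. h b) \<in> mod_hom R Y K"
  shows "bilinear_on R X Y K (\<lambda>g h. g a \<otimes> h b)"
  by (rule bilinear_mult[OF assms])

section \<open>Evaluation of tensors of functionals, treated for \<open>A\<^sup>*\<close> and
  \<open>A\<^sup>\<circ>\<close> at once\<close>

context
  fixes X :: "('a, 'c \<Rightarrow> 'a, 'y) module_scheme"
  assumes X: "module R X" and X_eval: "\<forall>a\<in>carrier A. (\<lambda>f. f a) \<in> mod_hom R X K"
begin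

lemma ev_hom: "a \<in> carrier A \<Longrightarrow> b \<in> carrier A \<Longrightarrow> ev a b \<in> mod_hom R (tensor R X X) K"
  using X_eval by (intro tensor_lift_hom[OF X X module_K] ev_bilinear) simp_all

lemma ev_pure:
  "a \<in> carrier A \<Longrightarrow> b \<in> carrier A \<Longrightarrow> g \<in> carrier X \<Longrightarrow> h \<in> carrier X \<Longrightarrow>
    ev a b (pure_tensor R X X g h) = g a \<otimes> h b"
  using X_eval by (intro tensor_lift_pure[OF X X module_K] ev_bilinear) simp_all

lemma ev_finsum:
  assumes g: "g \<in> J \<rightarrow> carrier X" and h: "h \<in> J \<rightarrow> carrier X"
  defines "t \<equiv> \<Oplus>\<^bsub>tensor R X X\<^esub>j\<in>J. pure_tensor R X X (g j) (h j)"
  shows "t \<in> carrier (tensor R X X)"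
    and "a \<in> carrier A \<Longrightarrow> b \<in> carrier A \<Longrightarrow> ev a b t = (\<Oplus>\<^bsub>K\<^esub>j\<in>J. g j a \<otimes> h j b)"
proof -
  interpret T: module R "tensor R X X" by (rule module_tensor[OF X X])
  have cl: "(\<lambda>j. pure_tensor R X X (g j) (h j)) \<in> J \<rightarrow> carrier (tensor R X X)"
    using g h pure_tensor_closed[OF X X] by blast
  then show "t \<in> carrier (tensor R X X)"
    unfolding t_def by (rule T.M.finsum_closed)
  assume ab: "a \<in> carrier A" "b \<in> carrier A"
  have "ev a b t = (\<Oplus>\<^bsub>K\<^esub>j\<in>J. ev a b (pure_tensor R X X (g j) (h j)))"
    unfolding t_def by (rule mod_hom_finsum[OF ev_hom[OF ab] T.module_axioms module_K cl])
  also have "\<dots> = (\<Oplus>\<^bsub>K\<^esub>j\<in>J. g j a \<otimes> h j b)"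
  proof (rule K.M.finsum_cong')
    have "x a \<in> carrier R" "x b \<in> carrier R" if "x \<in> carrier X" for x
      using X_eval ab mod_hom_closed[of "\<lambda>f. f a" R X K x] mod_hom_closed[of "\<lambda>f. f b" R X K x] that
      by simp_all
    then show "(\<lambda>j. g j a \<otimes> h j b) \<in> J \<rightarrow> carrier K"
      using g h by (auto simp: Pi_iff)
    show "ev a b (pure_tensor R X X (g j) (h j)) = g j a \<otimes> h j b" if "j \<in> J" for j
      using g h that by (intro ev_pure[OF ab]) auto
  qed simp
  finally show "ev a b t = (\<Oplus>\<^bsub>K\<^esub>j\<in>J. g j a \<otimes> h j b)" .
qed

end

lemma D_evals: "\<forall>a\<in>carrier A. (\<lambda>f. f a) \<in> mod_hom R D K"
  by (simp add: D_eval)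

lemmas ev_hom_D = ev_hom[OF module_D D_evals]
  and ev_pure_D = ev_pure[OF module_D D_evals]
  and ev_finsum_D = ev_finsum[OF module_D D_evals]

text \<open>For \<open>t = \<Sum> g\<^sub>i \<otimes> h\<^sub>i\<close> the set \<open>G\<close>
  consists of the \<open>g\<^sub>i\<close>, and the values \<open>h\<^sub>i(b)\<close> are the
  coefficients. The order of quantifiers matters: \<open>G\<close> is independent of
  \<open>b\<close>, so that one finite set controls a whole orbit \<open>A f\<close>.\<close>

lemma ev_span_D:
  assumes "t \<in> carrier (tensor R D D)"
  shows "\<exists>G. finite G \<and> G \<subseteq> carrier D \<and> (\<forall>b\<in>carrier A. (\<lambda>a\<in>carrier A. ev a b t) \<in> module_span R D G)"
  using assms
proof (induction rule: tensor_induct[OF module_D module_D, consumes 1, case_names pure add])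
  case (pure g h)
  have "(\<lambda>a\<in>carrier A. ev a b (pure_tensor R D D g h)) \<in> module_span R D {g}" if b: "b \<in> carrier A" for b
  proof -
    have "(\<lambda>a\<in>carrier A. ev a b (pure_tensor R D D g h)) = h b \<odot>\<^bsub>D\<^esub> g"
      unfolding D_smult using pure b by (intro restrict_ext) (simp add: ev_pure_D D_closed m_comm)
    also have "\<dots> \<in> module_span R D {g}"
      using pure b span_superset[of "{g}" R D]
      by (intro D.submoduleE(4)[OF submodule_span[OF module_D]]) (auto simp: D_closed)
    finally show ?thesis .
  qed
  moreover have "finite {g}" "{g} \<subseteq> carrier D" using pure by auto
  ultimately show ?case by (intro exI[of _ "{g}"] conjI ballI)
next
  case (add s t)
  obtain G where G: "finite G" "G \<subseteq> carrier D"
    "\<And>b. b \<in> carrier A \<Longrightarrow> (\<lambda>a\<in>carrier A. ev a b s) \<in> module_span R D G"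
    using add.IH(1) by blast
  obtain H where H: "finite H" "H \<subseteq> carrier D"
    "\<And>b. b \<in> carrier A \<Longrightarrow> (\<lambda>a\<in>carrier A. ev a b t) \<in> module_span R D H"
    using add.IH(2) by blast
  have sub: "G \<union> H \<subseteq> carrier D" using G(2) H(2) by blast
  have "(\<lambda>a\<in>carrier A. ev a b (s \<oplus>\<^bsub>tensor R D D\<^esub> t)) \<in> module_span R D (G \<union> H)"
    if b: "b \<in> carrier A" for b
  proof -
    have "(\<lambda>a\<in>carrier A. ev a b (s \<oplus>\<^bsub>tensor R D D\<^esub> t)) =
        (\<lambda>a\<in>carrier A. ev a b s) \<oplus>\<^bsub>D\<^esub> (\<lambda>a\<in>carrier A. ev a b t)"
      unfolding D_add using mod_hom_add[OF ev_hom_D[OF _ b] add.hyps] by (intro restrict_ext) simp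
    also have "\<dots> \<in> module_span R D (G \<union> H)"
      by (rule D.submoduleE(5)[OF submodule_span[OF module_D sub]
            subsetD[OF span_mono[OF Un_upper1] G(3)[OF b]] subsetD[OF span_mono[OF Un_upper2] H(3)[OF b]]])
    finally show ?thesis .
  qed
  moreover have "finite (G \<union> H)" using G(1) H(1) by simp
  ultimately show ?case
    using sub by (intro exI[of _ "G \<union> H"] conjI ballI)
qed

lemma finite_dual_subset: "finite_dual R A \<subseteq> carrier D"
  by (auto simp: finite_dual_def)

lemma finite_dual_D: "f \<in> finite_dual R A \<Longrightarrow> f \<in> carrier D"
  using finite_dual_subset by blast

text \<open>A scalar acts as left multiplication by the algebra element \<open>r 1\<close>.\<close>

lemma submodule_if_left_ideal:
  assumes "left_ideal I A"
  shows "submodule I R A"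
proof -
  interpret I: left_ideal I A by fact
  have "r \<odot>\<^bsub>A\<^esub> x \<in> I" if "r \<in> carrier R" "x \<in> I" for r x
  proof -
    have "r \<odot>\<^bsub>A\<^esub> x = (r \<odot>\<^bsub>A\<^esub> \<one>\<^bsub>A\<^esub>) \<otimes>\<^bsub>A\<^esub> x"
      using that I.a_subset by (simp add: subset_iff smult_mult_left)
    then show ?thesis
      using that by (simp add: I.l_closed)
  qed
  then show ?thesis
    using I.a_subset by (intro submoduleI) auto
qed

end

section \<open>Membership in the finite dual and annihilators over a noetherian ring\<close>

locale noetherian_algebra = assoc_algebra +
  assumes noetherian: "noetherian_ring R"
begin

interpretation K: module R K by (rule module_K)
interpretation D: module R D by (rule module_D)

text \<open>The tensor is taken over \<open>A\<^sup>*\<close>, so the criterion applies before its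
  factors are known to lie in \<open>A\<^sup>\<circ>\<close>. It is the source of all closure
  properties of \<open>A\<^sup>\<circ>\<close> below.\<close>

lemma finite_dualI:
  assumes f: "f \<in> carrier D" and t: "t \<in> carrier (tensor R D D)"
    and eq: "\<And>a b. a \<in> carrier A \<Longrightarrow> b \<in> carrier A \<Longrightarrow> f (a \<otimes>\<^bsub>A\<^esub> b) = ev a b t"
  shows "f \<in> finite_dual R A"
proof -
  obtain G where G: "finite G" "G \<subseteq> carrier D"
    "\<And>b. b \<in> carrier A \<Longrightarrow> (\<lambda>a\<in>carrier A. ev a b t) \<in> module_span R D G"
    using ev_span_D[OF t] by blast
  let ?N = "(\<lambda>a. dual_act A a f) ` carrier A"
  have N: "submodule ?N R D"
    by (rule submodule_image[OF dual_act_hom[OF f] module_axioms module_D])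
  have "dual_act A b f = (\<lambda>a\<in>carrier A. ev a b t)" if "b \<in> carrier A" for b
    using eq that by (auto simp: dual_act_def intro!: restrict_ext)
  then have "?N \<subseteq> module_span R D G"
    using G(3) by auto
  from noetherian_submodule_of_span[OF noetherian module_D G(1,2) N this]
  show ?thesis
    using f unfolding finite_dual_def by (simp add: finitely_generated_submodule[OF module_D N])
qed

lemma finite_dual_sumI:
  assumes f: "f \<in> carrier D" and J: "finite J" "\<And>j. j \<in> J \<Longrightarrow> g j \<in> carrier D" "\<And>j. j \<in> J \<Longrightarrow> h j \<in> carrier D"
    and eq: "\<And>a b. a \<in> carrier A \<Longrightarrow> b \<in> carrier A \<Longrightarrow> f (a \<otimes>\<^bsub>A\<^esub> b) = (\<Oplus>\<^bsub>K\<^esub>j\<in>J. g j a \<otimes> h j b)"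
  shows "f \<in> finite_dual R A"
proof -
  have "g \<in> J \<rightarrow> carrier D" "h \<in> J \<rightarrow> carrier D"
    using J(2,3) by blast+
  note t = ev_finsum_D[OF this]
  show ?thesis
    by (rule finite_dualI[OF f t(1)]) (simp add: eq t(2))
qed

text \<open>For a single \<open>f\<close> the set is the kernel of \<open>x \<mapsto> x f\<close>,
  whose image \<open>A f\<close> is finitely generated by definition of
  \<open>A\<^sup>\<circ>\<close>. Further functionals are added by intersecting.\<close>

lemma cofinite_annihilator:
  assumes "finite F" "F \<subseteq> finite_dual R A"
  shows "cofinite_submodule R A {x \<in> carrier A. \<forall>f\<in>F. \<forall>b\<in>carrier A. f (b \<otimes>\<^bsub>A\<^esub> x) = \<zero>}"
  using assms
proof (induction F)
  case empty
  then show ?case using cofinite_submodule_carrier[OF module_axioms] by simp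
next
  case (insert f F)
  have f: "f \<in> carrier D" using insert.prems finite_dual_subset by blast
  note h = dual_act_hom[OF f]
  let ?N = "(\<lambda>a. dual_act A a f) ` carrier A"
  have N: "submodule ?N R D"
    by (rule submodule_image[OF h module_axioms module_D])
  have "finitely_generated R (D\<lparr>carrier := ?N\<rparr>)"
    using insert.prems by (simp add: finite_dual_def)
  then obtain G where "finite G" "G \<subseteq> ?N" "module_span R D G = ?N"
    unfolding finitely_generated_submodule[OF module_D N] by blast
  then have "cofinite_submodule R A {x \<in> carrier A. dual_act A x f = \<zero>\<^bsub>D\<^esub>}"
    by (intro cofinite_submodule_kernel[OF h module_axioms module_D, of G]) auto
  also have "{x \<in> carrier A. dual_act A x f = \<zero>\<^bsub>D\<^esub>} =
      {x \<in> carrier A. \<forall>b\<in>carrier A. f (b \<otimes>\<^bsub>A\<^esub> x) = \<zero>}"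
  proof -
    have "dual_act A x f = \<zero>\<^bsub>D\<^esub> \<longleftrightarrow> (\<forall>b\<in>carrier A. f (b \<otimes>\<^bsub>A\<^esub> x) = \<zero>)" if "x \<in> carrier A" for x
      by (auto simp: dual_act_def dual_module_def hom_module_simps fun_eq_iff restrict_def)
    then show ?thesis by blast
  qed
  finally have "cofinite_submodule R A {x \<in> carrier A. \<forall>b\<in>carrier A. f (b \<otimes>\<^bsub>A\<^esub> x) = \<zero>}" .
  moreover have "cofinite_submodule R A {x \<in> carrier A. \<forall>f\<in>F. \<forall>b\<in>carrier A. f (b \<otimes>\<^bsub>A\<^esub> x) = \<zero>}"
    using insert.IH insert.prems by blast
  ultimately have "cofinite_submodule R A ({x \<in> carrier A. \<forall>b\<in>carrier A. f (b \<otimes>\<^bsub>A\<^esub> x) = \<zero>} \<inter>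
      {x \<in> carrier A. \<forall>f\<in>F. \<forall>b\<in>carrier A. f (b \<otimes>\<^bsub>A\<^esub> x) = \<zero>})"
    by (rule cofinite_submodule_Int[OF noetherian module_axioms])
  also have "{x \<in> carrier A. \<forall>b\<in>carrier A. f (b \<otimes>\<^bsub>A\<^esub> x) = \<zero>} \<inter>
      {x \<in> carrier A. \<forall>f\<in>F. \<forall>b\<in>carrier A. f (b \<otimes>\<^bsub>A\<^esub> x) = \<zero>} =
      {x \<in> carrier A. \<forall>g\<in>insert f F. \<forall>b\<in>carrier A. g (b \<otimes>\<^bsub>A\<^esub> x) = \<zero>}"
    by auto
  finally show ?case .
qed

end

section \<open>Dual bases supplied by property P\<close>

locale property_P_algebra = noetherian_algebra +
  assumes property_P: "property_P_left R A"
begin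

interpretation K: module R K by (rule module_K)
interpretation D: module R D by (rule module_D)

text \<open>The dual basis of \<open>A/I\<close> says that
  \<open>b - \<Sum> \<phi>\<^sub>j(b) a\<^sub>j\<close> lies in \<open>I\<close>, and
  \<open>g\<close> kills this difference. The functional \<open>g\<close> ranges over
  \<open>mod_hom\<close> and not over \<open>carrier D\<close>, because it will be
  \<open>c \<mapsto> f(b c)\<close>, which is not extensional.\<close>

lemma left_ideal_dual_basis:
  assumes I: "left_ideal I A" and fg: "finitely_generated R (quotient_module A I)"
    and proj: "projective_module R (quotient_module A I)"
  shows "\<exists>(J :: 'c set set) a \<phi>. finite J \<and> a \<in> J \<rightarrow> carrier A \<and> \<phi> \<in> J \<rightarrow> carrier D \<and> (\<forall>j\<in>J. \<forall>x\<in>I. \<phi> j x = \<zero>) \<and>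
    (\<forall>g\<in>mod_hom R A K. (\<forall>x\<in>I. g x = \<zero>) \<longrightarrow>
      (\<forall>b\<in>carrier A. g b = (\<Oplus>\<^bsub>K\<^esub>j\<in>J. g (a j) \<otimes> \<phi> j b)))"
proof -
  note subI = submodule_if_left_ideal[OF I]
  let ?Q = "quotient_module A I" and ?q = "\<lambda>x. I +>\<^bsub>A\<^esub> x"
  note q = mod_hom_coset[OF module_axioms subI] and Q = module_quotient[OF module_axioms subI]
  interpret Q: module R ?Q by (rule Q)
  \<comment> \<open>The index set is a finite generating set of \<open>A/I\<close>, hence a set of
    cosets; this explains the type of \<open>J\<close> here and later.\<close>
  obtain J \<psi> where J: "finite J" "J \<subseteq> carrier ?Q"
    "\<And>j. j \<in> J \<Longrightarrow> \<psi> j \<in> mod_hom R ?Q K"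
    "\<And>x. x \<in> carrier ?Q \<Longrightarrow> x = (\<Oplus>\<^bsub>?Q\<^esub>j\<in>J. \<psi> j x \<odot>\<^bsub>?Q\<^esub> j)"
    using projective_dual_basis[OF proj fg] by blast
  have "\<forall>j\<in>J. \<exists>x\<in>carrier A. j = ?q x"
    using J(2) quotient_cases[OF module_axioms subI] by (metis subsetD)
  then obtain a where a: "\<And>j. j \<in> J \<Longrightarrow> a j \<in> carrier A" "\<And>j. j \<in> J \<Longrightarrow> j = ?q (a j)"
    by metis
  define \<phi> where "\<phi> j = (\<lambda>x\<in>carrier A. \<psi> j (?q x))" for j
  have \<psi>_closed: "\<psi> j (?q x) \<in> carrier R" if "j \<in> J" "x \<in> carrier A" for j x
    using mod_hom_closed[OF J(3)[OF that(1)] mod_hom_closed[OF q that(2)]] by simp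
  show ?thesis
  proof (rule exI[of _ J], rule exI[of _ a], rule exI[of _ \<phi>], intro conjI ballI impI funcsetI)
    show "finite J" by (rule J(1))
  next
    fix j assume j: "j \<in> J"
    show "a j \<in> carrier A" by (rule a(1)[OF j])
    show "\<phi> j \<in> carrier D"
      unfolding \<phi>_def by (rule D_restrict[OF mod_hom_comp[OF J(3)[OF j] q]])
    fix x assume x: "x \<in> I"
    then have xA: "x \<in> carrier A" using submodule_subset[OF subI] by blast
    have "?q x = ?q \<zero>\<^bsub>A\<^esub>"
      using x xA by (subst coset_eq_iff[OF module_axioms subI]) (auto simp: a_minus_def)
    then have "\<psi> j (?q x) = \<zero>\<^bsub>K\<^esub>"
      using mod_hom_zero[OF q module_axioms Q] mod_hom_zero[OF J(3)[OF j] Q module_K] by simp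
    then show "\<phi> j x = \<zero>"
      using xA by (simp add: \<phi>_def)
  next
    fix g b assume g: "g \<in> mod_hom R A K" "\<forall>x\<in>I. g x = \<zero>" and b: "b \<in> carrier A"
    let ?c = "\<Oplus>\<^bsub>A\<^esub>j\<in>J. \<psi> j (?q b) \<odot>\<^bsub>A\<^esub> a j"
    have cl: "(\<lambda>j. \<psi> j (?q b) \<odot>\<^bsub>A\<^esub> a j) \<in> J \<rightarrow> carrier A"
      using \<psi>_closed[OF _ b] a(1) by blast
    then have cA: "?c \<in> carrier A" by (rule M.finsum_closed)
    have "?q b = (\<Oplus>\<^bsub>?Q\<^esub>j\<in>J. \<psi> j (?q b) \<odot>\<^bsub>?Q\<^esub> j)"
      by (rule J(4)[OF mod_hom_closed[OF q b]])
    also have "\<dots> = (\<Oplus>\<^bsub>?Q\<^esub>j\<in>J. ?q (\<psi> j (?q b) \<odot>\<^bsub>A\<^esub> a j))"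
    proof (rule Q.M.finsum_cong')
      show "(\<lambda>j. ?q (\<psi> j (?q b) \<odot>\<^bsub>A\<^esub> a j)) \<in> J \<rightarrow> carrier ?Q"
        using cl mod_hom_closed[OF q] by blast
      fix j assume j: "j \<in> J"
      show "\<psi> j (?q b) \<odot>\<^bsub>?Q\<^esub> j = ?q (\<psi> j (?q b) \<odot>\<^bsub>A\<^esub> a j)"
        using mod_hom_smult[OF q \<psi>_closed[OF j b] a(1)[OF j]] a(2)[OF j] by simp
    qed simp
    also have "\<dots> = ?q ?c"
      by (rule mod_hom_finsum[OF q module_axioms Q cl, symmetric])
    finally have "b \<ominus>\<^bsub>A\<^esub> ?c \<in> I"
      using coset_eq_iff[OF module_axioms subI b cA] by simp
    then have "g b \<ominus>\<^bsub>K\<^esub> g ?c = \<zero>\<^bsub>K\<^esub>"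
      using g(2) mod_hom_minus[OF g(1) module_axioms module_K b cA] by simp
    then have "g b = g ?c"
      by (rule K.M.minus_eq_zeroD[OF _ mod_hom_closed[OF g(1) b] mod_hom_closed[OF g(1) cA]])
    also have "\<dots> = (\<Oplus>\<^bsub>K\<^esub>j\<in>J. g (\<psi> j (?q b) \<odot>\<^bsub>A\<^esub> a j))"
      by (rule mod_hom_finsum[OF g(1) module_axioms module_K cl])
    also have "\<dots> = (\<Oplus>\<^bsub>K\<^esub>j\<in>J. g (a j) \<otimes> \<phi> j b)"
      using \<psi>_closed[OF _ b] a(1) b mod_hom_closed[OF g(1)]
      by (intro K.M.finsum_cong') (auto simp: \<phi>_def mod_hom_smult[OF g(1)] m_comm)
    finally show "g b = (\<Oplus>\<^bsub>K\<^esub>j\<in>J. g (a j) \<otimes> \<phi> j b)" .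
  qed
qed

text \<open>The relation is imposed on \<open>f(b c)\<close>, so it already contains an expansion of
  the comultiplication of \<open>f\<close>, and \<open>b = 1\<close> gives the usual dual basis
  identity. It passes to subsets of \<open>F\<close>, so one dual basis for a union serves both
  parts.\<close>

definition dual_basis_for :: "('c \<Rightarrow> 'a) set \<Rightarrow> 'j set \<Rightarrow> ('j \<Rightarrow> 'c) \<Rightarrow> ('j \<Rightarrow> 'c \<Rightarrow> 'a) \<Rightarrow> bool"
  where "dual_basis_for F J a \<phi> \<longleftrightarrow> finite J \<and> a \<in> J \<rightarrow> carrier A \<and> \<phi> \<in> J \<rightarrow> finite_dual R A \<and>
    (\<forall>f\<in>F. \<forall>b\<in>carrier A. \<forall>c\<in>carrier A.
      f (b \<otimes>\<^bsub>A\<^esub> c) = (\<Oplus>\<^bsub>K\<^esub>j\<in>J. f (b \<otimes>\<^bsub>A\<^esub> a j) \<otimes> \<phi> j c))"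

lemma finite_dual_basis:
  assumes "finite F" "F \<subseteq> finite_dual R A"
  shows "\<exists>(J :: 'c set set) a \<phi>. dual_basis_for F J a \<phi>"
proof -
  let ?I = "{x \<in> carrier A. \<forall>f\<in>F. \<forall>b\<in>carrier A. f (b \<otimes>\<^bsub>A\<^esub> x) = \<zero>}"
  note cof = cofinite_annihilator[OF assms]
  have FD: "f \<in> carrier D" if "f \<in> F" for f
    using that assms(2) finite_dual_subset by blast
  have "submodule ?I R A"
    using cof by (simp add: cofinite_submodule_def)
  then have "subgroup ?I (add_monoid A)"
    by (rule submodule.axioms(1))
  \<comment> \<open>Closure under left multiplication holds because the condition runs over all left
    multiples \<open>b x\<close>.\<close>
  then have "left_ideal ?I A"
    by (intro left_ideal.intro additive_subgroup.intro left_ideal_axioms.intro)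
      (auto simp: A.m_assoc[symmetric])
  then obtain I where I: "left_ideal I A" "I \<subseteq> ?I" "finitely_generated R (quotient_module A I)"
    "projective_module R (quotient_module A I)"
    using property_P finitely_generated_quotient[OF module_axioms cof]
    unfolding property_P_left_def by blast
  obtain J :: "'c set set" and a \<phi> where J: "finite J" "a \<in> J \<rightarrow> carrier A" "\<phi> \<in> J \<rightarrow> carrier D"
    "\<forall>j\<in>J. \<forall>x\<in>I. \<phi> j x = \<zero>"
    "\<forall>g\<in>mod_hom R A K. (\<forall>x\<in>I. g x = \<zero>) \<longrightarrow>
      (\<forall>b\<in>carrier A. g b = (\<Oplus>\<^bsub>K\<^esub>j\<in>J. g (a j) \<otimes> \<phi> j b))"
    using left_ideal_dual_basis[OF I(1,3,4)] by (elim exE conjE)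
  have a: "a j \<in> carrier A" and \<phi>: "\<phi> j \<in> carrier D" if "j \<in> J" for j
    using J(2,3) that by auto
  have expand: "f (b \<otimes>\<^bsub>A\<^esub> c) = (\<Oplus>\<^bsub>K\<^esub>j\<in>J. f (b \<otimes>\<^bsub>A\<^esub> a j) \<otimes> \<phi> j c)"
    if f: "f \<in> carrier D" "\<forall>x\<in>I. f x = \<zero>" and bc: "b \<in> carrier A" "c \<in> carrier A" for f b c
  proof (rule J(5)[rule_format, OF mod_hom_comp[OF D_hom[OF f(1)] mult_left_hom[OF bc(1)]] _ bc(2)])
    show "f (b \<otimes>\<^bsub>A\<^esub> x) = \<zero>" if "x \<in> I" for x
      using f(2) left_ideal.l_closed[OF I(1) bc(1) that] by blast
  qed
  \<comment> \<open>Each \<open>\<phi>\<^sub>i\<close> vanishes on \<open>I\<close> itself, so the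
    expansion applies to it in place of \<open>f\<close>, again with the
    \<open>\<phi>\<^sub>j\<close> as right factors.\<close>
  have \<phi>_fin: "\<phi> i \<in> finite_dual R A" if i: "i \<in> J" for i
  proof (rule finite_dual_sumI[OF \<phi>[OF i] J(1), of "\<lambda>j. dual_act A (a j) (\<phi> i)" \<phi>])
    fix b c assume bc: "b \<in> carrier A" "c \<in> carrier A"
    have "\<forall>x\<in>I. \<phi> i x = \<zero>" using J(4) i by blast
    from expand[OF \<phi>[OF i] this bc] bc
    show "\<phi> i (b \<otimes>\<^bsub>A\<^esub> c) = (\<Oplus>\<^bsub>K\<^esub>j\<in>J. dual_act A (a j) (\<phi> i) b \<otimes> \<phi> j c)"
      by (simp add: dual_act_def)
  qed (use a \<phi> i dual_act_closed in auto)
  have "f (b \<otimes>\<^bsub>A\<^esub> c) = (\<Oplus>\<^bsub>K\<^esub>j\<in>J. f (b \<otimes>\<^bsub>A\<^esub> a j) \<otimes> \<phi> j c)"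
    if f: "f \<in> F" and bc: "b \<in> carrier A" "c \<in> carrier A" for f b c
  proof (rule expand[OF FD[OF f] _ bc], rule ballI)
    \<comment> \<open>The annihilator condition at \<open>b = 1\<close> shows that \<open>f\<close>
      vanishes on \<open>I\<close>.\<close>
    fix x assume "x \<in> I"
    then have "x \<in> carrier A" "f (\<one>\<^bsub>A\<^esub> \<otimes>\<^bsub>A\<^esub> x) = \<zero>"
      using I(2) f by blast+
    then show "f x = \<zero>" by simp
  qed
  then have "dual_basis_for F J a \<phi>"
    unfolding dual_basis_for_def using J(1,2) \<phi>_fin by (intro conjI ballI funcsetI) auto
  then show ?thesis by blast
qed

lemma dual_basis_for_apply:
  assumes "dual_basis_for F J a \<phi>" "f \<in> F" "f \<in> carrier D" "b \<in> carrier A"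
  shows "f b = (\<Oplus>\<^bsub>K\<^esub>j\<in>J. f (a j) \<otimes> \<phi> j b)"
proof -
  have "f (\<one>\<^bsub>A\<^esub> \<otimes>\<^bsub>A\<^esub> b) = (\<Oplus>\<^bsub>K\<^esub>j\<in>J. f (\<one>\<^bsub>A\<^esub> \<otimes>\<^bsub>A\<^esub> a j) \<otimes> \<phi> j b)"
    using assms A.one_closed unfolding dual_basis_for_def by blast
  also have "\<dots> = (\<Oplus>\<^bsub>K\<^esub>j\<in>J. f (a j) \<otimes> \<phi> j b)"
  proof (rule K.M.finsum_cong')
    have *: "a j \<in> carrier A" "\<phi> j \<in> carrier D" if "j \<in> J" for j
      using assms(1) that finite_dual_subset by (auto simp: dual_basis_for_def)
    then show "(\<lambda>j. f (a j) \<otimes> \<phi> j b) \<in> J \<rightarrow> carrier K"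
      using D_closed[OF assms(3)] D_closed[OF _ assms(4)] by auto
    show "f (\<one>\<^bsub>A\<^esub> \<otimes>\<^bsub>A\<^esub> a j) \<otimes> \<phi> j b = f (a j) \<otimes> \<phi> j b" if "j \<in> J" for j
      using *(1)[OF that] by simp
  qed simp
  finally show ?thesis
    using assms(4) by simp
qed

text \<open>Since \<open>f(b a\<^sub>j) = (a\<^sub>j f)(b)\<close>, the relation of a dual basis for
  the one functional \<open>f\<close> is an expansion whose left factors are translates of
  \<open>f\<close>.\<close>

lemma finite_dual_expansion:
  assumes f: "f \<in> finite_dual R A"
  obtains J a \<phi> where "finite (J :: 'c set set)" "\<And>j. j \<in> J \<Longrightarrow> a j \<in> carrier A"
    "\<And>j. j \<in> J \<Longrightarrow> \<phi> j \<in> finite_dual R A"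
    "\<And>b c. b \<in> carrier A \<Longrightarrow> c \<in> carrier A \<Longrightarrow>
      f (b \<otimes>\<^bsub>A\<^esub> c) = (\<Oplus>\<^bsub>K\<^esub>j\<in>J. dual_act A (a j) f b \<otimes> \<phi> j c)"
proof -
  obtain J :: "'c set set" and a \<phi> where J: "dual_basis_for {f} J a \<phi>"
    using finite_dual_basis[of "{f}"] f by auto
  show ?thesis
    by (rule that[of J a \<phi>]) (use J in \<open>auto simp: dual_basis_for_def dual_act_def\<close>)
qed

lemma finite_dualE:
  assumes "f \<in> finite_dual R A"
  obtains t where "t \<in> carrier (tensor R D D)"
    "\<And>a b. a \<in> carrier A \<Longrightarrow> b \<in> carrier A \<Longrightarrow> f (a \<otimes>\<^bsub>A\<^esub> b) = ev a b t"
proof -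
  have f: "f \<in> carrier D" using assms finite_dual_subset by blast
  obtain J a \<phi> where J: "finite (J :: 'c set set)" "\<And>j. j \<in> J \<Longrightarrow> a j \<in> carrier A"
    "\<And>j. j \<in> J \<Longrightarrow> \<phi> j \<in> finite_dual R A"
    "\<And>b c. b \<in> carrier A \<Longrightarrow> c \<in> carrier A \<Longrightarrow>
      f (b \<otimes>\<^bsub>A\<^esub> c) = (\<Oplus>\<^bsub>K\<^esub>j\<in>J. dual_act A (a j) f b \<otimes> \<phi> j c)"
    using finite_dual_expansion[OF assms] by blast
  have "(\<lambda>j. dual_act A (a j) f) \<in> J \<rightarrow> carrier D" "\<phi> \<in> J \<rightarrow> carrier D"
    using dual_act_closed[OF f J(2)] finite_dual_D[OF J(3)] by blast+
  note t = ev_finsum_D[OF this]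
  show ?thesis
    by (rule that[OF t(1)]) (simp add: J(4) t(2))
qed

text \<open>The description by tensors is linear in \<open>f\<close>: sums and multiples of the
  tensors serve for sums and multiples of the functionals.\<close>

lemma submodule_finite_dual: "submodule (finite_dual R A) R D"
proof -
  note T = module_tensor[OF module_D module_D]
  interpret T: module R "tensor R D D" by (rule T)
  have add: "f \<oplus>\<^bsub>D\<^esub> g \<in> finite_dual R A" if fg: "f \<in> finite_dual R A" "g \<in> finite_dual R A" for f g
  proof -
    obtain s where s: "s \<in> carrier (tensor R D D)"
      "\<And>a b. a \<in> carrier A \<Longrightarrow> b \<in> carrier A \<Longrightarrow> f (a \<otimes>\<^bsub>A\<^esub> b) = ev a b s"
      using finite_dualE[OF fg(1)] by blast
    obtain t where t: "t \<in> carrier (tensor R D D)"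
      "\<And>a b. a \<in> carrier A \<Longrightarrow> b \<in> carrier A \<Longrightarrow> g (a \<otimes>\<^bsub>A\<^esub> b) = ev a b t"
      using finite_dualE[OF fg(2)] by blast
    show ?thesis
    proof (rule finite_dualI)
      show "f \<oplus>\<^bsub>D\<^esub> g \<in> carrier D" using fg finite_dual_subset by blast
      show "s \<oplus>\<^bsub>tensor R D D\<^esub> t \<in> carrier (tensor R D D)" using s t by blast
    qed (simp add: D_apply s t mod_hom_add[OF ev_hom_D])
  qed
  have smult: "r \<odot>\<^bsub>D\<^esub> f \<in> finite_dual R A" if r: "r \<in> carrier R" and f: "f \<in> finite_dual R A" for r f
  proof -
    obtain s where s: "s \<in> carrier (tensor R D D)"
      "\<And>a b. a \<in> carrier A \<Longrightarrow> b \<in> carrier A \<Longrightarrow> f (a \<otimes>\<^bsub>A\<^esub> b) = ev a b s"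
      using finite_dualE[OF f] by blast
    show ?thesis
    proof (rule finite_dualI)
      show "r \<odot>\<^bsub>D\<^esub> f \<in> carrier D" using r f finite_dual_subset by blast
      show "r \<odot>\<^bsub>tensor R D D\<^esub> s \<in> carrier (tensor R D D)" using r s by blast
    qed (simp add: D_apply r s mod_hom_smult[OF ev_hom_D])
  qed
  show ?thesis
  proof (rule D.submoduleI)
    show "\<zero>\<^bsub>D\<^esub> \<in> finite_dual R A"
      by (rule finite_dualI[of _ "\<zero>\<^bsub>tensor R D D\<^esub>"])
        (simp_all add: D_apply mod_hom_zero[OF ev_hom_D T module_K])
    show "\<ominus>\<^bsub>D\<^esub> f \<in> finite_dual R A" if f: "f \<in> finite_dual R A" for f
      using smult[of "\<ominus> \<one>" f] f finite_dual_subset by (simp add: D.smult_l_minus subset_iff)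
  qed (rule finite_dual_subset add smult; assumption?)+
qed

text \<open>\<open>(a f)(b c) = f(b (c a))\<close>, and expanding this moves the action of
  \<open>a\<close> onto the right factors \<open>\<phi>\<^sub>j\<close>. The left factors of the
  comultiplication will be such translates, so they must lie in
  \<open>A\<^sup>\<circ>\<close>.\<close>

lemma dual_act_finite_dual:
  assumes f: "f \<in> finite_dual R A" and a: "a \<in> carrier A"
  shows "dual_act A a f \<in> finite_dual R A"
proof -
  have fD: "f \<in> carrier D" using f finite_dual_subset by blast
  obtain J x \<phi> where J: "finite (J :: 'c set set)" "\<And>j. j \<in> J \<Longrightarrow> x j \<in> carrier A"
    "\<And>j. j \<in> J \<Longrightarrow> \<phi> j \<in> finite_dual R A"
    "\<And>b c. b \<in> carrier A \<Longrightarrow> c \<in> carrier A \<Longrightarrow>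
      f (b \<otimes>\<^bsub>A\<^esub> c) = (\<Oplus>\<^bsub>K\<^esub>j\<in>J. dual_act A (x j) f b \<otimes> \<phi> j c)"
    using finite_dual_expansion[OF f] by blast
  have \<phi>: "\<phi> j \<in> carrier D" if "j \<in> J" for j
    using J(3)[OF that] finite_dual_subset by blast
  show ?thesis
  proof (rule finite_dual_sumI[OF dual_act_closed[OF fD a] J(1),
        of "\<lambda>j. dual_act A (x j) f" "\<lambda>j. dual_act A a (\<phi> j)"])
    fix b c assume bc: "b \<in> carrier A" "c \<in> carrier A"
    show "dual_act A a f (b \<otimes>\<^bsub>A\<^esub> c) = (\<Oplus>\<^bsub>K\<^esub>j\<in>J. dual_act A (x j) f b \<otimes> dual_act A a (\<phi> j) c)"
      using J(4)[of b "c \<otimes>\<^bsub>A\<^esub> a"] bc a by (simp add: dual_act_def A.m_assoc)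
  qed (auto intro: dual_act_closed fD J(2) \<phi> a)
qed

end

section \<open>The coalgebra structure and the rational pairing\<close>

lemma (in cring) mod_hom_mult_left:
  assumes "f \<in> mod_hom R M (ring_module R)" "r \<in> carrier R"
  shows "(\<lambda>x. r \<otimes> f x) \<in> mod_hom R M (ring_module R)"
  using mod_hom_smult_fun[OF assms module_ring_module] by simp

lemma (in cring) mod_hom_mult_right:
  assumes "f \<in> mod_hom R M (ring_module R)" "r \<in> carrier R"
  shows "(\<lambda>x. f x \<otimes> r) \<in> mod_hom R M (ring_module R)"
  using mod_hom_smult_elem[OF assms(1) _ module_ring_module, of r] assms(2) by simp

lemma (in cring) trilinear_mult:
  assumes "f \<in> mod_hom R L (ring_module R)" "g \<in> mod_hom R M (ring_module R)"
    "h \<in> mod_hom R N (ring_module R)"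
  shows "trilinear_on R L M N (ring_module R) (\<lambda>x y z. f x \<otimes> (g y \<otimes> h z))"
proof -
  have cl: "f x \<in> carrier R" if "x \<in> carrier L" for x
    using mod_hom_closed[OF assms(1) that] by simp
  have cl': "g x \<in> carrier R" if "x \<in> carrier M" for x
    using mod_hom_closed[OF assms(2) that] by simp
  have cl'': "h x \<in> carrier R" if "x \<in> carrier N" for x
    using mod_hom_closed[OF assms(3) that] by simp
  show ?thesis
    by (rule trilinear_onI; intro mod_hom_mult_left mod_hom_mult_right assms m_closed cl cl' cl'')
qed

context property_P_algebra
begin

interpretation K: module R K by (rule module_K)
interpretation D: module R D by (rule module_D)

lemma C_simps [simp]:
  "carrier C = finite_dual R A" "add C = add D" "zero C = zero D" "smult C = smult D"
  by (simp_all add: finite_dual_module_def)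

lemma module_C: "module R C"
  unfolding finite_dual_module_def
  by (rule submodule.submodule_is_module[OF submodule_finite_dual module_D])

interpretation C: module R C by (rule module_C)

lemma C_eval: "a \<in> carrier A \<Longrightarrow> (\<lambda>f. f a) \<in> mod_hom R C K"
  by (rule mod_homI) (simp_all add: D_apply D_closed[OF finite_dual_D])

lemma C_eqI:
  "f \<in> carrier C \<Longrightarrow> g \<in> carrier C \<Longrightarrow> (\<And>a. a \<in> carrier A \<Longrightarrow> f a = g a) \<Longrightarrow> f = g"
  by (rule D_eqI) (auto dest: finite_dual_D)

lemma C_closed: "f \<in> finite_dual R A \<Longrightarrow> a \<in> carrier A \<Longrightarrow> f a \<in> carrier R"
  by (rule D_closed[OF finite_dual_D])

abbreviation "CC \<equiv> tensor R C C"

lemma module_CC: "module R CC"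
  by (rule module_tensor[OF module_C module_C])

lemmas ev_bilinear_C = ev_bilinear[OF C_eval C_eval]

lemma C_evals: "\<forall>a\<in>carrier A. (\<lambda>f. f a) \<in> mod_hom R C K"
  by (simp add: C_eval)

lemmas ev_hom_C = ev_hom[OF module_C C_evals]

lemma ev_pure_C:
  "a \<in> carrier A \<Longrightarrow> b \<in> carrier A \<Longrightarrow> g \<in> finite_dual R A \<Longrightarrow> h \<in> finite_dual R A \<Longrightarrow>
    ev a b (pure_tensor R C C g h) = g a \<otimes> h b"
  by (rule ev_pure[OF module_C C_evals]) simp_all

section \<open>Tensors with \<open>A\<^sup>\<circ>\<close> are separated by evaluation at elements
  of \<open>A\<close>\<close>

context
  fixes M :: "('a, 'm, 'y) module_scheme"
  assumes M: "module R M"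
begin

interpretation M': module R M by (rule M)

private abbreviation "T \<equiv> tensor R M C"
private abbreviation "EV a \<equiv> tensor_lift R M (\<lambda>m c. c a \<odot>\<^bsub>M\<^esub> m)"

lemma eval_right_bilinear: "a \<in> carrier A \<Longrightarrow> bilinear_on R M C M (\<lambda>m c. c a \<odot>\<^bsub>M\<^esub> m)"
  by (rule bilinear_on_flip[OF bilinear_smult[OF C_eval mod_hom_id M]])

lemma eval_right_hom: "a \<in> carrier A \<Longrightarrow> EV a \<in> mod_hom R T M"
  by (rule tensor_lift_hom[OF M module_C M eval_right_bilinear])

lemma eval_right_pure:
  "a \<in> carrier A \<Longrightarrow> m \<in> carrier M \<Longrightarrow> f \<in> finite_dual R A \<Longrightarrow>
    EV a (pure_tensor R M C m f) = f a \<odot>\<^bsub>M\<^esub> m"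
  by (rule tensor_lift_pure[OF M module_C M eval_right_bilinear]) simp_all

text \<open>For a pure tensor of \<open>m\<close> and \<open>f\<close> this is
  \<open>f = \<Sum> f(a\<^sub>j) \<phi>\<^sub>j\<close> with the scalars moved to the left factor,
  and \<open>F\<close> is the singleton of \<open>f\<close>. Quantifying over all dual bases of
  \<open>F\<close> makes the additive step work: a dual basis for \<open>F \<union> G\<close> is one
  for both sets.\<close>

lemma tensor_right_expansion:
  assumes "t \<in> carrier T"
  shows "\<exists>F. finite F \<and> F \<subseteq> finite_dual R A \<and>
    (\<forall>(J :: 'c set set) a \<phi>. dual_basis_for F J a \<phi> \<longrightarrow>
      t = (\<Oplus>\<^bsub>T\<^esub>j\<in>J. pure_tensor R M C (EV (a j) t) (\<phi> j)))"
  using assms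
proof (induction rule: tensor_induct[OF M module_C, consumes 1, case_names pure add])
  case (pure m f)
  note T = module_tensor[OF M module_C] and b = bilinear_pure_tensor[OF M module_C]
  interpret T: module R T by (rule T)
  have f: "f \<in> finite_dual R A" using pure by simp
  have "pure_tensor R M C m f = (\<Oplus>\<^bsub>T\<^esub>j\<in>J. pure_tensor R M C (EV (a j) (pure_tensor R M C m f)) (\<phi> j))"
    if J: "dual_basis_for {f} J a \<phi>" for J :: "'c set set" and a \<phi>
  proof -
    have a: "a j \<in> carrier A" and \<phi>: "\<phi> j \<in> carrier C" and r: "f (a j) \<in> carrier R" if "j \<in> J" for j
      using J that C_closed[OF f] by (auto simp: dual_basis_for_def)
    have cl: "(\<lambda>j. f (a j) \<odot>\<^bsub>C\<^esub> \<phi> j) \<in> J \<rightarrow> carrier C"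
      using r \<phi> C.smult_closed by blast
    have "f = (\<Oplus>\<^bsub>C\<^esub>j\<in>J. f (a j) \<odot>\<^bsub>C\<^esub> \<phi> j)"
    proof (rule C_eqI[OF _ C.M.finsum_closed[OF cl]])
      fix x assume x: "x \<in> carrier A"
      have "(\<Oplus>\<^bsub>C\<^esub>j\<in>J. f (a j) \<odot>\<^bsub>C\<^esub> \<phi> j) x = (\<Oplus>\<^bsub>K\<^esub>j\<in>J. (f (a j) \<odot>\<^bsub>C\<^esub> \<phi> j) x)"
        by (rule mod_hom_finsum[OF C_eval[OF x] module_C module_K cl])
      also have "\<dots> = (\<Oplus>\<^bsub>K\<^esub>j\<in>J. f (a j) \<otimes> \<phi> j x)"
        using x r \<phi> C_closed[OF _ x] by (intro K.M.finsum_cong') (auto simp: D_apply)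
      finally show "f x = (\<Oplus>\<^bsub>C\<^esub>j\<in>J. f (a j) \<odot>\<^bsub>C\<^esub> \<phi> j) x"
        using dual_basis_for_apply[OF J _ finite_dual_D[OF f] x] by simp
    qed (use f in simp)
    then have "pure_tensor R M C m f = pure_tensor R M C m (\<Oplus>\<^bsub>C\<^esub>j\<in>J. f (a j) \<odot>\<^bsub>C\<^esub> \<phi> j)"
      by simp
    also have "\<dots> = (\<Oplus>\<^bsub>T\<^esub>j\<in>J. pure_tensor R M C m (f (a j) \<odot>\<^bsub>C\<^esub> \<phi> j))"
      by (rule mod_hom_finsum[OF bilinear_on_right[OF b pure(1)] module_C T cl])
    also have "\<dots> = (\<Oplus>\<^bsub>T\<^esub>j\<in>J. pure_tensor R M C (EV (a j) (pure_tensor R M C m f)) (\<phi> j))"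
    proof (rule T.M.finsum_cong')
      show "(\<lambda>j. pure_tensor R M C (EV (a j) (pure_tensor R M C m f)) (\<phi> j)) \<in> J \<rightarrow> carrier T"
        using a \<phi> r f pure(1) by (auto intro!: pure_tensor_closed[OF M module_C] simp: eval_right_pure)
      fix j assume j: "j \<in> J"
      have "pure_tensor R M C m (f (a j) \<odot>\<^bsub>C\<^esub> \<phi> j) = f (a j) \<odot>\<^bsub>T\<^esub> pure_tensor R M C m (\<phi> j)"
        by (rule mod_hom_smult[OF bilinear_on_right[OF b pure(1)] r[OF j] \<phi>[OF j]])
      also have "\<dots> = pure_tensor R M C (f (a j) \<odot>\<^bsub>M\<^esub> m) (\<phi> j)"
        by (rule mod_hom_smult[OF bilinear_on_left[OF b \<phi>[OF j]] r[OF j] pure(1), symmetric])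
      finally show "pure_tensor R M C m (f (a j) \<odot>\<^bsub>C\<^esub> \<phi> j) =
          pure_tensor R M C (EV (a j) (pure_tensor R M C m f)) (\<phi> j)"
        by (simp only: eval_right_pure[OF a[OF j] pure(1) f])
    qed simp
    finally show ?thesis .
  qed
  then show ?case
    using f by (intro exI[of _ "{f}"]) simp
next
  case (add s t)
  note T = module_tensor[OF M module_C] and b = bilinear_pure_tensor[OF M module_C]
  interpret T: module R T by (rule T)
  obtain F where F: "finite F" "F \<subseteq> finite_dual R A"
    "\<And>(J :: 'c set set) a \<phi>. dual_basis_for F J a \<phi> \<Longrightarrow>
      s = (\<Oplus>\<^bsub>T\<^esub>j\<in>J. pure_tensor R M C (EV (a j) s) (\<phi> j))"
    using add.IH(1) by blast
  obtain G where G: "finite G" "G \<subseteq> finite_dual R A"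
    "\<And>(J :: 'c set set) a \<phi>. dual_basis_for G J a \<phi> \<Longrightarrow>
      t = (\<Oplus>\<^bsub>T\<^esub>j\<in>J. pure_tensor R M C (EV (a j) t) (\<phi> j))"
    using add.IH(2) by blast
  have "s \<oplus>\<^bsub>T\<^esub> t = (\<Oplus>\<^bsub>T\<^esub>j\<in>J. pure_tensor R M C (EV (a j) (s \<oplus>\<^bsub>T\<^esub> t)) (\<phi> j))"
    if J: "dual_basis_for (F \<union> G) J a \<phi>" for J :: "'c set set" and a \<phi>
  proof -
    have a: "a j \<in> carrier A" and \<phi>: "\<phi> j \<in> carrier C" if "j \<in> J" for j
      using J that by (auto simp: dual_basis_for_def)
    have JF: "dual_basis_for F J a \<phi>" and JG: "dual_basis_for G J a \<phi>"
      using J by (simp_all add: dual_basis_for_def)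
    have cl: "pure_tensor R M C (EV (a j) u) (\<phi> j) \<in> carrier T" if "j \<in> J" "u \<in> carrier T" for j u
      by (rule pure_tensor_closed[OF M module_C mod_hom_closed[OF eval_right_hom[OF a[OF that(1)]] that(2)]
            \<phi>[OF that(1)]])
    have "s \<oplus>\<^bsub>T\<^esub> t = (\<Oplus>\<^bsub>T\<^esub>j\<in>J. pure_tensor R M C (EV (a j) s) (\<phi> j)) \<oplus>\<^bsub>T\<^esub>
        (\<Oplus>\<^bsub>T\<^esub>j\<in>J. pure_tensor R M C (EV (a j) t) (\<phi> j))"
      using F(3)[OF JF] G(3)[OF JG] by simp
    also have "\<dots> = (\<Oplus>\<^bsub>T\<^esub>j\<in>J. pure_tensor R M C (EV (a j) s) (\<phi> j) \<oplus>\<^bsub>T\<^esub>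
        pure_tensor R M C (EV (a j) t) (\<phi> j))"
      using cl add.hyps by (intro T.M.finsum_addf[symmetric] funcsetI)
    also have "\<dots> = (\<Oplus>\<^bsub>T\<^esub>j\<in>J. pure_tensor R M C (EV (a j) (s \<oplus>\<^bsub>T\<^esub> t)) (\<phi> j))"
    proof (rule T.M.finsum_cong')
      show "(\<lambda>j. pure_tensor R M C (EV (a j) (s \<oplus>\<^bsub>T\<^esub> t)) (\<phi> j)) \<in> J \<rightarrow> carrier T"
        using cl T.M.a_closed[OF add.hyps] by blast
      fix j assume j: "j \<in> J"
      show "pure_tensor R M C (EV (a j) s) (\<phi> j) \<oplus>\<^bsub>T\<^esub> pure_tensor R M C (EV (a j) t) (\<phi> j) =
          pure_tensor R M C (EV (a j) (s \<oplus>\<^bsub>T\<^esub> t)) (\<phi> j)"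
        using mod_hom_closed[OF eval_right_hom[OF a[OF j]]] add.hyps
        by (simp only: mod_hom_add[OF eval_right_hom[OF a[OF j]]]
            mod_hom_add[OF bilinear_on_left[OF b \<phi>[OF j]]])
    qed simp
    finally show ?thesis .
  qed
  moreover have "finite (F \<union> G)" "F \<union> G \<subseteq> finite_dual R A"
    using F(1,2) G(1,2) by auto
  ultimately show ?case by (intro exI[of _ "F \<union> G"] conjI allI impI)
qed

text \<open>A common dual basis expands both tensors with the same \<open>a\<^sub>j\<close> and
  \<open>\<phi>\<^sub>j\<close>. The left factors in these expansions are the evaluations, which
  agree by assumption.\<close>

lemma tensor_right_separation:
  assumes s: "s \<in> carrier T" and t: "t \<in> carrier T"
    and eq: "\<And>a. a \<in> carrier A \<Longrightarrow> EV a s = EV a t"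
  shows "s = t"
proof -
  interpret T: module R T by (rule module_tensor[OF M module_C])
  obtain F where F: "finite F" "F \<subseteq> finite_dual R A"
    "\<And>(J :: 'c set set) a \<phi>. dual_basis_for F J a \<phi> \<Longrightarrow>
      s = (\<Oplus>\<^bsub>T\<^esub>j\<in>J. pure_tensor R M C (EV (a j) s) (\<phi> j))"
    using tensor_right_expansion[OF s] by blast
  obtain G where G: "finite G" "G \<subseteq> finite_dual R A"
    "\<And>(J :: 'c set set) a \<phi>. dual_basis_for G J a \<phi> \<Longrightarrow>
      t = (\<Oplus>\<^bsub>T\<^esub>j\<in>J. pure_tensor R M C (EV (a j) t) (\<phi> j))"
    using tensor_right_expansion[OF t] by blast
  obtain J :: "'c set set" and a \<phi> where J: "dual_basis_for (F \<union> G) J a \<phi>"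
    using finite_dual_basis[of "F \<union> G"] F(1,2) G(1,2) by auto
  have a: "a j \<in> carrier A" and \<phi>: "\<phi> j \<in> carrier C" if "j \<in> J" for j
    using J that by (auto simp: dual_basis_for_def)
  have "dual_basis_for F J a \<phi>" and JG: "dual_basis_for G J a \<phi>"
    using J by (simp_all add: dual_basis_for_def)
  then have "s = (\<Oplus>\<^bsub>T\<^esub>j\<in>J. pure_tensor R M C (EV (a j) s) (\<phi> j))"
    by (intro F(3))
  also have "\<dots> = (\<Oplus>\<^bsub>T\<^esub>j\<in>J. pure_tensor R M C (EV (a j) t) (\<phi> j))"
  proof (rule T.M.finsum_cong')
    show "(\<lambda>j. pure_tensor R M C (EV (a j) t) (\<phi> j)) \<in> J \<rightarrow> carrier T"
      using pure_tensor_closed[OF M module_C mod_hom_closed[OF eval_right_hom[OF a] t] \<phi>] by blast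
  qed (simp_all add: eq a)
  also have "\<dots> = t"
    by (rule G(3)[OF JG, symmetric])
  finally show ?thesis .
qed

text \<open>The flip of the tensor factors is injective and exchanges the two kinds of evaluation,
  so the previous result carries over. This version strips the first factor of
  \<open>A\<^sup>\<circ> \<otimes> (A\<^sup>\<circ> \<otimes> A\<^sup>\<circ>)\<close>.\<close>

lemma tensor_left_separation:
  assumes s: "s \<in> carrier (tensor R C M)" and t: "t \<in> carrier (tensor R C M)"
    and eq: "\<And>a. a \<in> carrier A \<Longrightarrow>
      tensor_lift R M (\<lambda>c m. c a \<odot>\<^bsub>M\<^esub> m) s = tensor_lift R M (\<lambda>c m. c a \<odot>\<^bsub>M\<^esub> m) t"
  shows "s = t"
proof -
  note T = module_tensor[OF M module_C] and T' = module_tensor[OF module_C M]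
  let ?flip = "tensor_lift R T (\<lambda>c m. pure_tensor R M C m c)"
  let ?unflip = "tensor_lift R (tensor R C M) (\<lambda>m c. pure_tensor R C M c m)"
  note b = bilinear_on_flip[OF bilinear_pure_tensor[OF M module_C]]
  note b' = bilinear_on_flip[OF bilinear_pure_tensor[OF module_C M]]
  note flip = tensor_lift_hom[OF module_C M T b] and unflip = tensor_lift_hom[OF M module_C T' b']
  have unflip_flip: "?unflip (?flip u) = u" if "u \<in> carrier (tensor R C M)" for u
    by (rule tensor_hom_eq[OF module_C M mod_hom_comp[OF unflip flip] mod_hom_id that])
      (simp add: tensor_lift_pure[OF module_C M T b] tensor_lift_pure[OF M module_C T' b'])
  have EV_flip: "EV a (?flip u) = tensor_lift R M (\<lambda>c m. c a \<odot>\<^bsub>M\<^esub> m) u"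
    if a: "a \<in> carrier A" and u: "u \<in> carrier (tensor R C M)" for a u
  proof -
    note b'' = bilinear_smult[OF C_eval[OF a] mod_hom_id M]
    show ?thesis
      by (rule tensor_hom_eq[OF module_C M mod_hom_comp[OF eval_right_hom[OF a] flip]
            tensor_lift_hom[OF module_C M M b''] u])
        (simp add: tensor_lift_pure[OF module_C M T b] eval_right_pure a tensor_lift_pure[OF module_C M M b''])
  qed
  have flip_eq: "?flip s = ?flip t"
    by (rule tensor_right_separation[OF mod_hom_closed[OF flip s] mod_hom_closed[OF flip t]])
      (simp only: EV_flip s t eq)
  have "s = ?unflip (?flip s)"
    by (rule unflip_flip[OF s, symmetric])
  also have "\<dots> = ?unflip (?flip t)"
    by (rule arg_cong[OF flip_eq])
  also have "\<dots> = t"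
    by (rule unflip_flip[OF t])
  finally show ?thesis .
qed

lemma alpha_map_inj: "inj_on (alpha_map R A (\<lambda>f a. f a) M) (carrier T)"
proof (rule inj_onI)
  let ?H = "hom_module R A M"
  note H = module_hom_module[OF module_axioms M]
  have b: "bilinear_on R M C ?H (\<lambda>m c. \<lambda>a\<in>carrier A. c a \<odot>\<^bsub>M\<^esub> m)"
  proof (rule bilinear_onI)
    fix m assume m: "m \<in> carrier M"
    show "(\<lambda>c. \<lambda>a\<in>carrier A. c a \<odot>\<^bsub>M\<^esub> m) \<in> mod_hom R C ?H"
    proof (rule mod_hom_into_hom_module[OF module_axioms M module_C])
      show "(\<lambda>a. c a \<odot>\<^bsub>M\<^esub> m) \<in> mod_hom R A M" if "c \<in> carrier C" for c
        using that by (intro mod_hom_smult_elem[OF _ m M] D_hom finite_dual_D) simp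
      show "(\<lambda>c. c a \<odot>\<^bsub>M\<^esub> m) \<in> mod_hom R C M" if "a \<in> carrier A" for a
        by (rule mod_hom_smult_elem[OF C_eval[OF that] m M])
    qed
  next
    fix c assume c: "c \<in> carrier C"
    show "(\<lambda>m. \<lambda>a\<in>carrier A. c a \<odot>\<^bsub>M\<^esub> m) \<in> mod_hom R M ?H"
    proof (rule mod_hom_into_hom_module[OF module_axioms M M])
      show "(\<lambda>a. c a \<odot>\<^bsub>M\<^esub> m) \<in> mod_hom R A M" if "m \<in> carrier M" for m
        using c by (intro mod_hom_smult_elem[OF _ that M] D_hom finite_dual_D) simp
      show "(\<lambda>m. c a \<odot>\<^bsub>M\<^esub> m) \<in> mod_hom R M M" if "a \<in> carrier A" for a
        using c by (intro mod_hom_smult_fun[OF mod_hom_id _ M] C_closed that) simp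
    qed
  qed
  \<comment> \<open>Evaluation of a linear map at \<open>a\<close> is linear and can be pushed under
    the lift, so \<open>alpha_map\<close> collects the evaluations in one function.\<close>
  have alpha: "alpha_map R A (\<lambda>f a. f a) M u a = EV a u"
    if u: "u \<in> carrier T" and a: "a \<in> carrier A" for u a
  proof -
    have "alpha_map R A (\<lambda>f a. f a) M u a =
        tensor_lift R M (\<lambda>m c. (\<lambda>a\<in>carrier A. c a \<odot>\<^bsub>M\<^esub> m) a) u"
      unfolding alpha_map_def
      by (rule tensor_lift_comp[OF M module_C H M mod_hom_eval[OF a] b u])
    then show ?thesis
      using a by simp
  qed
  fix s t assume s: "s \<in> carrier T" and t: "t \<in> carrier T"
    and "alpha_map R A (\<lambda>f a. f a) M s = alpha_map R A (\<lambda>f a. f a) M t"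
  then show "s = t"
    using alpha[OF s] alpha[OF t] by (intro tensor_right_separation[OF s t]) metis
qed

end

text \<open>Right separation with \<open>M = A\<^sup>\<circ>\<close>: evaluating the right factor at
  \<open>b\<close> gives an element of \<open>A\<^sup>\<circ>\<close>, which is determined by its
  values at all \<open>a\<close>.\<close>

lemma ev_separation:
  assumes s: "s \<in> carrier CC" and t: "t \<in> carrier CC"
    and eq: "\<And>a b. a \<in> carrier A \<Longrightarrow> b \<in> carrier A \<Longrightarrow> ev a b s = ev a b t"
  shows "s = t"
proof (rule tensor_right_separation[OF module_C s t])
  fix b assume b: "b \<in> carrier A"
  note bb = eval_right_bilinear[OF module_C b]
  note cl = mod_hom_closed[OF eval_right_hom[OF module_C b]]
  have ev: "(tensor_lift R C (\<lambda>m c. c b \<odot>\<^bsub>C\<^esub> m) u) a = ev a b u"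
    if a: "a \<in> carrier A" and u: "u \<in> carrier CC" for a u
  proof -
    have "(tensor_lift R C (\<lambda>m c. c b \<odot>\<^bsub>C\<^esub> m) u) a = tensor_lift R K (\<lambda>m c. (c b \<odot>\<^bsub>C\<^esub> m) a) u"
      by (rule tensor_lift_comp[OF module_C module_C module_C module_K C_eval[OF a] bb u])
    also have "\<dots> = ev a b u"
      using a b by (intro tensor_lift_cong[OF module_C module_C module_K ev_bilinear_C[OF a b] u])
        (simp add: D_apply m_comm C_closed)
    finally show ?thesis .
  qed
  show "tensor_lift R C (\<lambda>m c. c b \<odot>\<^bsub>C\<^esub> m) s = tensor_lift R C (\<lambda>m c. c b \<odot>\<^bsub>C\<^esub> m) t"
    by (rule C_eqI[OF cl[OF s] cl[OF t]]) (simp only: ev s t b eq)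
qed

text \<open>Left separation with \<open>M = A\<^sup>\<circ> \<otimes> A\<^sup>\<circ>\<close>
  removes the first factor, and the two-variable result settles what remains.\<close>

lemma ev_separation3:
  assumes s: "s \<in> carrier (tensor R C CC)" and t: "t \<in> carrier (tensor R C CC)"
    and eq: "\<And>a b c. a \<in> carrier A \<Longrightarrow> b \<in> carrier A \<Longrightarrow> c \<in> carrier A \<Longrightarrow>
      tensor_lift R K (\<lambda>x. tensor_lift R K (\<lambda>y z. x a \<otimes> (y b \<otimes> z c))) s =
      tensor_lift R K (\<lambda>x. tensor_lift R K (\<lambda>y z. x a \<otimes> (y b \<otimes> z c))) t"
  shows "s = t"
proof (rule tensor_left_separation[OF module_CC s t])
  fix a assume a: "a \<in> carrier A"
  let ?L = "tensor_lift R CC (\<lambda>x m. x a \<odot>\<^bsub>CC\<^esub> m)"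
  note bl = bilinear_smult[OF C_eval[OF a] mod_hom_id module_CC]
  note cl = mod_hom_closed[OF tensor_lift_hom[OF module_C module_CC module_CC bl]]
  have ev: "ev b c (?L u) = tensor_lift R K (\<lambda>x. tensor_lift R K (\<lambda>y z. x a \<otimes> (y b \<otimes> z c))) u"
    if b: "b \<in> carrier A" and c: "c \<in> carrier A" and u: "u \<in> carrier (tensor R C CC)" for b c u
  proof -
    have "ev b c (?L u) = tensor_lift R K (\<lambda>x m. ev b c (x a \<odot>\<^bsub>CC\<^esub> m)) u"
      by (rule tensor_lift_comp[OF module_C module_CC module_CC module_K ev_hom_C[OF b c] bl u])
    also have "\<dots> = tensor_lift R K (\<lambda>x. tensor_lift R K (\<lambda>y z. x a \<otimes> (y b \<otimes> z c))) u"
    proof (rule tensor_lift_cong[OF module_C module_CC module_K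
          trilinear_lift_right[OF module_C module_C module_C module_K
            trilinear_mult[OF C_eval[OF a] C_eval[OF b] C_eval[OF c]]] u])
      fix x m assume x: "x \<in> carrier C" and m: "m \<in> carrier CC"
      have xa: "x a \<in> carrier R" using x a C_closed by simp
      have "ev b c (x a \<odot>\<^bsub>CC\<^esub> m) = x a \<otimes> ev b c m"
        using mod_hom_smult[OF ev_hom_C[OF b c] xa m] by simp
      also have "\<dots> = tensor_lift R K (\<lambda>y z. x a \<otimes> (y b \<otimes> z c)) m"
        by (rule tensor_lift_comp[OF module_C module_C module_K module_K
              mod_hom_mult_left[OF mod_hom_id xa] ev_bilinear_C[OF b c] m])
      finally show "ev b c (x a \<odot>\<^bsub>CC\<^esub> m) = tensor_lift R K (\<lambda>y z. x a \<otimes> (y b \<otimes> z c)) m" .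
    qed
    finally show ?thesis .
  qed
  show "?L s = ?L t"
    by (rule ev_separation[OF cl[OF s] cl[OF t]]) (simp only: ev s t eq a)
qed

section \<open>The comultiplication and the coalgebra axioms\<close>

abbreviation "comult \<equiv> finite_dual_comult R A"
abbreviation "counit \<equiv> finite_dual_counit A"

text \<open>The witness is \<open>\<Sum> (a\<^sub>j f) \<otimes> \<phi>\<^sub>j\<close>, with both
  factors in \<open>A\<^sup>\<circ>\<close>. Uniqueness is separation by values.\<close>

lemma finite_dual_comult_ex1:
  assumes f: "f \<in> finite_dual R A"
  shows "\<exists>!t. is_finite_dual_comult R A f t"
proof -
  obtain J a \<phi> where J: "finite (J :: 'c set set)" "\<And>j. j \<in> J \<Longrightarrow> a j \<in> carrier A"
    "\<And>j. j \<in> J \<Longrightarrow> \<phi> j \<in> finite_dual R A"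
    "\<And>b c. b \<in> carrier A \<Longrightarrow> c \<in> carrier A \<Longrightarrow>
      f (b \<otimes>\<^bsub>A\<^esub> c) = (\<Oplus>\<^bsub>K\<^esub>j\<in>J. dual_act A (a j) f b \<otimes> \<phi> j c)"
    using finite_dual_expansion[OF f] by blast
  have "(\<lambda>j. dual_act A (a j) f) \<in> J \<rightarrow> carrier C" "\<phi> \<in> J \<rightarrow> carrier C"
    using dual_act_finite_dual[OF f J(2)] J(3) by auto
  note t = ev_finsum[OF module_C C_evals this]
  have "is_finite_dual_comult R A f (\<Oplus>\<^bsub>CC\<^esub>j\<in>J. pure_tensor R C C (dual_act A (a j) f) (\<phi> j))"
    unfolding is_finite_dual_comult_def using t J(4) by simp
  moreover have "s = t" if "is_finite_dual_comult R A f s" "is_finite_dual_comult R A f t" for s t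
    using that by (intro ev_separation) (simp_all add: is_finite_dual_comult_def)
  ultimately show ?thesis by blast
qed

lemma is_finite_dual_comult: "f \<in> finite_dual R A \<Longrightarrow> is_finite_dual_comult R A f (comult f)"
  unfolding finite_dual_comult_def by (rule theI'[OF finite_dual_comult_ex1])

lemma comult_closed: "f \<in> finite_dual R A \<Longrightarrow> comult f \<in> carrier CC"
  and ev_comult: "f \<in> finite_dual R A \<Longrightarrow> a \<in> carrier A \<Longrightarrow> b \<in> carrier A \<Longrightarrow>
    ev a b (comult f) = f (a \<otimes>\<^bsub>A\<^esub> b)"
  using is_finite_dual_comult[of f] by (simp_all add: is_finite_dual_comult_def)

text \<open>Every identity for \<open>comult\<close> is obtained this way: a candidate tensor is
  exhibited and its values are computed.\<close>

lemma comult_eqI: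
  assumes "f \<in> finite_dual R A" "t \<in> carrier CC"
    and "\<And>a b. a \<in> carrier A \<Longrightarrow> b \<in> carrier A \<Longrightarrow> ev a b t = f (a \<otimes>\<^bsub>A\<^esub> b)"
  shows "comult f = t"
  by (rule ev_separation[OF comult_closed[OF assms(1)] assms(2)]) (simp add: ev_comult assms)

lemma finite_dual_comult_hom: "comult \<in> mod_hom R C CC"
proof -
  interpret T: module R CC by (rule module_CC)
  show ?thesis
  proof (rule mod_homI)
    fix f assume f: "f \<in> carrier C"
    show "comult f \<in> carrier CC" using f by (simp add: comult_closed)
    fix g assume g: "g \<in> carrier C"
    show "comult (f \<oplus>\<^bsub>C\<^esub> g) = comult f \<oplus>\<^bsub>CC\<^esub> comult g"
      using f g C.M.a_closed[OF f g]
      by (intro comult_eqI T.M.a_closed)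
        (simp_all add: comult_closed ev_comult mod_hom_add[OF ev_hom_C] D_apply)
  next
    fix r f assume r: "r \<in> carrier R" and f: "f \<in> carrier C"
    show "comult (r \<odot>\<^bsub>C\<^esub> f) = r \<odot>\<^bsub>CC\<^esub> comult f"
      using r f C.smult_closed[OF r f]
      by (intro comult_eqI T.smult_closed)
        (simp_all add: comult_closed ev_comult mod_hom_smult[OF ev_hom_C] D_apply)
  qed
qed

lemma finite_dual_counit_hom: "counit \<in> mod_hom R C K"
  using C_eval[OF A.one_closed] by (simp add: finite_dual_counit_def[abs_def])

text \<open>At \<open>(a, b, c)\<close> the two sides of coassociativity take the values
  \<open>f((a b) c)\<close> and \<open>f(a (b c))\<close>. The counit axioms become
  \<open>f(1 a) = f(a)\<close> and \<open>f(a 1) = f(a)\<close>.\<close>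

lemma coalgebra_finite_dual: "coalgebra R C comult counit"
proof (intro coalgebra.intro module_C coalgebra_axioms.intro finite_dual_comult_hom finite_dual_counit_hom)
  fix f assume f: "f \<in> carrier C"
  then have f': "f \<in> finite_dual R A" by simp
  note cf = comult_closed[OF f']
  have id: "id \<in> mod_hom R C C" using mod_hom_id[of R C] by (simp add: id_def)
  show "tensor_assoc R C C C (tensor_map R CC C comult id (comult f)) =
      tensor_map R C CC id comult (comult f)"
  proof (rule ev_separation3)
    show "tensor_assoc R C C C (tensor_map R CC C comult id (comult f)) \<in> carrier (tensor R C CC)"
      by (rule mod_hom_closed[OF tensor_assoc_hom[OF module_C module_C module_C]
            mod_hom_closed[OF tensor_map_hom[OF module_CC module_C module_C module_C finite_dual_comult_hom id] cf]])
    show "tensor_map R C CC id comult (comult f) \<in> carrier (tensor R C CC)"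
      by (rule mod_hom_closed[OF tensor_map_hom[OF module_C module_CC module_C module_C id finite_dual_comult_hom] cf])
    fix a b c assume a: "a \<in> carrier A" and b: "b \<in> carrier A" and c: "c \<in> carrier A"
    note tri = trilinear_mult[OF C_eval[OF a] C_eval[OF b] C_eval[OF c]]
    \<comment> \<open>The inner sum over \<open>comult x\<close> evaluates \<open>x\<close> at the
      product \<open>a b\<close>; \<open>xr\<close> does the same with \<open>b c\<close> in the
      second slot.\<close>
    have xl: "tensor_lift R K (\<lambda>u v. u a \<otimes> (v b \<otimes> z c)) (comult x) = x (a \<otimes>\<^bsub>A\<^esub> b) \<otimes> z c"
      if x: "x \<in> carrier C" and z: "z \<in> carrier C" for x z
    proof -
      have zc: "z c \<in> carrier R" using z c C_closed by simp
      have cx: "comult x \<in> carrier CC" using x comult_closed by simp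
      have "ev a b (comult x) \<otimes> z c = tensor_lift R K (\<lambda>u v. (u a \<otimes> v b) \<otimes> z c) (comult x)"
        by (rule tensor_lift_comp[OF module_C module_C module_K module_K
              mod_hom_mult_right[OF mod_hom_id zc] ev_bilinear_C[OF a b] cx])
      also have "\<dots> = tensor_lift R K (\<lambda>u v. u a \<otimes> (v b \<otimes> z c)) (comult x)"
        using a b zc by (intro tensor_lift_cong[OF module_C module_C module_K
              trilinear_on_3[OF tri z] cx]) (simp add: R.m_assoc C_closed)
      finally show ?thesis
        using x a b by (simp add: ev_comult)
    qed
    have xr: "tensor_lift R K (\<lambda>u v. x a \<otimes> (u b \<otimes> v c)) (comult y) = x a \<otimes> y (b \<otimes>\<^bsub>A\<^esub> c)"
      if x: "x \<in> carrier C" and y: "y \<in> carrier C" for x y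
    proof -
      have xa: "x a \<in> carrier R" using x a C_closed by simp
      have cy: "comult y \<in> carrier CC" using y comult_closed by simp
      have "x a \<otimes> ev b c (comult y) = tensor_lift R K (\<lambda>u v. x a \<otimes> (u b \<otimes> v c)) (comult y)"
        by (rule tensor_lift_comp[OF module_C module_C module_K module_K
              mod_hom_mult_left[OF mod_hom_id xa] ev_bilinear_C[OF b c] cy])
      then show ?thesis
        using y b c by (simp add: ev_comult)
    qed
    note ab = A.m_closed[OF a b] and bc = A.m_closed[OF b c]
    have "tensor_lift R K (\<lambda>x. tensor_lift R K (\<lambda>y z. x a \<otimes> (y b \<otimes> z c)))
        (tensor_assoc R C C C (tensor_map R CC C comult id (comult f))) =
      tensor_lift R K (\<lambda>x z. tensor_lift R K (\<lambda>u v. u a \<otimes> (v b \<otimes> z c)) (comult x)) (comult f)"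
      by (rule tensor_lift_comult_left[OF module_C finite_dual_comult_hom module_K tri f])
    also have "\<dots> = ev (a \<otimes>\<^bsub>A\<^esub> b) c (comult f)"
      by (rule tensor_lift_cong[OF module_C module_C module_K ev_bilinear_C[OF ab c] cf], rule xl)
    \<comment> \<open>Associativity of \<open>A\<close> enters here: both evaluations are values of
      \<open>f\<close> at the triple product.\<close>
    also have "\<dots> = ev a (b \<otimes>\<^bsub>A\<^esub> c) (comult f)"
      using a b c f' by (simp add: ev_comult A.m_assoc)
    also have "\<dots> = tensor_lift R K (\<lambda>x y. tensor_lift R K (\<lambda>u v. x a \<otimes> (u b \<otimes> v c)) (comult y)) (comult f)"
      by (rule sym, rule tensor_lift_cong[OF module_C module_C module_K ev_bilinear_C[OF a bc] cf], rule xr)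
    also have "\<dots> = tensor_lift R K (\<lambda>x. tensor_lift R K (\<lambda>y z. x a \<otimes> (y b \<otimes> z c)))
        (tensor_map R C CC id comult (comult f))"
      by (rule tensor_lift_comult_right[OF module_C finite_dual_comult_hom module_K tri f, symmetric])
    finally show "tensor_lift R K (\<lambda>x. tensor_lift R K (\<lambda>y z. x a \<otimes> (y b \<otimes> z c)))
        (tensor_assoc R C C C (tensor_map R CC C comult id (comult f))) =
      tensor_lift R K (\<lambda>x. tensor_lift R K (\<lambda>y z. x a \<otimes> (y b \<otimes> z c)))
        (tensor_map R C CC id comult (comult f))" .
  qed
  note bl = bilinear_smult[OF finite_dual_counit_hom mod_hom_id module_C]
  show "tensor_lift R C (\<lambda>x y. counit x \<odot>\<^bsub>C\<^esub> y) (comult f) = f"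
  proof (rule C_eqI[OF mod_hom_closed[OF tensor_lift_hom[OF module_C module_C module_C bl] cf] f])
    fix a assume a: "a \<in> carrier A"
    have "tensor_lift R C (\<lambda>x y. counit x \<odot>\<^bsub>C\<^esub> y) (comult f) a =
        tensor_lift R K (\<lambda>x y. (counit x \<odot>\<^bsub>C\<^esub> y) a) (comult f)"
      by (rule tensor_lift_comp[OF module_C module_C module_C module_K C_eval[OF a] bl cf])
    also have "\<dots> = ev \<one>\<^bsub>A\<^esub> a (comult f)"
      using a by (intro tensor_lift_cong[OF module_C module_C module_K ev_bilinear_C[OF A.one_closed a] cf])
        (simp add: D_apply finite_dual_counit_def)
    also have "\<dots> = f a" using f' a by (simp add: ev_comult)
    finally show "tensor_lift R C (\<lambda>x y. counit x \<odot>\<^bsub>C\<^esub> y) (comult f) a = f a" .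
  qed
  note br = bilinear_on_flip[OF bl]
  show "tensor_lift R C (\<lambda>x y. counit y \<odot>\<^bsub>C\<^esub> x) (comult f) = f"
  proof (rule C_eqI[OF mod_hom_closed[OF tensor_lift_hom[OF module_C module_C module_C br] cf] f])
    fix a assume a: "a \<in> carrier A"
    have "tensor_lift R C (\<lambda>x y. counit y \<odot>\<^bsub>C\<^esub> x) (comult f) a =
        tensor_lift R K (\<lambda>x y. (counit y \<odot>\<^bsub>C\<^esub> x) a) (comult f)"
      by (rule tensor_lift_comp[OF module_C module_C module_C module_K C_eval[OF a] br cf])
    also have "\<dots> = ev a \<one>\<^bsub>A\<^esub> (comult f)"
      using a by (intro tensor_lift_cong[OF module_C module_C module_K ev_bilinear_C[OF a A.one_closed] cf])
        (simp add: D_apply finite_dual_counit_def C_closed m_comm)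
    also have "\<dots> = f a" using f' a by (simp add: ev_comult)
    finally show "tensor_lift R C (\<lambda>x y. counit y \<odot>\<^bsub>C\<^esub> x) (comult f) a = f a" .
  qed
qed

section \<open>The pairing of \<open>A\<^sup>\<circ>\<close> with \<open>A\<close>\<close>

lemma convolution_algebra_simps:
  "carrier (convolution_algebra R B \<Delta> \<epsilon>) = carrier (dual_module R B)"
  "add (convolution_algebra R B \<Delta> \<epsilon>) = add (dual_module R B)"
  "zero (convolution_algebra R B \<Delta> \<epsilon>) = zero (dual_module R B)"
  "smult (convolution_algebra R B \<Delta> \<epsilon>) = smult (dual_module R B)"
  "mult (convolution_algebra R B \<Delta> \<epsilon>) =
    (\<lambda>f g. \<lambda>c\<in>carrier B. tensor_lift R (ring_module R) (\<lambda>x y. f x \<otimes> g y) (\<Delta> c))"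
  "one (convolution_algebra R B \<Delta> \<epsilon>) = restrict \<epsilon> (carrier B)"
  by (simp_all add: convolution_algebra_def)

lemma rational_pairing_finite_dual:
  "rational_pairing TYPE('m) R C comult counit A (\<lambda>f a. f a)"
  unfolding rational_pairing_def
proof (intro conjI ballI allI impI)
  show "coalgebra R C comult counit" by (rule coalgebra_finite_dual)
  show "assoc_algebra R A" by (rule assoc_algebra_axioms)
  show "(\<lambda>a. c a) \<in> mod_hom R A K" if "c \<in> carrier C" for c
    using that by (simp add: D_hom[OF finite_dual_D])
  show "(\<lambda>c. c a) \<in> mod_hom R C K" if "a \<in> carrier A" for a
    by (rule C_eval[OF that])
  show "inj_on (alpha_map R A (\<lambda>f a. f a) M) (carrier (tensor R M C))" if "module R M"
    for M :: "('a, 'm) module"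
    by (rule alpha_map_inj[OF that])
  let ?E = "convolution_algebra R C comult counit" and ?h = "\<lambda>a. \<lambda>c\<in>carrier C. c a"
  have "?h \<in> mod_hom R A (dual_module R C)"
    unfolding dual_module_def
    by (rule mod_hom_into_hom_module[OF module_C module_K module_axioms C_eval])
      (simp_all add: D_hom[OF finite_dual_D])
  \<comment> \<open>Linearity reads only the module operations, in which the convolution algebra and
    the dual module agree.\<close>
  moreover have "mod_hom R A ?E = mod_hom R A (dual_module R C)"
    unfolding mod_hom_def convolution_algebra_simps ..
  ultimately have h: "?h \<in> mod_hom R A ?E"
    by (simp only:)
  have "?h \<in> ring_hom A ?E"
  proof (rule ring_hom_memI)
    fix a assume a: "a \<in> carrier A"
    show "?h a \<in> carrier ?E" by (rule mod_hom_closed[OF h a])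
    fix b assume b: "b \<in> carrier A"
    show "?h (a \<oplus>\<^bsub>A\<^esub> b) = ?h a \<oplus>\<^bsub>?E\<^esub> ?h b" by (rule mod_hom_add[OF h a b])
    \<comment> \<open>The convolution product of the functionals given by \<open>a\<close> and
      \<open>b\<close>, taken at \<open>f\<close>, is the value of \<open>comult f\<close> at
      \<open>(a, b)\<close>. Multiplicativity is thus the defining property of the
      comultiplication.\<close>
    have "f (a \<otimes>\<^bsub>A\<^esub> b) = tensor_lift R K (\<lambda>x y. ?h a x \<otimes> ?h b y) (comult f)" if f: "f \<in> carrier C" for f
    proof -
      have f': "f \<in> finite_dual R A" using f by simp
      have "tensor_lift R K (\<lambda>x y. ?h a x \<otimes> ?h b y) (comult f) = ev a b (comult f)"
        by (rule tensor_lift_cong[OF module_C module_C module_K ev_bilinear_C[OF a b] comult_closed[OF f']])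
          simp
      then show ?thesis using ev_comult[OF f' a b] by simp
    qed
    then show "?h (a \<otimes>\<^bsub>A\<^esub> b) = ?h a \<otimes>\<^bsub>?E\<^esub> ?h b"
      unfolding convolution_algebra_simps by (intro restrict_ext)
  next
    show "?h \<one>\<^bsub>A\<^esub> = \<one>\<^bsub>?E\<^esub>"
      unfolding convolution_algebra_simps by (intro restrict_ext) (simp add: finite_dual_counit_def)
  qed
  with h show "?h \<in> alg_hom R A ?E"
    by (simp add: alg_hom_def)
qed

end

section \<open>The bialgebra structure\<close>

lemma module_transfer:
  assumes "module R M" "carrier N = carrier M" "add N = add M" "zero N = zero M" "smult N = smult M"
  shows "module R N"
proof -
  interpret M: module R M by fact
  show ?thesis
  proof (rule moduleI)
    show "abelian_group N"
    proof (rule abelian_groupI)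
      fix x assume "x \<in> carrier N"
      then show "\<exists>y\<in>carrier N. y \<oplus>\<^bsub>N\<^esub> x = \<zero>\<^bsub>N\<^esub>"
        by (intro bexI[of _ "\<ominus>\<^bsub>M\<^esub> x"]) (simp_all add: assms M.l_neg)
    qed (simp_all add: assms M.a_ac)
  qed (simp_all add: assms M.is_cring M.smult_l_distr M.smult_r_distr M.smult_assoc1)
qed

text \<open>The free module, the relations and the pure tensors read only the carriers, additions
  and scalar multiplications of the two factors.\<close>

lemma tensor_transfer:
  assumes "carrier M' = carrier M" "add M' = add M" "smult M' = smult M"
    and "carrier N' = carrier N" "add N' = add N" "smult N' = smult N"
  shows "tensor R M' N' = tensor R M N" "pure_tensor R M' N' = pure_tensor R M N"
proof -
  have "tensor_kernel R M' N' = tensor_kernel R M N"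
    by (simp add: tensor_kernel_def tensor_relations_def assms)
  then show "tensor R M' N' = tensor R M N" "pure_tensor R M' N' = pure_tensor R M N"
    by (simp_all add: tensor_def pure_tensor_def fun_eq_iff assms)
qed

lemma tensor_lift_transfer:
  fixes P P' :: "('r, 'p, 'y) module_scheme"
  assumes "carrier P' = carrier P" "add P' = add P" "zero P' = zero P" "smult P' = smult P"
  shows "tensor_lift R P' = tensor_lift R P"
  by (simp add: tensor_lift_def fun_eq_iff finsum_def assms)

text \<open>\<open>finite_dual_module\<close> and \<open>finite_dual_algebra\<close> are different
  records for \<open>A\<^sup>\<circ>\<close>, with the same module operations. This moves the
  coalgebra structure from the first to the second.\<close>

lemma coalgebra_transfer:
  fixes M N :: "('r, 'm, 'y) module_scheme"
  assumes "coalgebra R M \<Delta> \<epsilon>"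
    and eq: "carrier N = carrier M" "add N = add M" "zero N = zero M" "smult N = smult M"
  shows "coalgebra R N \<Delta> \<epsilon>"
proof -
  interpret M: coalgebra R M \<Delta> \<epsilon> by fact
  note tens = tensor_transfer(1)[OF eq(1,2,4) eq(1,2,4)]
  have t1: "tensor R N (tensor R N N) = tensor R M (tensor R M M)"
    unfolding tens by (rule tensor_transfer(1)) (simp_all add: eq)
  have p1: "pure_tensor R N (tensor R N N) = pure_tensor R M (tensor R M M)"
    unfolding tens by (rule tensor_transfer(2)) (simp_all add: eq)
  have t2: "tensor R (tensor R N N) N = tensor R (tensor R M M) M"
    unfolding tens by (rule tensor_transfer(1)) (simp_all add: eq)
  have p2: "pure_tensor R (tensor R N N) N = pure_tensor R (tensor R M M) M"
    unfolding tens by (rule tensor_transfer(2)) (simp_all add: eq)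
  have a: "tensor_assoc R N N N = tensor_assoc R M M M"
    unfolding tensor_assoc_def Let_def t1 p1 tensor_transfer(2)[OF eq(1,2,4) eq(1,2,4)] ..
  have m1: "tensor_map R (tensor R N N) N = tensor_map R (tensor R M M) M"
    unfolding tensor_map_def t2 p2 ..
  have m2: "tensor_map R N (tensor R N N) = tensor_map R M (tensor R M M)"
    unfolding tensor_map_def t1 p1 ..
  show ?thesis
  proof (intro coalgebra.intro coalgebra_axioms.intro)
    show "module R N" by (rule module_transfer[OF M.module_axioms eq])
    show "\<Delta> \<in> mod_hom R N (tensor R N N)"
      using M.comult_hom unfolding tens by (simp add: mod_hom_def eq)
    show "\<epsilon> \<in> mod_hom R N (ring_module R)"
      using M.counit_hom by (simp add: mod_hom_def eq)
    fix c assume "c \<in> carrier N"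
    then have c: "c \<in> carrier M" by (simp add: eq)
    show "tensor_assoc R N N N (tensor_map R (tensor R N N) N \<Delta> id (\<Delta> c)) =
        tensor_map R N (tensor R N N) id \<Delta> (\<Delta> c)"
      unfolding a m1 m2 by (rule M.coassoc[OF c])
    show "tensor_lift R N (\<lambda>x y. \<epsilon> x \<odot>\<^bsub>N\<^esub> y) (\<Delta> c) = c"
      unfolding tensor_lift_transfer[OF eq] eq by (rule M.counit_left[OF c])
    show "tensor_lift R N (\<lambda>x y. \<epsilon> y \<odot>\<^bsub>N\<^esub> x) (\<Delta> c) = c"
      unfolding tensor_lift_transfer[OF eq] eq by (rule M.counit_right[OF c])
  qed
qed

section \<open>Bialgebra axioms as identities of Sweedler sums\<close>

context bialgebra
begin

lemma comult_ring_hom: "\<Delta> \<in> ring_hom B (tensor_algebra R B B)"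
  using comult_alg_hom by (simp add: alg_hom_def)

lemma bilinear_algebra_mult: "bilinear_on R B B B (\<lambda>x y. x \<otimes>\<^bsub>B\<^esub> y)"
  by (rule bilinear_onI[OF mult_left_hom mult_right_hom])

text \<open>The Sweedler form of multiplicativity of \<open>\<Delta>\<close>: summing
  \<open>\<beta>\<close> over \<open>\<Delta>(a b)\<close> gives
  \<open>\<Sum> \<beta>(a\<^sub>1 b\<^sub>1, a\<^sub>2 b\<^sub>2)\<close>. The product of
  \<open>tensor_algebra\<close> is a nested lift of pure tensors, through which the lift of
  \<open>\<beta>\<close> is pushed twice.\<close>

lemma tensor_lift_comult_mult:
  assumes P: "module R P" and \<beta>: "bilinear_on R B B P \<beta>" and a: "a \<in> carrier B" and b: "b \<in> carrier B"
  shows "tensor_lift R P \<beta> (\<Delta> (a \<otimes>\<^bsub>B\<^esub> b)) =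
    tensor_lift R P (\<lambda>x y. tensor_lift R P (\<lambda>u v. \<beta> (x \<otimes>\<^bsub>B\<^esub> u) (y \<otimes>\<^bsub>B\<^esub> v)) (\<Delta> b)) (\<Delta> a)"
proof -
  let ?BB = "tensor R B B"
  note B = module_axioms and BB = module_tensor[OF module_axioms module_axioms]
  note p = bilinear_pure_tensor[OF B B] and h = tensor_lift_hom[OF B B P \<beta>]
  have da: "\<Delta> a \<in> carrier ?BB" and db: "\<Delta> b \<in> carrier ?BB"
    using mod_hom_closed[OF comult_hom] a b by auto
  \<comment> \<open>The target is left general because the fact is used for
    \<open>pure_tensor\<close> as well as for \<open>\<beta>\<close>.\<close>
  have b1: "bilinear_on R B B Q (\<lambda>u v. \<gamma> (x \<otimes>\<^bsub>B\<^esub> u) (y \<otimes>\<^bsub>B\<^esub> v))"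
    if "bilinear_on R B B Q \<gamma>" "x \<in> carrier B" "y \<in> carrier B"
    for x y \<gamma> and Q :: "('a, 'q, 'z) module_scheme"
    by (rule bilinear_on_precomp[OF that(1) mult_left_hom[OF that(2)] mult_left_hom[OF that(3)]])
  have b2: "bilinear_on R B B Q (\<lambda>x y. \<gamma> (x \<otimes>\<^bsub>B\<^esub> u) (y \<otimes>\<^bsub>B\<^esub> v))"
    if "bilinear_on R B B Q \<gamma>" "u \<in> carrier B" "v \<in> carrier B"
    for u v \<gamma> and Q :: "('a, 'q, 'z) module_scheme"
    by (rule bilinear_on_precomp[OF that(1) mult_right_hom[OF that(2)] mult_right_hom[OF that(3)]])
  have "\<Delta> (a \<otimes>\<^bsub>B\<^esub> b) = \<Delta> a \<otimes>\<^bsub>tensor_algebra R B B\<^esub> \<Delta> b"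
    by (rule ring_hom_mult[OF comult_ring_hom a b])
  also have "\<dots> = tensor_lift R ?BB (\<lambda>x y. tensor_lift R ?BB
      (\<lambda>u v. pure_tensor R B B (x \<otimes>\<^bsub>B\<^esub> u) (y \<otimes>\<^bsub>B\<^esub> v)) (\<Delta> b)) (\<Delta> a)"
    by (simp add: tensor_algebra_def)
  finally have "tensor_lift R P \<beta> (\<Delta> (a \<otimes>\<^bsub>B\<^esub> b)) =
      tensor_lift R P (\<lambda>x y. tensor_lift R P \<beta> (tensor_lift R ?BB
        (\<lambda>u v. pure_tensor R B B (x \<otimes>\<^bsub>B\<^esub> u) (y \<otimes>\<^bsub>B\<^esub> v)) (\<Delta> b))) (\<Delta> a)"
    using tensor_lift_comp[OF B B BB P h tensor_lift_bilinear[OF B B B B BB db b1[OF p] b2[OF p]] da]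
    by simp
  also have "\<dots> = tensor_lift R P (\<lambda>x y. tensor_lift R P (\<lambda>u v. \<beta> (x \<otimes>\<^bsub>B\<^esub> u) (y \<otimes>\<^bsub>B\<^esub> v)) (\<Delta> b)) (\<Delta> a)"
  proof (rule tensor_lift_cong[OF B B P tensor_lift_bilinear[OF B B B B P db b1[OF \<beta>] b2[OF \<beta>]] da])
    fix x y assume xy: "x \<in> carrier B" "y \<in> carrier B"
    have "tensor_lift R P \<beta> (tensor_lift R ?BB
        (\<lambda>u v. pure_tensor R B B (x \<otimes>\<^bsub>B\<^esub> u) (y \<otimes>\<^bsub>B\<^esub> v)) (\<Delta> b)) =
      tensor_lift R P (\<lambda>u v. tensor_lift R P \<beta> (pure_tensor R B B (x \<otimes>\<^bsub>B\<^esub> u) (y \<otimes>\<^bsub>B\<^esub> v))) (\<Delta> b)"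
      by (rule tensor_lift_comp[OF B B BB P h b1[OF p xy] db])
    also have "\<dots> = tensor_lift R P (\<lambda>u v. \<beta> (x \<otimes>\<^bsub>B\<^esub> u) (y \<otimes>\<^bsub>B\<^esub> v)) (\<Delta> b)"
      by (rule tensor_lift_cong[OF B B P b1[OF \<beta> xy] db])
        (simp add: tensor_lift_pure[OF B B P \<beta>] xy)
    finally show "tensor_lift R P \<beta> (tensor_lift R ?BB
        (\<lambda>u v. pure_tensor R B B (x \<otimes>\<^bsub>B\<^esub> u) (y \<otimes>\<^bsub>B\<^esub> v)) (\<Delta> b)) =
      tensor_lift R P (\<lambda>u v. \<beta> (x \<otimes>\<^bsub>B\<^esub> u) (y \<otimes>\<^bsub>B\<^esub> v)) (\<Delta> b)" .
  qed
  finally show ?thesis .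
qed

lemma tensor_lift_comult_one:
  assumes P: "module R P" and \<beta>: "bilinear_on R B B P \<beta>"
  shows "tensor_lift R P \<beta> (\<Delta> \<one>\<^bsub>B\<^esub>) = \<beta> \<one>\<^bsub>B\<^esub> \<one>\<^bsub>B\<^esub>"
proof -
  have "\<Delta> \<one>\<^bsub>B\<^esub> = \<one>\<^bsub>tensor_algebra R B B\<^esub>"
    by (rule ring_hom_one[OF comult_ring_hom])
  then have "\<Delta> \<one>\<^bsub>B\<^esub> = pure_tensor R B B \<one>\<^bsub>B\<^esub> \<one>\<^bsub>B\<^esub>"
    by (simp add: tensor_algebra_def)
  then show ?thesis
    by (simp add: tensor_lift_pure[OF module_axioms module_axioms P \<beta>])
qed

lemma counit_mult: "a \<in> carrier B \<Longrightarrow> b \<in> carrier B \<Longrightarrow> \<epsilon> (a \<otimes>\<^bsub>B\<^esub> b) = \<epsilon> a \<otimes> \<epsilon> b"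
  using counit_alg_hom by (simp add: alg_hom_def ring_hom_def)

lemma counit_one: "\<epsilon> \<one>\<^bsub>B\<^esub> = \<one>"
  using counit_alg_hom by (simp add: alg_hom_def ring_hom_def)

lemma counit_closed: "a \<in> carrier B \<Longrightarrow> \<epsilon> a \<in> carrier R"
  using mod_hom_closed[OF counit_hom] by simp

end

section \<open>The convolution product on \<open>A\<^sup>*\<close> and on
  \<open>A\<^sup>\<circ>\<close>\<close>

locale property_P_bialgebra = property_P_algebra R A + bialgebra R A \<Delta> \<epsilon>
  for R (structure) and A (structure) and \<Delta> and \<epsilon>
begin

abbreviation "B \<equiv> finite_dual_algebra R A \<Delta> \<epsilon>"

lemma B_simps:
  "carrier B = finite_dual R A" "add B = add D" "zero B = zero D" "smult B = smult D"
  "mult B = (\<lambda>f g. \<lambda>c\<in>carrier A. tensor_lift R K (\<lambda>x y. f x \<otimes> g y) (\<Delta> c))"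
  "one B = restrict \<epsilon> (carrier A)"
  by (simp_all add: finite_dual_algebra_def convolution_algebra_def)

lemma comult_A_closed: "a \<in> carrier A \<Longrightarrow> \<Delta> a \<in> carrier (tensor R A A)"
  by (rule mod_hom_closed[OF comult_hom])

lemma conv_bilinear: "f \<in> carrier D \<Longrightarrow> g \<in> carrier D \<Longrightarrow> bilinear_on R A A K (\<lambda>x y. f x \<otimes> g y)"
  by (rule bilinear_mult[OF D_hom D_hom])

lemma conv_hom:
  "f \<in> carrier D \<Longrightarrow> g \<in> carrier D \<Longrightarrow>
    (\<lambda>c. tensor_lift R K (\<lambda>x y. f x \<otimes> g y) (\<Delta> c)) \<in> mod_hom R A K"
  by (rule comult_lift_hom[OF module_axioms comult_hom module_K conv_bilinear])

lemma conv_closed_D: "f \<in> carrier D \<Longrightarrow> g \<in> carrier D \<Longrightarrow> f \<otimes>\<^bsub>B\<^esub> g \<in> carrier D"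
  unfolding B_simps by (rule D_restrict[OF conv_hom])

lemma conv_apply: "c \<in> carrier A \<Longrightarrow> (f \<otimes>\<^bsub>B\<^esub> g) c = tensor_lift R K (\<lambda>x y. f x \<otimes> g y) (\<Delta> c)"
  by (simp add: B_simps)

text \<open>Proved on all of \<open>A\<^sup>*\<close>, where products visibly stay. The closure of
  \<open>A\<^sup>\<circ>\<close> under products is itself deduced with the help of this
  bilinearity.\<close>

lemma conv_bilinear_D: "bilinear_on R D D D (\<lambda>f g. f \<otimes>\<^bsub>B\<^esub> g)"
proof (rule bilinear_onI)
  fix f assume f: "f \<in> carrier D"
  show "(\<lambda>g. f \<otimes>\<^bsub>B\<^esub> g) \<in> mod_hom R D D"
    unfolding B_simps dual_module_def[of R A]
  proof (rule mod_hom_into_hom_module[OF module_axioms module_K module_D[unfolded dual_module_def]],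
      fold dual_module_def)
    show "(\<lambda>c. tensor_lift R K (\<lambda>x y. f x \<otimes> g y) (\<Delta> c)) \<in> mod_hom R A K" if "g \<in> carrier D" for g
      by (rule conv_hom[OF f that])
    show "(\<lambda>g. tensor_lift R K (\<lambda>x y. f x \<otimes> g y) (\<Delta> c)) \<in> mod_hom R D K" if c: "c \<in> carrier A" for c
      by (rule tensor_lift_param_hom[OF module_axioms module_axioms module_K module_D comult_A_closed[OF c]
            conv_bilinear[OF f]])
        (simp_all add: mod_hom_mult_left[OF D_eval] D_closed f)
  qed
next
  fix g assume g: "g \<in> carrier D"
  show "(\<lambda>f. f \<otimes>\<^bsub>B\<^esub> g) \<in> mod_hom R D D"
    unfolding B_simps dual_module_def[of R A]
  proof (rule mod_hom_into_hom_module[OF module_axioms module_K module_D[unfolded dual_module_def]],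
      fold dual_module_def)
    show "(\<lambda>c. tensor_lift R K (\<lambda>x y. f x \<otimes> g y) (\<Delta> c)) \<in> mod_hom R A K" if "f \<in> carrier D" for f
      by (rule conv_hom[OF that g])
    show "(\<lambda>f. tensor_lift R K (\<lambda>x y. f x \<otimes> g y) (\<Delta> c)) \<in> mod_hom R D K" if c: "c \<in> carrier A" for c
      by (rule tensor_lift_param_hom[OF module_axioms module_axioms module_K module_D comult_A_closed[OF c]
            conv_bilinear[OF _ g]])
        (simp_all add: mod_hom_mult_right[OF D_eval] D_closed g)
  qed
qed

text \<open>Here the tensor is fixed and the point of \<open>A\<close> varies. This allows values of
  tensors to serve as integrands in sums over \<open>\<Delta> a\<close> and
  \<open>\<Delta> b\<close>.\<close>

lemma ev_left_hom: "s \<in> carrier CC \<Longrightarrow> u \<in> carrier A \<Longrightarrow> (\<lambda>x. ev x u s) \<in> mod_hom R A K"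
  by (rule tensor_lift_param_hom[OF module_C module_C module_K module_axioms _ ev_bilinear_C])
    (simp_all add: mod_hom_mult_right[OF D_hom[OF finite_dual_D]] C_closed)

lemma ev_right_hom: "s \<in> carrier CC \<Longrightarrow> x \<in> carrier A \<Longrightarrow> (\<lambda>u. ev x u s) \<in> mod_hom R A K"
  by (rule tensor_lift_param_hom[OF module_C module_C module_K module_axioms _ ev_bilinear_C])
    (simp_all add: mod_hom_mult_left[OF D_hom[OF finite_dual_D]] C_closed)

lemma ev_closed: "s \<in> carrier CC \<Longrightarrow> x \<in> carrier A \<Longrightarrow> u \<in> carrier A \<Longrightarrow> ev x u s \<in> carrier R"
  using mod_hom_closed[OF ev_hom_C] by simp

lemma incl_CD: "(\<lambda>f. f) \<in> mod_hom R C D"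
  by (rule mod_homI) (simp_all add: finite_dual_D)

lemma mod_hom_into_C: "h \<in> mod_hom R X D \<Longrightarrow> h ` carrier X \<subseteq> finite_dual R A \<Longrightarrow> h \<in> mod_hom R X C"
  by (auto simp: mod_hom_def)

lemma conv_eval_left_hom:
  assumes "g \<in> finite_dual R A" "a \<in> carrier A"
  shows "(\<lambda>f. (f \<otimes>\<^bsub>B\<^esub> g) a) \<in> mod_hom R C K"
proof (rule mod_hom_comp[OF D_eval[OF assms(2)]])
  show "(\<lambda>f. f \<otimes>\<^bsub>B\<^esub> g) \<in> mod_hom R C D"
    by (rule mod_hom_comp[OF bilinear_on_left[OF conv_bilinear_D finite_dual_D[OF assms(1)]] incl_CD])
qed

lemma conv_eval_right_hom:
  assumes "f \<in> finite_dual R A" "a \<in> carrier A"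
  shows "(\<lambda>g. (f \<otimes>\<^bsub>B\<^esub> g) a) \<in> mod_hom R C K"
proof (rule mod_hom_comp[OF D_eval[OF assms(2)]])
  show "(\<lambda>g. f \<otimes>\<^bsub>B\<^esub> g) \<in> mod_hom R C D"
    by (rule mod_hom_comp[OF bilinear_on_right[OF conv_bilinear_D finite_dual_D[OF assms(1)]] incl_CD])
qed

text \<open>Both sides are \<open>\<Sum> f\<^sub>1(a\<^sub>1) f\<^sub>2(b\<^sub>1) g\<^sub>1(a\<^sub>2) g\<^sub>2(b\<^sub>2)\<close> for \<open>s = \<Sum> f\<^sub>1 \<otimes> f\<^sub>2\<close>, \<open>t = \<Sum> g\<^sub>1 \<otimes> g\<^sub>2\<close>.\<close>

lemma conv_interchange:
  assumes s: "s \<in> carrier CC" and t: "t \<in> carrier CC" and a: "a \<in> carrier A" and b: "b \<in> carrier A"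
  shows "tensor_lift R K (\<lambda>x y. tensor_lift R K (\<lambda>u v. ev x u s \<otimes> ev y v t) (\<Delta> b)) (\<Delta> a) =
    tensor_lift R K (\<lambda>f f'. tensor_lift R K (\<lambda>g g'. (f \<otimes>\<^bsub>B\<^esub> g) a \<otimes> (f' \<otimes>\<^bsub>B\<^esub> g') b) t) s"
proof -
  note A = module_axioms and CK = module_C module_C module_K
  note da = comult_A_closed[OF a] and db = comult_A_closed[OF b]
  \<comment> \<open>The left side is viewed as a function of both tensors, linear in each. It can
    then be compared with the right side on pure tensors, in one argument after the other.\<close>
  define \<Phi> where "\<Phi> s t = tensor_lift R K (\<lambda>x y. tensor_lift R K (\<lambda>u v. ev x u s \<otimes> ev y v t) (\<Delta> b)) (\<Delta> a)" for s t
  have q1: "bilinear_on R A A K (\<lambda>u v. ev x u s \<otimes> ev y v t)"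
    if "s \<in> carrier CC" "t \<in> carrier CC" "x \<in> carrier A" "y \<in> carrier A" for s t x y
    by (rule bilinear_mult[OF ev_right_hom[OF that(1,3)] ev_right_hom[OF that(2,4)]])
  have q2: "bilinear_on R A A K (\<lambda>x y. ev x u s \<otimes> ev y v t)"
    if "s \<in> carrier CC" "t \<in> carrier CC" "u \<in> carrier A" "v \<in> carrier A" for s t u v
    by (rule bilinear_mult[OF ev_left_hom[OF that(1,3)] ev_left_hom[OF that(2,4)]])
  have q: "bilinear_on R A A K (\<lambda>x y. tensor_lift R K (\<lambda>u v. ev x u s \<otimes> ev y v t) (\<Delta> b))"
    if "s \<in> carrier CC" "t \<in> carrier CC" for s t
    by (rule tensor_lift_bilinear[OF A A A A module_K db q1[OF that] q2[OF that]])
  have \<Phi>_left: "(\<lambda>s. \<Phi> s t) \<in> mod_hom R CC K" if t: "t \<in> carrier CC" for t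
    unfolding \<Phi>_def
  proof (rule tensor_lift_param_hom[OF A A module_K module_CC da q[OF _ t]])
    fix x y assume xy: "x \<in> carrier A" "y \<in> carrier A"
    show "(\<lambda>s. tensor_lift R K (\<lambda>u v. ev x u s \<otimes> ev y v t) (\<Delta> b)) \<in> mod_hom R CC K"
      by (rule tensor_lift_param_hom[OF A A module_K module_CC db q1[OF _ t xy]])
        (simp_all add: mod_hom_mult_right[OF ev_hom_C] ev_closed t xy)
  qed
  have \<Phi>_right: "(\<lambda>t. \<Phi> s t) \<in> mod_hom R CC K" if s: "s \<in> carrier CC" for s
    unfolding \<Phi>_def
  proof (rule tensor_lift_param_hom[OF A A module_K module_CC da q[OF s]])
    fix x y assume xy: "x \<in> carrier A" "y \<in> carrier A"
    show "(\<lambda>t. tensor_lift R K (\<lambda>u v. ev x u s \<otimes> ev y v t) (\<Delta> b)) \<in> mod_hom R CC K"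
      by (rule tensor_lift_param_hom[OF A A module_K module_CC db q1[OF s _ xy]])
        (simp_all add: mod_hom_mult_left[OF ev_hom_C] ev_closed s xy)
  qed
  have \<Phi>_pure: "\<Phi> (pure_tensor R C C f f') (pure_tensor R C C g g') = (f \<otimes>\<^bsub>B\<^esub> g) a \<otimes> (f' \<otimes>\<^bsub>B\<^esub> g') b"
    if f: "f \<in> carrier C" "f' \<in> carrier C" and g: "g \<in> carrier C" "g' \<in> carrier C" for f f' g g'
  proof -
    have D: "f \<in> carrier D" "f' \<in> carrier D" "g \<in> carrier D" "g' \<in> carrier D"
      using f g by (simp_all add: finite_dual_D)
    have fb: "(f' \<otimes>\<^bsub>B\<^esub> g') b \<in> carrier R"
      by (rule D_closed[OF conv_closed_D[OF D(2,4)] b])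
    have "\<Phi> (pure_tensor R C C f f') (pure_tensor R C C g g') =
        tensor_lift R K (\<lambda>x y. (f x \<otimes> g y) \<otimes> (f' \<otimes>\<^bsub>B\<^esub> g') b) (\<Delta> a)"
      unfolding \<Phi>_def
    proof (rule tensor_lift_cong[OF A A module_K
          bilinear_on_comp[OF mod_hom_mult_right[OF mod_hom_id fb] conv_bilinear[OF D(1,3)]] da])
      fix x y assume xy: "x \<in> carrier A" "y \<in> carrier A"
      have r: "f x \<otimes> g y \<in> carrier R"
        using D_closed[OF D(1) xy(1)] D_closed[OF D(3) xy(2)] by simp
      have "tensor_lift R K (\<lambda>u v. ev x u (pure_tensor R C C f f') \<otimes> ev y v (pure_tensor R C C g g')) (\<Delta> b) =
          tensor_lift R K (\<lambda>u v. (f x \<otimes> g y) \<otimes> (f' u \<otimes> g' v)) (\<Delta> b)"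
      proof (rule tensor_lift_cong[OF A A module_K
            bilinear_on_comp[OF mod_hom_mult_left[OF mod_hom_id r] conv_bilinear[OF D(2,4)]] db])
        fix u v assume "u \<in> carrier A" "v \<in> carrier A"
        then show "ev x u (pure_tensor R C C f f') \<otimes> ev y v (pure_tensor R C C g g') =
            (f x \<otimes> g y) \<otimes> (f' u \<otimes> g' v)"
          using xy f g D by (simp add: ev_pure_C D_closed R.m_ac)
      qed
      also have "\<dots> = (f x \<otimes> g y) \<otimes> (f' \<otimes>\<^bsub>B\<^esub> g') b"
        using tensor_lift_comp[OF A A module_K module_K mod_hom_mult_left[OF mod_hom_id r]
            conv_bilinear[OF D(2,4)] db] by (simp add: conv_apply[OF b])
      finally show "tensor_lift R K (\<lambda>u v. ev x u (pure_tensor R C C f f') \<otimes> ev y v (pure_tensor R C C g g')) (\<Delta> b) =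
          (f x \<otimes> g y) \<otimes> (f' \<otimes>\<^bsub>B\<^esub> g') b" .
    qed
    also have "\<dots> = (f \<otimes>\<^bsub>B\<^esub> g) a \<otimes> (f' \<otimes>\<^bsub>B\<^esub> g') b"
      using tensor_lift_comp[OF A A module_K module_K mod_hom_mult_right[OF mod_hom_id fb]
          conv_bilinear[OF D(1,3)] da] by (simp add: conv_apply[OF a])
    finally show ?thesis .
  qed
  have r1: "bilinear_on R C C K (\<lambda>g g'. (f \<otimes>\<^bsub>B\<^esub> g) a \<otimes> (f' \<otimes>\<^bsub>B\<^esub> g') b)"
    if "f \<in> carrier C" "f' \<in> carrier C" for f f'
    using that a b by (intro bilinear_mult conv_eval_right_hom) simp_all
  have r2: "bilinear_on R C C K (\<lambda>f f'. (f \<otimes>\<^bsub>B\<^esub> g) a \<otimes> (f' \<otimes>\<^bsub>B\<^esub> g') b)"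
    if "g \<in> carrier C" "g' \<in> carrier C" for g g'
    using that a b by (intro bilinear_mult conv_eval_left_hom) simp_all
  note r = tensor_lift_bilinear[OF module_C module_C module_C module_C module_K t r1 r2]
  have "\<Phi> s t = tensor_lift R K (\<lambda>f f'. tensor_lift R K (\<lambda>g g'. (f \<otimes>\<^bsub>B\<^esub> g) a \<otimes> (f' \<otimes>\<^bsub>B\<^esub> g') b) t) s"
  proof (rule tensor_hom_eq[OF module_C module_C \<Phi>_left[OF t] tensor_lift_hom[OF CK r] s])
    fix f f' assume f: "f \<in> carrier C" "f' \<in> carrier C"
    have "\<Phi> (pure_tensor R C C f f') t = tensor_lift R K (\<lambda>g g'. (f \<otimes>\<^bsub>B\<^esub> g) a \<otimes> (f' \<otimes>\<^bsub>B\<^esub> g') b) t"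
      by (rule tensor_hom_eq[OF module_C module_C \<Phi>_right[OF pure_tensor_closed[OF module_C module_C f]]
            tensor_lift_hom[OF CK r1[OF f]] t])
        (simp only: \<Phi>_pure[OF f] tensor_lift_pure[OF CK r1[OF f]])
    then show "\<Phi> (pure_tensor R C C f f') t = tensor_lift R K (\<lambda>f f'. tensor_lift R K
        (\<lambda>g g'. (f \<otimes>\<^bsub>B\<^esub> g) a \<otimes> (f' \<otimes>\<^bsub>B\<^esub> g') b) t) (pure_tensor R C C f f')"
      by (simp only: tensor_lift_pure[OF CK r f])
  qed
  then show ?thesis unfolding \<Phi>_def .
qed

text \<open>Multiplicativity of \<open>\<Delta>\<close> gives \<open>(f * g)(a b) = \<Sum>
  f(a\<^sub>1 b\<^sub>1) g(a\<^sub>2 b\<^sub>2)\<close>. Each factor is a value of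
  \<open>comult f\<close> or \<open>comult g\<close>, and the interchange regroups the four sums by
  functionals instead of by elements.\<close>

lemma conv_mult_apply:
  assumes f: "f \<in> finite_dual R A" and g: "g \<in> finite_dual R A" and a: "a \<in> carrier A" and b: "b \<in> carrier A"
  shows "(f \<otimes>\<^bsub>B\<^esub> g) (a \<otimes>\<^bsub>A\<^esub> b) = tensor_lift R K (\<lambda>f f'. tensor_lift R K
    (\<lambda>g g'. (f \<otimes>\<^bsub>B\<^esub> g) a \<otimes> (f' \<otimes>\<^bsub>B\<^esub> g') b) (comult g)) (comult f)"
proof -
  note A = module_axioms
  note fD = finite_dual_D[OF f] and gD = finite_dual_D[OF g]
  note da = comult_A_closed[OF a] and db = comult_A_closed[OF b]
  note cf = comult_closed[OF f] and cg = comult_closed[OF g]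
  have q1: "bilinear_on R A A K (\<lambda>u v. ev x u (comult f) \<otimes> ev y v (comult g))"
    if "x \<in> carrier A" "y \<in> carrier A" for x y
    by (rule bilinear_mult[OF ev_right_hom[OF cf that(1)] ev_right_hom[OF cg that(2)]])
  have q2: "bilinear_on R A A K (\<lambda>x y. ev x u (comult f) \<otimes> ev y v (comult g))"
    if "u \<in> carrier A" "v \<in> carrier A" for u v
    by (rule bilinear_mult[OF ev_left_hom[OF cf that(1)] ev_left_hom[OF cg that(2)]])
  have "(f \<otimes>\<^bsub>B\<^esub> g) (a \<otimes>\<^bsub>A\<^esub> b) = tensor_lift R K (\<lambda>x y. tensor_lift R K
      (\<lambda>u v. f (x \<otimes>\<^bsub>A\<^esub> u) \<otimes> g (y \<otimes>\<^bsub>A\<^esub> v)) (\<Delta> b)) (\<Delta> a)"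
    using a b by (simp add: conv_apply tensor_lift_comult_mult[OF module_K conv_bilinear[OF fD gD]])
  also have "\<dots> = tensor_lift R K (\<lambda>x y. tensor_lift R K
      (\<lambda>u v. ev x u (comult f) \<otimes> ev y v (comult g)) (\<Delta> b)) (\<Delta> a)"
  proof (rule tensor_lift_cong[OF A A module_K tensor_lift_bilinear[OF A A A A module_K db q1 q2] da])
    fix x y assume xy: "x \<in> carrier A" "y \<in> carrier A"
    show "tensor_lift R K (\<lambda>u v. f (x \<otimes>\<^bsub>A\<^esub> u) \<otimes> g (y \<otimes>\<^bsub>A\<^esub> v)) (\<Delta> b) =
        tensor_lift R K (\<lambda>u v. ev x u (comult f) \<otimes> ev y v (comult g)) (\<Delta> b)"
      by (rule tensor_lift_cong[OF A A module_K q1[OF xy] db]) (simp add: ev_comult f g xy)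
  qed
  also have "\<dots> = tensor_lift R K (\<lambda>f f'. tensor_lift R K
      (\<lambda>g g'. (f \<otimes>\<^bsub>B\<^esub> g) a \<otimes> (f' \<otimes>\<^bsub>B\<^esub> g') b) (comult g)) (comult f)"
    by (rule conv_interchange[OF cf cg a b])
  finally show ?thesis .
qed

text \<open>Applied to \<open>X = A\<^sup>*\<close> to see that \<open>A\<^sup>\<circ>\<close> is closed under products, and then to \<open>X = A\<^sup>\<circ>\<close>.\<close>

lemma conv_tensor_product:
  fixes X :: "('a, 'c \<Rightarrow> 'a) module"
  assumes X: "module R X" and X_eval: "\<And>a. a \<in> carrier A \<Longrightarrow> (\<lambda>f. f a) \<in> mod_hom R X K"
    and conv: "bilinear_on R C C X (\<lambda>f g. f \<otimes>\<^bsub>B\<^esub> g)"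
    and f: "f \<in> finite_dual R A" and g: "g \<in> finite_dual R A"
  defines "t \<equiv> tensor_lift R (tensor R X X) (\<lambda>f f'. tensor_lift R (tensor R X X)
    (\<lambda>g g'. pure_tensor R X X (f \<otimes>\<^bsub>B\<^esub> g) (f' \<otimes>\<^bsub>B\<^esub> g')) (comult g)) (comult f)"
  shows "t \<in> carrier (tensor R X X)"
    and "a \<in> carrier A \<Longrightarrow> b \<in> carrier A \<Longrightarrow> ev a b t = (f \<otimes>\<^bsub>B\<^esub> g) (a \<otimes>\<^bsub>A\<^esub> b)"
proof -
  let ?XX = "tensor R X X"
  note XX = module_tensor[OF X X] and C = module_C
  note cf = comult_closed[OF f] and cg = comult_closed[OF g]
  have r1: "bilinear_on R C C ?XX (\<lambda>g g'. pure_tensor R X X (f \<otimes>\<^bsub>B\<^esub> g) (f' \<otimes>\<^bsub>B\<^esub> g'))"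
    if "f \<in> carrier C" "f' \<in> carrier C" for f f'
    by (rule bilinear_pure_precomp[OF X X bilinear_on_right[OF conv that(1)] bilinear_on_right[OF conv that(2)]])
  have r2: "bilinear_on R C C ?XX (\<lambda>f f'. pure_tensor R X X (f \<otimes>\<^bsub>B\<^esub> g) (f' \<otimes>\<^bsub>B\<^esub> g'))"
    if "g \<in> carrier C" "g' \<in> carrier C" for g g'
    by (rule bilinear_pure_precomp[OF X X bilinear_on_left[OF conv that(1)] bilinear_on_left[OF conv that(2)]])
  note r = tensor_lift_bilinear[OF C C C C XX cg r1 r2]
  show "t \<in> carrier ?XX"
    unfolding t_def by (rule mod_hom_closed[OF tensor_lift_hom[OF C C XX r] cf])
  assume a: "a \<in> carrier A" and b: "b \<in> carrier A"
  note e = ev_bilinear[OF X_eval[OF a] X_eval[OF b]]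
  note h = tensor_lift_hom[OF X X module_K e]
  have k1: "bilinear_on R C C K (\<lambda>g g'. (f \<otimes>\<^bsub>B\<^esub> g) a \<otimes> (f' \<otimes>\<^bsub>B\<^esub> g') b)"
    if "f \<in> carrier C" "f' \<in> carrier C" for f f'
    using that a b by (intro bilinear_mult conv_eval_right_hom) simp_all
  have k2: "bilinear_on R C C K (\<lambda>f f'. (f \<otimes>\<^bsub>B\<^esub> g) a \<otimes> (f' \<otimes>\<^bsub>B\<^esub> g') b)"
    if "g \<in> carrier C" "g' \<in> carrier C" for g g'
    using that a b by (intro bilinear_mult conv_eval_left_hom) simp_all
  \<comment> \<open>\<open>t\<close> is the factorwise product of \<open>comult f\<close> and
    \<open>comult g\<close>. Evaluation passes through both lifts and leaves products of
    convolutions.\<close>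
  have "ev a b t = tensor_lift R K (\<lambda>f f'. ev a b (tensor_lift R ?XX
      (\<lambda>g g'. pure_tensor R X X (f \<otimes>\<^bsub>B\<^esub> g) (f' \<otimes>\<^bsub>B\<^esub> g')) (comult g))) (comult f)"
    unfolding t_def by (rule tensor_lift_comp[OF C C XX module_K h r cf])
  also have "\<dots> = tensor_lift R K (\<lambda>f f'. tensor_lift R K
      (\<lambda>g g'. (f \<otimes>\<^bsub>B\<^esub> g) a \<otimes> (f' \<otimes>\<^bsub>B\<^esub> g') b) (comult g)) (comult f)"
  proof (rule tensor_lift_cong[OF C C module_K tensor_lift_bilinear[OF C C C C module_K cg k1 k2] cf])
    fix f f' assume ff: "f \<in> carrier C" "f' \<in> carrier C"
    have "ev a b (tensor_lift R ?XX (\<lambda>g g'. pure_tensor R X X (f \<otimes>\<^bsub>B\<^esub> g) (f' \<otimes>\<^bsub>B\<^esub> g')) (comult g)) =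
        tensor_lift R K (\<lambda>g g'. ev a b (pure_tensor R X X (f \<otimes>\<^bsub>B\<^esub> g) (f' \<otimes>\<^bsub>B\<^esub> g'))) (comult g)"
      by (rule tensor_lift_comp[OF C C XX module_K h r1[OF ff] cg])
    also have "\<dots> = tensor_lift R K (\<lambda>g g'. (f \<otimes>\<^bsub>B\<^esub> g) a \<otimes> (f' \<otimes>\<^bsub>B\<^esub> g') b) (comult g)"
      by (rule tensor_lift_cong[OF C C module_K k1[OF ff] cg], rule tensor_lift_pure[OF X X module_K e])
        (rule bilinear_on_closed[OF conv ff(1)] bilinear_on_closed[OF conv ff(2)], assumption)+
    finally show "ev a b (tensor_lift R ?XX
        (\<lambda>g g'. pure_tensor R X X (f \<otimes>\<^bsub>B\<^esub> g) (f' \<otimes>\<^bsub>B\<^esub> g')) (comult g)) =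
      tensor_lift R K (\<lambda>g g'. (f \<otimes>\<^bsub>B\<^esub> g) a \<otimes> (f' \<otimes>\<^bsub>B\<^esub> g') b) (comult g)" .
  qed
  also have "\<dots> = (f \<otimes>\<^bsub>B\<^esub> g) (a \<otimes>\<^bsub>A\<^esub> b)"
    by (rule conv_mult_apply[OF f g a b, symmetric])
  finally show "ev a b t = (f \<otimes>\<^bsub>B\<^esub> g) (a \<otimes>\<^bsub>A\<^esub> b)" .
qed

lemma conv_closed:
  assumes f: "f \<in> finite_dual R A" and g: "g \<in> finite_dual R A"
  shows "f \<otimes>\<^bsub>B\<^esub> g \<in> finite_dual R A"
proof -
  note b = bilinear_on_precomp[OF conv_bilinear_D incl_CD incl_CD]
  note t = conv_tensor_product[OF module_D D_eval b f g]
  show ?thesis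
    by (rule finite_dualI[OF conv_closed_D[OF finite_dual_D[OF f] finite_dual_D[OF g]] t(1) t(2)[symmetric]])
qed

lemma conv_bilinear_C: "bilinear_on R C C C (\<lambda>f g. f \<otimes>\<^bsub>B\<^esub> g)"
proof -
  note b = bilinear_on_precomp[OF conv_bilinear_D incl_CD incl_CD]
  show ?thesis
    by (intro bilinear_onI mod_hom_into_C bilinear_on_right[OF b] bilinear_on_left[OF b])
      (auto intro: conv_closed)
qed

text \<open>The unit is the counit of \<open>A\<close>, and
  \<open>\<epsilon>(a b) = \<epsilon>(a) \<epsilon>(b)\<close> makes
  \<open>\<epsilon> \<otimes> \<epsilon>\<close> the required tensor.\<close>

lemma one_closed_B: "\<one>\<^bsub>B\<^esub> \<in> finite_dual R A"
proof (rule finite_dualI)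
  show D: "\<one>\<^bsub>B\<^esub> \<in> carrier D"
    unfolding B_simps by (rule D_restrict[OF counit_hom])
  show "pure_tensor R D D \<one>\<^bsub>B\<^esub> \<one>\<^bsub>B\<^esub> \<in> carrier (tensor R D D)"
    by (rule pure_tensor_closed[OF module_D module_D D D])
  show "\<one>\<^bsub>B\<^esub> (a \<otimes>\<^bsub>A\<^esub> b) = ev a b (pure_tensor R D D \<one>\<^bsub>B\<^esub> \<one>\<^bsub>B\<^esub>)"
    if "a \<in> carrier A" "b \<in> carrier A" for a b
    unfolding ev_pure_D[OF that D D] using that by (simp add: B_simps counit_mult)
qed

text \<open>Coassociativity of \<open>\<Delta>\<close>, tested against the trilinear map
  \<open>(x, y, z) \<mapsto> f(x) g(y) h(z)\<close>.\<close>

lemma conv_assoc: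
  assumes f: "f \<in> carrier D" and g: "g \<in> carrier D" and h: "h \<in> carrier D"
  shows "(f \<otimes>\<^bsub>B\<^esub> g) \<otimes>\<^bsub>B\<^esub> h = f \<otimes>\<^bsub>B\<^esub> (g \<otimes>\<^bsub>B\<^esub> h)"
proof (rule D_eqI[OF conv_closed_D[OF conv_closed_D[OF f g] h] conv_closed_D[OF f conv_closed_D[OF g h]]])
  fix c assume c: "c \<in> carrier A"
  note A = module_axioms and dc = comult_A_closed[OF c]
  note tri = trilinear_mult[OF D_hom[OF f] D_hom[OF g] D_hom[OF h]]
  have "((f \<otimes>\<^bsub>B\<^esub> g) \<otimes>\<^bsub>B\<^esub> h) c = tensor_lift R K (\<lambda>x z. (f \<otimes>\<^bsub>B\<^esub> g) x \<otimes> h z) (\<Delta> c)"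
    by (rule conv_apply[OF c])
  also have "\<dots> = tensor_lift R K (\<lambda>x z. tensor_lift R K (\<lambda>u v. f u \<otimes> (g v \<otimes> h z)) (\<Delta> x)) (\<Delta> c)"
  proof (rule tensor_lift_cong[OF A A module_K comult_lift_bilinear_left[OF A comult_hom module_K tri] dc])
    fix x z assume x: "x \<in> carrier A" and z: "z \<in> carrier A"
    have hz: "h z \<in> carrier R" by (rule D_closed[OF h z])
    have "(f \<otimes>\<^bsub>B\<^esub> g) x \<otimes> h z = tensor_lift R K (\<lambda>u v. (f u \<otimes> g v) \<otimes> h z) (\<Delta> x)"
      unfolding conv_apply[OF x]
      by (rule tensor_lift_comp[OF A A module_K module_K mod_hom_mult_right[OF mod_hom_id hz]
            conv_bilinear[OF f g] comult_A_closed[OF x]])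
    also have "\<dots> = tensor_lift R K (\<lambda>u v. f u \<otimes> (g v \<otimes> h z)) (\<Delta> x)"
      by (rule tensor_lift_cong[OF A A module_K trilinear_on_3[OF tri z] comult_A_closed[OF x]])
        (simp add: R.m_assoc D_closed f g hz)
    finally show "(f \<otimes>\<^bsub>B\<^esub> g) x \<otimes> h z = tensor_lift R K (\<lambda>u v. f u \<otimes> (g v \<otimes> h z)) (\<Delta> x)" .
  qed
  also have "\<dots> = tensor_lift R K (\<lambda>x y. tensor_lift R K (\<lambda>u v. f x \<otimes> (g u \<otimes> h v)) (\<Delta> y)) (\<Delta> c)"
    by (rule coassoc_lift[OF module_K tri c])
  also have "\<dots> = tensor_lift R K (\<lambda>x y. f x \<otimes> (g \<otimes>\<^bsub>B\<^esub> h) y) (\<Delta> c)"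
  proof (rule tensor_lift_cong[OF A A module_K conv_bilinear[OF f conv_closed_D[OF g h]] dc])
    fix x y assume x: "x \<in> carrier A" and y: "y \<in> carrier A"
    have fx: "f x \<in> carrier R" by (rule D_closed[OF f x])
    show "tensor_lift R K (\<lambda>u v. f x \<otimes> (g u \<otimes> h v)) (\<Delta> y) = f x \<otimes> (g \<otimes>\<^bsub>B\<^esub> h) y"
      unfolding conv_apply[OF y]
      by (rule tensor_lift_comp[OF A A module_K module_K mod_hom_mult_left[OF mod_hom_id fx]
            conv_bilinear[OF g h] comult_A_closed[OF y], symmetric])
  qed
  also have "\<dots> = (f \<otimes>\<^bsub>B\<^esub> (g \<otimes>\<^bsub>B\<^esub> h)) c"
    by (rule conv_apply[OF c, symmetric])
  finally show "((f \<otimes>\<^bsub>B\<^esub> g) \<otimes>\<^bsub>B\<^esub> h) c = (f \<otimes>\<^bsub>B\<^esub> (g \<otimes>\<^bsub>B\<^esub> h)) c" .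
qed

lemma conv_one:
  assumes f: "f \<in> carrier D"
  shows "\<one>\<^bsub>B\<^esub> \<otimes>\<^bsub>B\<^esub> f = f" "f \<otimes>\<^bsub>B\<^esub> \<one>\<^bsub>B\<^esub> = f"
proof -
  have one: "\<one>\<^bsub>B\<^esub> \<in> carrier D" by (rule finite_dual_D[OF one_closed_B])
  note A = module_axioms
  have b: "bilinear_on R A A K (\<lambda>x y. \<epsilon> x \<otimes> f y)" "bilinear_on R A A K (\<lambda>x y. \<epsilon> y \<otimes> f x)"
    using bilinear_mult[OF counit_hom D_hom[OF f]] bilinear_on_flip[OF bilinear_mult[OF counit_hom D_hom[OF f]]]
    by simp_all
  show "\<one>\<^bsub>B\<^esub> \<otimes>\<^bsub>B\<^esub> f = f"
  proof (rule D_eqI[OF conv_closed_D[OF one f] f])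
    fix c assume c: "c \<in> carrier A"
    have "(\<one>\<^bsub>B\<^esub> \<otimes>\<^bsub>B\<^esub> f) c = tensor_lift R K (\<lambda>x y. \<epsilon> x \<otimes> f y) (\<Delta> c)"
      unfolding conv_apply[OF c]
      by (rule tensor_lift_cong[OF A A module_K b(1) comult_A_closed[OF c]]) (simp add: B_simps)
    then show "(\<one>\<^bsub>B\<^esub> \<otimes>\<^bsub>B\<^esub> f) c = f c"
      using counit_left_lift[OF module_K D_hom[OF f] c] by simp
  qed
  show "f \<otimes>\<^bsub>B\<^esub> \<one>\<^bsub>B\<^esub> = f"
  proof (rule D_eqI[OF conv_closed_D[OF f one] f])
    fix c assume c: "c \<in> carrier A"
    have "(f \<otimes>\<^bsub>B\<^esub> \<one>\<^bsub>B\<^esub>) c = tensor_lift R K (\<lambda>x y. \<epsilon> y \<otimes> f x) (\<Delta> c)"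
      unfolding conv_apply[OF c]
      by (rule tensor_lift_cong[OF A A module_K b(2) comult_A_closed[OF c]])
        (simp add: B_simps R.m_comm counit_closed D_closed[OF f])
    then show "(f \<otimes>\<^bsub>B\<^esub> \<one>\<^bsub>B\<^esub>) c = f c"
      using counit_right_lift[OF module_K D_hom[OF f] c] by simp
  qed
qed

section \<open>The algebra and bialgebra axioms for \<open>A\<^sup>\<circ>\<close>\<close>

lemma module_B: "module R B"
  by (rule module_transfer[OF module_C]) (simp_all add: B_simps)

lemma assoc_algebra_B: "assoc_algebra R B"
proof -
  interpret B: module R B by (rule module_B)
  note right = bilinear_on_right[OF conv_bilinear_C] and left = bilinear_on_left[OF conv_bilinear_C]
  have "ring B"
  proof (rule ringI)
    show "abelian_group B" by (rule B.M.abelian_group_axioms)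
    show "monoid B"
      by (rule monoidI)
        (simp_all add: B_simps(1) conv_closed one_closed_B conv_one conv_assoc finite_dual_D)
    fix f g h assume "f \<in> carrier B" "g \<in> carrier B" "h \<in> carrier B"
    then have *: "f \<in> carrier C" "g \<in> carrier C" "h \<in> carrier C"
      by (simp_all add: B_simps(1))
    show "(f \<oplus>\<^bsub>B\<^esub> g) \<otimes>\<^bsub>B\<^esub> h = f \<otimes>\<^bsub>B\<^esub> h \<oplus>\<^bsub>B\<^esub> g \<otimes>\<^bsub>B\<^esub> h"
      using mod_hom_add[OF left[OF *(3)] *(1,2)] by (simp add: B_simps(2))
    show "h \<otimes>\<^bsub>B\<^esub> (f \<oplus>\<^bsub>B\<^esub> g) = h \<otimes>\<^bsub>B\<^esub> f \<oplus>\<^bsub>B\<^esub> h \<otimes>\<^bsub>B\<^esub> g"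
      using mod_hom_add[OF right[OF *(3)] *(1,2)] by (simp add: B_simps(2))
  qed
  moreover have "assoc_algebra_axioms R B"
  proof
    fix r f g assume r: "r \<in> carrier R" and "f \<in> carrier B" "g \<in> carrier B"
    then have *: "f \<in> carrier C" "g \<in> carrier C"
      by (simp_all add: B_simps(1))
    show "(r \<odot>\<^bsub>B\<^esub> f) \<otimes>\<^bsub>B\<^esub> g = r \<odot>\<^bsub>B\<^esub> (f \<otimes>\<^bsub>B\<^esub> g)"
      using mod_hom_smult[OF left[OF *(2)] r *(1)] by (simp add: B_simps(4))
    show "f \<otimes>\<^bsub>B\<^esub> (r \<odot>\<^bsub>B\<^esub> g) = r \<odot>\<^bsub>B\<^esub> (f \<otimes>\<^bsub>B\<^esub> g)"
      using mod_hom_smult[OF right[OF *(1)] r *(2)] by (simp add: B_simps(4))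
  qed
  ultimately show ?thesis
    by (intro assoc_algebra.intro module_B)
qed

lemma tensor_B: "tensor R B B = CC" "pure_tensor R B B = pure_tensor R C C"
  by (rule tensor_transfer; simp add: B_simps)+

text \<open>Compatibility of the structures is checked on values: multiplicativity of the new
  comultiplication comes from that of \<open>\<Delta>\<close>, its value at the unit from
  multiplicativity of \<open>\<epsilon>\<close>, and multiplicativity of the new counit from
  \<open>\<Delta>(1) = 1 \<otimes> 1\<close>.\<close>

lemma bialgebra_finite_dual: "bialgebra R B comult counit"
proof (intro bialgebra.intro bialgebra_axioms.intro assoc_algebra_B)
  show "coalgebra R B comult counit"
    by (rule coalgebra_transfer[OF coalgebra_finite_dual]) (simp_all add: B_simps)
  let ?T = "tensor_algebra R B B"
  have T: "carrier ?T = carrier CC" "add ?T = add CC" "smult ?T = smult CC"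
    by (simp_all add: tensor_algebra_def tensor_B)
  have CC: "comult \<in> mod_hom R B ?T"
    using finite_dual_comult_hom by (simp add: mod_hom_def T B_simps)
  have "comult \<in> ring_hom B ?T"
  proof (rule ring_hom_memI)
    fix f assume f: "f \<in> carrier B"
    show "comult f \<in> carrier ?T" by (rule mod_hom_closed[OF CC f])
    fix g assume g: "g \<in> carrier B"
    show "comult (f \<oplus>\<^bsub>B\<^esub> g) = comult f \<oplus>\<^bsub>?T\<^esub> comult g" by (rule mod_hom_add[OF CC f g])
    have fg: "f \<in> finite_dual R A" "g \<in> finite_dual R A" using f g by (simp_all add: B_simps(1))
    \<comment> \<open>With factors in \<open>A\<^sup>\<circ>\<close> the tensor is literally the
      product in \<open>tensor_algebra\<close>. Its values identify it with the comultiplication of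
      the product.\<close>
    note t = conv_tensor_product[OF module_C C_eval conv_bilinear_C fg]
    show "comult (f \<otimes>\<^bsub>B\<^esub> g) = comult f \<otimes>\<^bsub>?T\<^esub> comult g"
      using comult_eqI[OF conv_closed[OF fg] t] by (simp add: tensor_algebra_def tensor_B)
  next
    have "comult \<one>\<^bsub>B\<^esub> = pure_tensor R C C \<one>\<^bsub>B\<^esub> \<one>\<^bsub>B\<^esub>"
    proof (rule comult_eqI[OF one_closed_B])
      show "pure_tensor R C C \<one>\<^bsub>B\<^esub> \<one>\<^bsub>B\<^esub> \<in> carrier CC"
        by (rule pure_tensor_closed[OF module_C module_C]) (simp_all add: one_closed_B)
      show "ev a b (pure_tensor R C C \<one>\<^bsub>B\<^esub> \<one>\<^bsub>B\<^esub>) = \<one>\<^bsub>B\<^esub> (a \<otimes>\<^bsub>A\<^esub> b)"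
        if "a \<in> carrier A" "b \<in> carrier A" for a b
        unfolding ev_pure_C[OF that one_closed_B one_closed_B] using that by (simp add: B_simps counit_mult)
    qed
    then show "comult \<one>\<^bsub>B\<^esub> = \<one>\<^bsub>?T\<^esub>"
      by (simp add: tensor_algebra_def tensor_B)
  qed
  with CC show "comult \<in> alg_hom R B ?T"
    by (simp add: alg_hom_def)
  have K: "counit \<in> mod_hom R B K"
    using finite_dual_counit_hom by (simp add: mod_hom_def B_simps)
  have "counit \<in> ring_hom B K"
  proof (rule ring_hom_memI)
    fix f assume f: "f \<in> carrier B"
    show "counit f \<in> carrier K" by (rule mod_hom_closed[OF K f])
    fix g assume g: "g \<in> carrier B"
    show "counit (f \<oplus>\<^bsub>B\<^esub> g) = counit f \<oplus>\<^bsub>K\<^esub> counit g" by (rule mod_hom_add[OF K f g])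
    have "f \<in> carrier D" "g \<in> carrier D" using f g by (simp_all add: B_simps(1) finite_dual_D)
    \<comment> \<open>The counit is evaluation at \<open>1\<close>, and
      \<open>\<Delta>(1) = 1 \<otimes> 1\<close> reduces the convolution there to a product of
      values.\<close>
    from tensor_lift_comult_one[OF module_K conv_bilinear[OF this]]
    show "counit (f \<otimes>\<^bsub>B\<^esub> g) = counit f \<otimes>\<^bsub>K\<^esub> counit g"
      by (simp add: finite_dual_counit_def conv_apply)
  next
    show "counit \<one>\<^bsub>B\<^esub> = \<one>\<^bsub>K\<^esub>"
      by (simp add: finite_dual_counit_def B_simps counit_one)
  qed
  with K show "counit \<in> alg_hom R B K"
    by (simp add: alg_hom_def)
qed

end

section \<open>The antipode\<close>

context hopf_algebra
begin

lemma antipode_closed: "a \<in> carrier H \<Longrightarrow> S a \<in> carrier H"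
  by (rule mod_hom_closed[OF antipode_hom])

lemma unit_hom:
  assumes "f \<in> mod_hom R H (ring_module R)" "c \<in> carrier H"
  shows "(\<lambda>x. f x \<odot>\<^bsub>H\<^esub> c) \<in> mod_hom R H H"
  by (rule mod_hom_smult_elem[OF assms module_axioms])

text \<open>\<open>S\<close> is the convolution inverse of the identity, so \<open>id * F = G\<close> gives \<open>F = S * G\<close>.\<close>

lemma antipode_cancel:
  assumes F: "F \<in> mod_hom R H H" and G: "G \<in> mod_hom R H H" and a: "a \<in> carrier H"
    and eq: "\<And>b. b \<in> carrier H \<Longrightarrow> tensor_lift R H (\<lambda>x y. x \<otimes>\<^bsub>H\<^esub> F y) (\<Delta> b) = G b"
  shows "tensor_lift R H (\<lambda>x y. S x \<otimes>\<^bsub>H\<^esub> G y) (\<Delta> a) = F a"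
proof -
  note M = module_axioms and m = bilinear_algebra_mult
  note dc = mod_hom_closed[OF comult_hom]
  note Fc = mod_hom_closed[OF F] and Sc = antipode_closed
  have tri: "trilinear_on R H H H H (\<lambda>x u v. S x \<otimes>\<^bsub>H\<^esub> (u \<otimes>\<^bsub>H\<^esub> F v))"
  proof (rule trilinear_onI)
    show "(\<lambda>v. S x \<otimes>\<^bsub>H\<^esub> (u \<otimes>\<^bsub>H\<^esub> F v)) \<in> mod_hom R H H" if "x \<in> carrier H" "u \<in> carrier H" for x u
      by (rule mod_hom_comp[OF mult_left_hom[OF Sc[OF that(1)]] mod_hom_comp[OF mult_left_hom[OF that(2)] F]])
    show "(\<lambda>u. S x \<otimes>\<^bsub>H\<^esub> (u \<otimes>\<^bsub>H\<^esub> F v)) \<in> mod_hom R H H" if "x \<in> carrier H" "v \<in> carrier H" for x v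
      by (rule mod_hom_comp[OF mult_left_hom[OF Sc[OF that(1)]] mult_right_hom[OF Fc[OF that(2)]]])
    show "(\<lambda>x. S x \<otimes>\<^bsub>H\<^esub> (u \<otimes>\<^bsub>H\<^esub> F v)) \<in> mod_hom R H H" if "u \<in> carrier H" "v \<in> carrier H" for u v
      using that Fc by (intro mod_hom_comp[OF mult_right_hom antipode_hom]) simp
  qed
  have "tensor_lift R H (\<lambda>x y. S x \<otimes>\<^bsub>H\<^esub> G y) (\<Delta> a) =
      tensor_lift R H (\<lambda>x y. tensor_lift R H (\<lambda>u v. S x \<otimes>\<^bsub>H\<^esub> (u \<otimes>\<^bsub>H\<^esub> F v)) (\<Delta> y)) (\<Delta> a)"
  proof (rule tensor_lift_cong[OF M M M comult_lift_bilinear_right[OF M comult_hom M tri] dc[OF a]])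
    fix x y assume x: "x \<in> carrier H" and y: "y \<in> carrier H"
    show "S x \<otimes>\<^bsub>H\<^esub> G y = tensor_lift R H (\<lambda>u v. S x \<otimes>\<^bsub>H\<^esub> (u \<otimes>\<^bsub>H\<^esub> F v)) (\<Delta> y)"
      unfolding eq[OF y, symmetric]
      by (rule tensor_lift_comp[OF M M M M mult_left_hom[OF Sc[OF x]]
            bilinear_on_precomp[OF m mod_hom_id F] dc[OF y]])
  qed
  also have "\<dots> = tensor_lift R H (\<lambda>x z. tensor_lift R H (\<lambda>u v. S u \<otimes>\<^bsub>H\<^esub> (v \<otimes>\<^bsub>H\<^esub> F z)) (\<Delta> x)) (\<Delta> a)"
    by (rule coassoc_lift[OF M tri a, symmetric])
  \<comment> \<open>After the change of bracketing, the inner sum over the first leg is the antipode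
    axiom multiplied on the right by \<open>F z\<close>.\<close>
  also have "\<dots> = tensor_lift R H (\<lambda>x z. \<epsilon> x \<odot>\<^bsub>H\<^esub> F z) (\<Delta> a)"
  proof (rule tensor_lift_cong[OF M M M bilinear_smult[OF counit_hom F M] dc[OF a]])
    fix x z assume x: "x \<in> carrier H" and z: "z \<in> carrier H"
    have Fz: "F z \<in> carrier H" by (rule Fc[OF z])
    note Sid = bilinear_on_precomp[OF m antipode_hom mod_hom_id]
    have "tensor_lift R H (\<lambda>u v. S u \<otimes>\<^bsub>H\<^esub> (v \<otimes>\<^bsub>H\<^esub> F z)) (\<Delta> x) =
        tensor_lift R H (\<lambda>u v. (S u \<otimes>\<^bsub>H\<^esub> v) \<otimes>\<^bsub>H\<^esub> F z) (\<Delta> x)"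
      by (rule tensor_lift_cong[OF M M M bilinear_on_comp[OF mult_right_hom[OF Fz] Sid] dc[OF x]])
        (simp add: A.m_assoc Sc Fz)
    also have "\<dots> = tensor_lift R H (\<lambda>u v. S u \<otimes>\<^bsub>H\<^esub> v) (\<Delta> x) \<otimes>\<^bsub>H\<^esub> F z"
      by (rule tensor_lift_comp[OF M M M M mult_right_hom[OF Fz] Sid dc[OF x], symmetric])
    also have "\<dots> = \<epsilon> x \<odot>\<^bsub>H\<^esub> F z"
      using x Fz by (simp add: antipode_left smult_mult_left counit_closed)
    finally show "tensor_lift R H (\<lambda>u v. S u \<otimes>\<^bsub>H\<^esub> (v \<otimes>\<^bsub>H\<^esub> F z)) (\<Delta> x) = \<epsilon> x \<odot>\<^bsub>H\<^esub> F z" .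
  qed
  also have "\<dots> = F a"
    by (rule counit_left_lift[OF M F a])
  finally show ?thesis .
qed

text \<open>
  With \<open>W(c) = \<Sum> b\<^sub>1 S(c b\<^sub>2)\<close>, the convolution \<open>id * W\<close> is \<open>c \<mapsto> \<epsilon>(c b) 1\<close>, so that \<open>W(c) = \<epsilon>(b) S(c)\<close> by
  cancellation; this says that \<open>id * (b \<mapsto> S(a b)) = (b \<mapsto> \<epsilon>(b) S(a))\<close>, and cancelling once more gives
  \<open>S(a b) = S(b) S(a)\<close>.
\<close>

lemma antipode_mult:
  assumes a: "a \<in> carrier H" and b: "b \<in> carrier H"
  shows "S (a \<otimes>\<^bsub>H\<^esub> b) = S b \<otimes>\<^bsub>H\<^esub> S a"
proof -
  note M = module_axioms and m = bilinear_algebra_mult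
  note dc = mod_hom_closed[OF comult_hom]
  note Sc = antipode_closed
  note idS = bilinear_on_precomp[OF m mod_hom_id antipode_hom]
  have F: "(\<lambda>y. S (c \<otimes>\<^bsub>H\<^esub> y)) \<in> mod_hom R H H" if "c \<in> carrier H" for c
    by (rule mod_hom_comp[OF antipode_hom mult_left_hom[OF that]])
  have F': "(\<lambda>c. S (c \<otimes>\<^bsub>H\<^esub> y)) \<in> mod_hom R H H" if "y \<in> carrier H" for y
    by (rule mod_hom_comp[OF antipode_hom mult_right_hom[OF that]])
  have bF: "bilinear_on R H H H (\<lambda>x y. x \<otimes>\<^bsub>H\<^esub> S (c \<otimes>\<^bsub>H\<^esub> y))" if "c \<in> carrier H" for c
    by (rule bilinear_on_precomp[OF m mod_hom_id F[OF that]])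
  define W where "W b c = tensor_lift R H (\<lambda>x y. x \<otimes>\<^bsub>H\<^esub> S (c \<otimes>\<^bsub>H\<^esub> y)) (\<Delta> b)" for b c
  have W_eq: "W b c = \<epsilon> b \<odot>\<^bsub>H\<^esub> S c" if b: "b \<in> carrier H" and c: "c \<in> carrier H" for b c
  proof -
    have WH: "W b \<in> mod_hom R H H"
      unfolding W_def
    proof (rule tensor_lift_param_hom[OF M M M M dc[OF b] bF])
      show "(\<lambda>c. x \<otimes>\<^bsub>H\<^esub> S (c \<otimes>\<^bsub>H\<^esub> y)) \<in> mod_hom R H H" if "x \<in> carrier H" "y \<in> carrier H" for x y
        by (rule mod_hom_comp[OF mult_left_hom[OF that(1)] F'[OF that(2)]])
    qed
    have eb: "\<epsilon> b \<in> carrier R" by (rule counit_closed[OF b])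
    let ?G = "\<lambda>y. \<epsilon> y \<odot>\<^bsub>H\<^esub> (\<epsilon> b \<odot>\<^bsub>H\<^esub> \<one>\<^bsub>H\<^esub>)"
    have G: "?G \<in> mod_hom R H H"
      using eb by (intro unit_hom[OF counit_hom]) simp
    have "tensor_lift R H (\<lambda>x y. x \<otimes>\<^bsub>H\<^esub> W b y) (\<Delta> d) = ?G d" if d: "d \<in> carrier H" for d
    proof -
      have q1: "bilinear_on R H H H (\<lambda>u v. (x \<otimes>\<^bsub>H\<^esub> u) \<otimes>\<^bsub>H\<^esub> S (y \<otimes>\<^bsub>H\<^esub> v))"
        if "x \<in> carrier H" "y \<in> carrier H" for x y
        by (rule bilinear_on_precomp[OF m mult_left_hom[OF that(1)] F[OF that(2)]])
      have q2: "bilinear_on R H H H (\<lambda>x y. (x \<otimes>\<^bsub>H\<^esub> u) \<otimes>\<^bsub>H\<^esub> S (y \<otimes>\<^bsub>H\<^esub> v))"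
        if "u \<in> carrier H" "v \<in> carrier H" for u v
        by (rule bilinear_on_precomp[OF m mult_right_hom[OF that(1)] F'[OF that(2)]])
      have "tensor_lift R H (\<lambda>x y. x \<otimes>\<^bsub>H\<^esub> W b y) (\<Delta> d) =
          tensor_lift R H (\<lambda>x y. tensor_lift R H (\<lambda>u v. (x \<otimes>\<^bsub>H\<^esub> u) \<otimes>\<^bsub>H\<^esub> S (y \<otimes>\<^bsub>H\<^esub> v)) (\<Delta> b)) (\<Delta> d)"
      proof (rule tensor_lift_cong[OF M M M tensor_lift_bilinear[OF M M M M M dc[OF b] q1 q2] dc[OF d]])
        fix x y assume x: "x \<in> carrier H" and y: "y \<in> carrier H"
        have "x \<otimes>\<^bsub>H\<^esub> W b y = tensor_lift R H (\<lambda>u v. x \<otimes>\<^bsub>H\<^esub> (u \<otimes>\<^bsub>H\<^esub> S (y \<otimes>\<^bsub>H\<^esub> v))) (\<Delta> b)"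
          unfolding W_def by (rule tensor_lift_comp[OF M M M M mult_left_hom[OF x] bF[OF y] dc[OF b]])
        also have "\<dots> = tensor_lift R H (\<lambda>u v. (x \<otimes>\<^bsub>H\<^esub> u) \<otimes>\<^bsub>H\<^esub> S (y \<otimes>\<^bsub>H\<^esub> v)) (\<Delta> b)"
          by (rule tensor_lift_cong[OF M M M q1[OF x y] dc[OF b]]) (simp add: A.m_assoc x y Sc)
        finally show "x \<otimes>\<^bsub>H\<^esub> W b y = tensor_lift R H (\<lambda>u v. (x \<otimes>\<^bsub>H\<^esub> u) \<otimes>\<^bsub>H\<^esub> S (y \<otimes>\<^bsub>H\<^esub> v)) (\<Delta> b)" .
      qed
      \<comment> \<open>Multiplicativity of \<open>\<Delta>\<close>, read backwards, recognises the
        double sum as the antipode axiom for the product \<open>d b\<close>.\<close>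
      also have "\<dots> = tensor_lift R H (\<lambda>x y. x \<otimes>\<^bsub>H\<^esub> S y) (\<Delta> (d \<otimes>\<^bsub>H\<^esub> b))"
        by (rule tensor_lift_comult_mult[OF M idS d b, symmetric])
      also have "\<dots> = ?G d"
        using d b eb by (simp add: antipode_right counit_mult smult_assoc1 counit_closed)
      finally show ?thesis .
    qed
    from antipode_cancel[OF WH G c this]
    have "W b c = tensor_lift R H (\<lambda>x y. S x \<otimes>\<^bsub>H\<^esub> ?G y) (\<Delta> c)" by simp
    also have "\<dots> = tensor_lift R H (\<lambda>x y. \<epsilon> y \<odot>\<^bsub>H\<^esub> (\<epsilon> b \<odot>\<^bsub>H\<^esub> S x)) (\<Delta> c)"
      by (rule tensor_lift_cong[OF M M M bilinear_on_flip[OF bilinear_smult[OF counit_hom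
              mod_hom_smult_fun[OF antipode_hom eb M] M]] dc[OF c]])
        (simp add: smult_mult_right eb Sc counit_closed)
    also have "\<dots> = \<epsilon> b \<odot>\<^bsub>H\<^esub> S c"
      by (rule counit_right_lift[OF M mod_hom_smult_fun[OF antipode_hom eb M] c])
    finally show ?thesis .
  qed
  have Sa: "S a \<in> carrier H" by (rule Sc[OF a])
  have "S (a \<otimes>\<^bsub>H\<^esub> b) = tensor_lift R H (\<lambda>x y. S x \<otimes>\<^bsub>H\<^esub> (\<epsilon> y \<odot>\<^bsub>H\<^esub> S a)) (\<Delta> b)"
    using W_eq[OF _ a] by (intro antipode_cancel[OF F[OF a] unit_hom[OF counit_hom Sa] b, symmetric])
      (simp add: W_def)
  also have "\<dots> = tensor_lift R H (\<lambda>x y. \<epsilon> y \<odot>\<^bsub>H\<^esub> (S x \<otimes>\<^bsub>H\<^esub> S a)) (\<Delta> b)"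
    by (rule tensor_lift_cong[OF M M M bilinear_on_flip[OF bilinear_smult[OF counit_hom
            mod_hom_comp[OF mult_right_hom[OF Sa] antipode_hom] M]] dc[OF b]])
      (simp add: smult_mult_right Sa Sc counit_closed)
  also have "\<dots> = S b \<otimes>\<^bsub>H\<^esub> S a"
    by (rule counit_right_lift[OF M mod_hom_comp[OF mult_right_hom[OF Sa] antipode_hom] b])
  finally show ?thesis .
qed

end

section \<open>The antipode of \<open>A\<^sup>\<circ>\<close>\<close>

locale property_P_hopf_algebra = property_P_bialgebra R A \<Delta> \<epsilon> + hopf_algebra R A \<Delta> \<epsilon> S
  for R (structure) and A (structure) and \<Delta> and \<epsilon> and S
begin

abbreviation "antip \<equiv> finite_dual_antipode A S"

lemma antip_apply: "a \<in> carrier A \<Longrightarrow> antip f a = f (S a)"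
  by (simp add: finite_dual_antipode_def)

lemma antip_D_hom: "antip \<in> mod_hom R D D"
  unfolding finite_dual_antipode_def[abs_def] dual_module_def[of R A]
proof (rule mod_hom_into_hom_module[OF module_axioms module_K module_D[unfolded dual_module_def]],
    fold dual_module_def)
  show "(\<lambda>a. f (S a)) \<in> mod_hom R A K" if "f \<in> carrier D" for f
    by (rule mod_hom_comp[OF D_hom[OF that] antipode_hom])
  show "(\<lambda>f. f (S a)) \<in> mod_hom R D K" if "a \<in> carrier A" for a
    by (rule D_eval[OF antipode_closed[OF that]])
qed

text \<open>Because the antipode reverses products,
  \<open>f(S(a c)) = \<Sum> f\<^sub>1(S(c)) f\<^sub>2(S(a))\<close>. The required tensor is
  therefore \<open>comult f\<close> with its factors exchanged and both composed with
  \<open>S\<close>.\<close>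

lemma antip_closed:
  assumes f: "f \<in> finite_dual R A"
  shows "antip f \<in> finite_dual R A"
proof -
  note cf = comult_closed[OF f]
  note DD = module_tensor[OF module_D module_D]
  note CD = mod_hom_comp[OF antip_D_hom incl_CD]
  note b = bilinear_on_flip[OF bilinear_pure_precomp[OF module_D module_D CD CD]]
  show ?thesis
  proof (rule finite_dualI)
    show "antip f \<in> carrier D"
      by (rule mod_hom_closed[OF antip_D_hom finite_dual_D[OF f]])
    let ?t = "tensor_lift R (tensor R D D) (\<lambda>x y. pure_tensor R D D (antip y) (antip x)) (comult f)"
    show "?t \<in> carrier (tensor R D D)"
      by (rule mod_hom_closed[OF tensor_lift_hom[OF module_C module_C DD b] cf])
    fix a c assume a: "a \<in> carrier A" and c: "c \<in> carrier A"
    note Sa = antipode_closed[OF a] and Sc = antipode_closed[OF c]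
    have "ev a c ?t = tensor_lift R K (\<lambda>x y. ev a c (pure_tensor R D D (antip y) (antip x))) (comult f)"
      by (rule tensor_lift_comp[OF module_C module_C DD module_K ev_hom_D[OF a c] b cf])
    also have "\<dots> = ev (S c) (S a) (comult f)"
    proof (rule tensor_lift_cong[OF module_C module_C module_K ev_bilinear_C[OF Sc Sa] cf])
      fix x y assume xy: "x \<in> carrier C" "y \<in> carrier C"
      show "ev a c (pure_tensor R D D (antip y) (antip x)) = x (S c) \<otimes> y (S a)"
        unfolding ev_pure_D[OF a c mod_hom_closed[OF CD xy(2)] mod_hom_closed[OF CD xy(1)]]
        using xy a c Sa Sc by (simp add: antip_apply R.m_comm C_closed)
    qed
    also have "\<dots> = antip f (a \<otimes>\<^bsub>A\<^esub> c)"
      using a c by (simp add: ev_comult[OF f Sc Sa] antip_apply antipode_mult)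
    finally show "antip f (a \<otimes>\<^bsub>A\<^esub> c) = ev a c ?t" by simp
  qed
qed

lemma antip_C_hom: "antip \<in> mod_hom R C C"
  by (rule mod_hom_into_C[OF mod_hom_comp[OF antip_D_hom incl_CD, simplified]])
    (auto intro: antip_closed)

lemma unit_B_apply: "a \<in> carrier A \<Longrightarrow> (counit f \<odot>\<^bsub>B\<^esub> \<one>\<^bsub>B\<^esub>) a = f \<one>\<^bsub>A\<^esub> \<otimes> \<epsilon> a"
  by (simp add: B_simps D_apply finite_dual_counit_def)

lemma lift_B_eq_lift_C: "tensor_lift R B = tensor_lift R C"
  by (rule tensor_lift_transfer) (simp_all add: B_simps)

text \<open>Covers both antipode axioms: one of \<open>P\<close>, \<open>Q\<close> is
  \<open>S\<close> and the other the identity, with \<open>p\<close>, \<open>q\<close> their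
  transposes. At \<open>a\<close> the left side is \<open>\<Sum> f\<^sub>1(P a\<^sub>1) f\<^sub>2(Q
  a\<^sub>2) = f(\<Sum> P a\<^sub>1 Q a\<^sub>2) = \<epsilon>(a) f(1)\<close>.\<close>

lemma antipode_convolution:
  assumes f: "f \<in> finite_dual R A" and p: "p \<in> mod_hom R C C" "q \<in> mod_hom R C C"
    and PQ: "P \<in> mod_hom R A A" "Q \<in> mod_hom R A A"
    and p_apply: "\<And>x a. x \<in> finite_dual R A \<Longrightarrow> a \<in> carrier A \<Longrightarrow> p x a = x (P a)"
    and q_apply: "\<And>x a. x \<in> finite_dual R A \<Longrightarrow> a \<in> carrier A \<Longrightarrow> q x a = x (Q a)"
    and inverse: "\<And>a. a \<in> carrier A \<Longrightarrow> tensor_lift R A (\<lambda>u v. P u \<otimes>\<^bsub>A\<^esub> Q v) (\<Delta> a) = \<epsilon> a \<odot>\<^bsub>A\<^esub> \<one>\<^bsub>A\<^esub>"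
  shows "tensor_lift R B (\<lambda>x y. p x \<otimes>\<^bsub>B\<^esub> q y) (comult f) = counit f \<odot>\<^bsub>B\<^esub> \<one>\<^bsub>B\<^esub>"
proof -
  note A = module_axioms and CCK = module_C module_C module_K
  note cf = comult_closed[OF f] and fD = D_hom[OF finite_dual_D[OF f]]
  note b = bilinear_on_precomp[OF conv_bilinear_C p]
  note PQ_mult = bilinear_on_precomp[OF bilinear_algebra_mult PQ]
  interpret B: module R B by (rule module_B)
  have f1: "f \<one>\<^bsub>A\<^esub> \<in> carrier R" by (rule C_closed[OF f A.one_closed])
  show ?thesis
    unfolding lift_B_eq_lift_C
  proof (rule C_eqI)
    show "tensor_lift R C (\<lambda>x y. p x \<otimes>\<^bsub>B\<^esub> q y) (comult f) \<in> carrier C"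
      by (rule mod_hom_closed[OF tensor_lift_hom[OF module_C module_C module_C b] cf])
    show "counit f \<odot>\<^bsub>B\<^esub> \<one>\<^bsub>B\<^esub> \<in> carrier C"
      using B.smult_closed[of "counit f" "\<one>\<^bsub>B\<^esub>"] f1 one_closed_B
      by (simp add: finite_dual_counit_def B_simps(1))
    fix a assume a: "a \<in> carrier A"
    note da = comult_A_closed[OF a]
    have Pc: "P u \<in> carrier A" and Qc: "Q u \<in> carrier A" if "u \<in> carrier A" for u
      using mod_hom_closed[OF PQ(1) that] mod_hom_closed[OF PQ(2) that] .
    have q1: "bilinear_on R A A K (\<lambda>u v. x (P u) \<otimes> y (Q v))" if "x \<in> carrier C" "y \<in> carrier C" for x y
      using that by (intro bilinear_mult mod_hom_comp[OF D_hom PQ(1)] mod_hom_comp[OF D_hom PQ(2)] finite_dual_D)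
        simp_all
    have q2: "bilinear_on R C C K (\<lambda>x y. x (P u) \<otimes> y (Q v))" if "u \<in> carrier A" "v \<in> carrier A" for u v
      by (rule ev_bilinear_C[OF Pc[OF that(1)] Qc[OF that(2)]])
    have "tensor_lift R C (\<lambda>x y. p x \<otimes>\<^bsub>B\<^esub> q y) (comult f) a =
        tensor_lift R K (\<lambda>x y. (p x \<otimes>\<^bsub>B\<^esub> q y) a) (comult f)"
      by (rule tensor_lift_comp[OF module_C module_C module_C module_K C_eval[OF a] b cf])
    also have "\<dots> = tensor_lift R K (\<lambda>x y. tensor_lift R K (\<lambda>u v. x (P u) \<otimes> y (Q v)) (\<Delta> a)) (comult f)"
    proof (rule tensor_lift_cong[OF CCK tensor_lift_bilinear[where T = "\<lambda>x y u v. x (P u) \<otimes> y (Q v)",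
            OF module_C module_C A A module_K da q1 q2] cf])
      fix x y assume xy: "x \<in> carrier C" "y \<in> carrier C"
      show "(p x \<otimes>\<^bsub>B\<^esub> q y) a = tensor_lift R K (\<lambda>u v. x (P u) \<otimes> y (Q v)) (\<Delta> a)"
        unfolding conv_apply[OF a] using xy
        by (intro tensor_lift_cong[OF A A module_K q1[OF xy] da]) (simp add: p_apply q_apply)
    qed
    \<comment> \<open>Exchanging the sums brings the one over \<open>comult f\<close> inside, where
      it evaluates \<open>f\<close> at a product.\<close>
    also have "\<dots> = tensor_lift R K (\<lambda>u v. tensor_lift R K (\<lambda>x y. x (P u) \<otimes> y (Q v)) (comult f)) (\<Delta> a)"
      by (rule tensor_lift_swap[where T = "\<lambda>x y u v. x (P u) \<otimes> y (Q v)",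
            OF module_C module_C A A module_K cf da q1 q2])
    also have "\<dots> = tensor_lift R K (\<lambda>u v. f (P u \<otimes>\<^bsub>A\<^esub> Q v)) (\<Delta> a)"
      by (rule tensor_lift_cong[OF A A module_K bilinear_on_comp[OF fD PQ_mult] da])
        (rule ev_comult[OF f Pc Qc])
    also have "\<dots> = f (tensor_lift R A (\<lambda>u v. P u \<otimes>\<^bsub>A\<^esub> Q v) (\<Delta> a))"
      by (rule tensor_lift_comp[OF A A A module_K fD PQ_mult da, symmetric])
    also have "\<dots> = \<epsilon> a \<otimes> f \<one>\<^bsub>A\<^esub>"
      using mod_hom_smult[OF fD counit_closed[OF a] A.one_closed] by (simp add: inverse[OF a])
    also have "\<dots> = (counit f \<odot>\<^bsub>B\<^esub> \<one>\<^bsub>B\<^esub>) a"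
      unfolding unit_B_apply[OF a] by (rule R.m_comm[OF counit_closed[OF a] f1])
    finally show "tensor_lift R C (\<lambda>x y. p x \<otimes>\<^bsub>B\<^esub> q y) (comult f) a = (counit f \<odot>\<^bsub>B\<^esub> \<one>\<^bsub>B\<^esub>) a" .
  qed
qed

lemma hopf_algebra_finite_dual: "hopf_algebra R B comult counit antip"
proof (intro hopf_algebra.intro hopf_algebra_axioms.intro bialgebra_finite_dual)
  show "antip \<in> mod_hom R B B"
    using antip_C_hom by (simp add: mod_hom_def B_simps)
  fix f assume "f \<in> carrier B"
  then have f: "f \<in> finite_dual R A" by (simp add: B_simps(1))
  show "tensor_lift R B (\<lambda>x y. antip x \<otimes>\<^bsub>B\<^esub> y) (comult f) = counit f \<odot>\<^bsub>B\<^esub> \<one>\<^bsub>B\<^esub>"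
    by (rule antipode_convolution[OF f antip_C_hom mod_hom_id antipode_hom mod_hom_id antip_apply _ antipode_left])
      simp_all
  show "tensor_lift R B (\<lambda>x y. x \<otimes>\<^bsub>B\<^esub> antip y) (comult f) = counit f \<odot>\<^bsub>B\<^esub> \<one>\<^bsub>B\<^esub>"
    by (rule antipode_convolution[OF f mod_hom_id antip_C_hom mod_hom_id antipode_hom _ antip_apply antipode_right])
      simp_all
qed

end

text \<open>The clause of unique existence certifies that the description in
  \<open>finite_dual_comult\<close> denotes the canonical comultiplication. The bialgebra and Hopf
  algebra clauses use the same comultiplication and counit on \<open>A\<^sup>\<circ>\<close>,
  whichever structure on \<open>A\<close> is given; only the product, the unit and the antipode
  depend on it.\<close>

theorem corollary4p3:
  fixes R :: "'r ring" and A :: "('r, 'a) module"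
  assumes "cring R" and "noetherian_ring R" and "assoc_algebra R A" and "property_P_left R A"
  shows
    "(\<forall>f\<in>finite_dual R A. \<exists>!t. is_finite_dual_comult R A f t) \<and>
     coalgebra R (finite_dual_module R A) (finite_dual_comult R A) (finite_dual_counit A) \<and>
     (\<forall>\<Delta> \<epsilon>. bialgebra R A \<Delta> \<epsilon> \<longrightarrow>
        bialgebra R (finite_dual_algebra R A \<Delta> \<epsilon>) (finite_dual_comult R A) (finite_dual_counit A)) \<and>
     (\<forall>\<Delta> \<epsilon> S. hopf_algebra R A \<Delta> \<epsilon> S \<longrightarrow>
        hopf_algebra R (finite_dual_algebra R A \<Delta> \<epsilon>) (finite_dual_comult R A) (finite_dual_counit A)
          (finite_dual_antipode A S)) \<and>
     rational_pairing TYPE('m) R (finite_dual_module R A) (finite_dual_comult R A)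
       (finite_dual_counit A) A (\<lambda>f a. f a)"
proof -
  have P: "property_P_algebra R A"
    using assms by (simp add: property_P_algebra_def property_P_algebra_axioms_def
        noetherian_algebra_def noetherian_algebra_axioms_def)
  then interpret property_P_algebra R A .
  have bialg: "property_P_bialgebra R A \<Delta> \<epsilon>" if "bialgebra R A \<Delta> \<epsilon>" for \<Delta> \<epsilon>
    using P that by (rule property_P_bialgebra.intro)
  have hopf: "property_P_hopf_algebra R A \<Delta> \<epsilon> S" if "hopf_algebra R A \<Delta> \<epsilon> S" for \<Delta> \<epsilon> S
    using bialg[OF hopf_algebra.axioms(1)[OF that]] that by (rule property_P_hopf_algebra.intro)
  show ?thesis
    by (intro conjI allI impI ballI)
      (erule finite_dual_comult_ex1, rule coalgebra_finite_dual,
        erule property_P_bialgebra.bialgebra_finite_dual[OF bialg],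
        erule property_P_hopf_algebra.hopf_algebra_finite_dual[OF hopf],
        rule rational_pairing_finite_dual)
qed

end
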